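(* Unless $\mathrm{P}=\mathrm{NP}$, for every $\epsilon\in(0,1)$ and every non-decreasing function $r$ with $r(n)=O(n^{1-\epsilon})$, there is no polynomial-time $r(\cdot)$-approximation algorithm for the Maximum Reachability Trip Temporalisation problem (mrtt), where $n$ is the number of nodes; i.e. no polynomial-time algorithm that, on every input trip network with $n$ nodes, returns a temporalisation whose temporal reachability is at least $1/r(n)$ times the maximum possible.
   Context: A weighted multidigraph $D=(V,E)$ has a finite node set $V$ and a finite multiset $E$ of edges $(u,v,w)$ with tail $u$, head $v$ and weight $w>0$. A walk is a sequence of edges $e_1,\dots,e_k$ where the head of $e_i$ equals the tail of $e_{i+1}$. A trip network is a pair $(D,\mathbb{T})$ where $\mathbb{T}$ is a finite multiset of walks in $D$, called trips; every node and edge of $D$ appears in some trip. A temporalisation $\tau$ assigns a real starting time $\tau(T)$ to each trip. For a trip $T=e_1,\dots,e_k$ with $e_i=(u_i,v_i,w_i)$, it induces temporal edges $(u_i,v_i,\tau(T)+\sum_{j<i}w_j,w_i)$ (tail, head, starting time, travel time). The induced temporal graph $G[D,\mathbb{T},\tau]$ has node set $V$ and all temporal edges induced by all trips (disjoint union). A temporal path from $u$ to $v$ is a sequence of temporal edges $f_1,\dots,f_k$ from $u$ to $v$, consecutive (head of $f_i$ = tail of $f_{i+1}$), with the starting time of $f_{i+1}$ at least the arrival time (starting time plus travel time) of $f_i$. $v$ is temporally reachable from $u$ if such a path exists (every node reaches itself). The temporal reachability ($\tau$-reachability) of the trip network is $\sum_{u\in V}|\{v: v \text{ temporally reachable from }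 u \text{ in } G[D,\mathbb{T},\tau]\}|$. The mrtt problem: given a trip network, find a temporalisation maximising its $\tau$-reachability. *)

theory Defs
  imports
    Complex_Main
    "HOL-Library.Multiset"
    "HOL-Library.Landau_Symbols"
    "HOL-Computational_Algebra.Polynomial"
begin

section \<open>Trip networks and their temporal reachability\<close>

type_synonym 'v edge = "'v \<times> 'v \<times> real"

definition tail :: "'v edge \<Rightarrow> 'v" where "tail e = fst e"
definition head :: "'v edge \<Rightarrow> 'v" where "head e = fst (snd e)"
definition weight :: "'v edge \<Rightarrow> real" where "weight e = snd (snd e)"

text \<open>The multiset of trips is given by an enumeration, so that equal trips can be told
  apart by their index; a temporalisation maps trip indices to starting times.\<close>

record 'v trip_network =
  nodes :: "'v set"
  edges :: "'v edge multiset"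
  trips :: "'v edge list list"

type_synonym temporalisation = "nat \<Rightarrow> real"

definition walk :: "'v edge multiset \<Rightarrow> 'v edge list \<Rightarrow> bool" where
  "walk E T \<longleftrightarrow> T \<noteq> [] \<and> set T \<subseteq> set_mset E \<and> successively (\<lambda>e e'. head e = tail e') T"

definition is_trip_network :: "'v trip_network \<Rightarrow> bool" where
  "is_trip_network N \<longleftrightarrow>
     finite (nodes N) \<and>
     (\<forall>e \<in># edges N. tail e \<in> nodes N \<and> head e \<in> nodes N \<and> weight e > 0) \<and>
     (\<forall>T \<in> set (trips N). walk (edges N) T) \<and>
     (\<forall>v \<in> nodes N. \<exists>T \<in> set (trips N). \<exists>e \<in> set T. v = tail e \<or> v = head e) \<and>
     (\<forall>e \<in># edges N. \<exists>T \<in> set (trips N). e \<in> set T)"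

text \<open>Tail, head, starting time, travel time.\<close>

type_synonym 'v temporal_edge = "'v \<times> 'v \<times> real \<times> real"

definition t_tail :: "'v temporal_edge \<Rightarrow> 'v" where "t_tail f = fst f"
definition t_head :: "'v temporal_edge \<Rightarrow> 'v" where "t_head f = fst (snd f)"
definition t_start :: "'v temporal_edge \<Rightarrow> real" where "t_start f = fst (snd (snd f))"
definition t_travel :: "'v temporal_edge \<Rightarrow> real" where "t_travel f = snd (snd (snd f))"
definition t_arrival :: "'v temporal_edge \<Rightarrow> real" where "t_arrival f = t_start f + t_travel f"

definition induced_edges :: "real \<Rightarrow> 'v edge list \<Rightarrow> 'v temporal_edge list" where
  "induced_edges s T =
     map (\<lambda>i. (tail (T ! i), head (T ! i), s + (\<Sum>j<i. weight (T ! j)), weight (T ! i)))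
       [0..<length T]"

definition temporal_edges :: "'v trip_network \<Rightarrow> temporalisation \<Rightarrow> 'v temporal_edge multiset" where
  "temporal_edges N \<tau> = (\<Sum>i<length (trips N). mset (induced_edges (\<tau> i) (trips N ! i)))"

definition temporal_path ::
    "'v temporal_edge multiset \<Rightarrow> 'v \<Rightarrow> 'v temporal_edge list \<Rightarrow> 'v \<Rightarrow> bool" where
  "temporal_path F u fs v \<longleftrightarrow>
     fs \<noteq> [] \<and> set fs \<subseteq> set_mset F \<and> t_tail (hd fs) = u \<and> t_head (last fs) = v \<and>
     successively (\<lambda>f f'. t_head f = t_tail f' \<and> t_start f' \<ge> t_arrival f) fs"

definition temporally_reachable :: "'v temporal_edge multiset \<Rightarrow> 'v \<Rightarrow> 'v \<Rightarrow> bool" where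
  "temporally_reachable F u v \<longleftrightarrow> u = v \<or> (\<exists>fs. temporal_path F u fs v)"

definition temporal_reachability :: "'v trip_network \<Rightarrow> temporalisation \<Rightarrow> nat" where
  "temporal_reachability N \<tau> =
     (\<Sum>u \<in> nodes N. card {v \<in> nodes N. temporally_reachable (temporal_edges N \<tau>) u v})"

definition max_reachability :: "'v trip_network \<Rightarrow> nat" where
  "max_reachability N = Max (range (temporal_reachability N))"


section \<open>Turing machines, P and NP\<close>

text \<open>Deterministic multi-tape machines with two-way infinite tapes. The non-halting states
  are \<open>0, \<dots>, states M - 1\<close>, with initial state \<open>0\<close>; the halting state is \<open>states M\<close>. The tape
  symbols are \<open>0, \<dots>, symbols M - 1\<close>: \<open>0\<close> is the blank, \<open>1\<close> and \<open>2\<close> represent the bits.\<close>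

datatype move = MoveLeft | Stay | MoveRight

record tm =
  tapes :: nat
  states :: nat
  symbols :: nat
  delta :: "nat \<Rightarrow> nat list \<Rightarrow> nat \<times> (nat \<times> move) list"

definition is_tm :: "tm \<Rightarrow> bool" where
  "is_tm M \<longleftrightarrow> tapes M \<ge> 2 \<and> symbols M \<ge> 3 \<and>
     (\<forall>q < states M. \<forall>ss. length ss = tapes M \<and> (\<forall>s \<in> set ss. s < symbols M) \<longrightarrow>
        (case delta M q ss of (q', as) \<Rightarrow>
           q' \<le> states M \<and> length as = tapes M \<and> (\<forall>(s', m) \<in> set as. s' < symbols M)))"

text \<open>Tape contents and head position.\<close>

type_synonym tape = "(int \<Rightarrow> nat) \<times> int"
type_synonym config = "nat \<times> tape list"

definition read_tape :: "tape \<Rightarrow> nat" where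
  "read_tape T = fst T (snd T)"

fun move_head :: "move \<Rightarrow> int \<Rightarrow> int" where
  "move_head MoveLeft h = h - 1"
| "move_head Stay h = h"
| "move_head MoveRight h = h + 1"

definition act :: "nat \<times> move \<Rightarrow> tape \<Rightarrow> tape" where
  "act a T = ((fst T)(snd T := fst a), move_head (snd a) (snd T))"

definition tm_step :: "tm \<Rightarrow> config \<Rightarrow> config" where
  "tm_step M c =
     (if fst c = states M then c
      else (case delta M (fst c) (map read_tape (snd c)) of
              (q', as) \<Rightarrow> (q', map2 act as (snd c))))"

definition bit_symbol :: "bool \<Rightarrow> nat" where
  "bit_symbol b = (if b then 2 else 1)"

definition input_tape :: "bool list \<Rightarrow> tape" where
  "input_tape x =
     ((\<lambda>i. if 0 \<le> i \<and> i < int (length x) then bit_symbol (x ! nat i) else 0), 0)"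

definition init_config :: "tm \<Rightarrow> bool list \<Rightarrow> config" where
  "init_config M x = (0, input_tape x # replicate (tapes M - 1) (\<lambda>_. 0, 0))"

definition tape_output :: "tape \<Rightarrow> bool list \<Rightarrow> bool" where
  "tape_output T y \<longleftrightarrow>
     (\<forall>i < length y. fst T (int i) = bit_symbol (y ! i)) \<and> fst T (int (length y)) = 0"

text \<open>On input \<open>x\<close> (on tape 0), \<open>M\<close> halts after at most \<open>t\<close> steps with output \<open>y\<close> (on tape 1).
  A halted configuration is a fixed point of \<open>tm_step\<close>.\<close>

definition outputs_within :: "tm \<Rightarrow> nat \<Rightarrow> bool list \<Rightarrow> bool list \<Rightarrow> bool" where
  "outputs_within M t x y \<longleftrightarrow>
     (let c = (tm_step M ^^ t) (init_config M x)
      in fst c = states M \<and> tape_output (snd c ! 1) y)"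

definition P_class :: "bool list set set" where
  "P_class = {L. \<exists>M p. is_tm M \<and>
     (\<forall>x. outputs_within M (poly (p :: nat poly) (length x)) x [x \<in> L])}"


subsection \<open>Prefix-free encodings as bit strings\<close>

definition enc_list :: "('a \<Rightarrow> bool list) \<Rightarrow> 'a list \<Rightarrow> bool list" where
  "enc_list f xs = concat (map (\<lambda>x. True # f x) xs) @ [False]"

definition enc_string :: "bool list \<Rightarrow> bool list" where
  "enc_string = enc_list (\<lambda>b. [b])"

definition enc_pair :: "bool list \<Rightarrow> bool list \<Rightarrow> bool list" where
  "enc_pair x y = enc_string x @ enc_string y"

definition NP_class :: "bool list set set" where
  "NP_class = {L. \<exists>V \<in> P_class. \<exists>q :: nat poly.
     \<forall>x. x \<in> L \<longleftrightarrow> (\<exists>y. length y \<le> poly q (length x) \<and> enc_pair x y \<in> V)}"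

text \<open>Binary digits, least significant first.\<close>

fun binary :: "nat \<Rightarrow> bool list" where
  "binary n = (if n = 0 then [] else odd n # binary (n div 2))"

declare binary.simps [simp del]

definition enc_nat :: "nat \<Rightarrow> bool list" where
  "enc_nat n = enc_string (binary n)"

definition enc_int :: "int \<Rightarrow> bool list" where
  "enc_int k = (k < 0) # enc_nat (nat \<bar>k\<bar>)"

definition enc_rat :: "rat \<Rightarrow> bool list" where
  "enc_rat q = (case quotient_of q of (a, b) \<Rightarrow> enc_int a @ enc_int b)"


section \<open>The approximation problem\<close>

text \<open>An input consists of the number \<open>n\<close> of nodes, which are \<open>0, \<dots>, n - 1\<close>, the edges and the
  trips; weights are rational numbers, written in binary.\<close>

type_synonym rat_edge = "nat \<times> nat \<times> rat"
type_synonym mrtt_input = "nat \<times> rat_edge list \<times> rat_edge list list"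

definition real_edge :: "rat_edge \<Rightarrow> nat edge" where
  "real_edge = (\<lambda>(u, v, w). (u, v, of_rat w))"

definition network_of :: "mrtt_input \<Rightarrow> nat trip_network" where
  "network_of = (\<lambda>(n, E, Ts).
     \<lparr> nodes = {..<n}, edges = mset (map real_edge E), trips = map (map real_edge) Ts \<rparr>)"

definition enc_edge :: "rat_edge \<Rightarrow> bool list" where
  "enc_edge = (\<lambda>(u, v, w). enc_nat u @ enc_nat v @ enc_rat w)"

definition enc_input :: "mrtt_input \<Rightarrow> bool list" where
  "enc_input = (\<lambda>(n, E, Ts).
     enc_nat n @ enc_list enc_edge E @ enc_list (enc_list enc_edge) Ts)"

text \<open>The output lists the (rational) starting times of the trips. The maximum in
  \<^const>\<open>max_reachability\<close> ranges over all real temporalisations.\<close>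

definition poly_time_approximation :: "(nat \<Rightarrow> real) \<Rightarrow> tm \<Rightarrow> bool" where
  "poly_time_approximation r M \<longleftrightarrow> is_tm M \<and>
     (\<exists>p :: nat poly. \<forall>I. is_trip_network (network_of I) \<longrightarrow>
        (\<exists>ts :: rat list.
           length ts = length (trips (network_of I)) \<and>
           outputs_within M (poly p (length (enc_input I))) (enc_input I) (enc_list enc_rat ts) \<and>
           real (temporal_reachability (network_of I) (\<lambda>i. of_rat (ts ! i)))
             \<ge> 1 / r (card (nodes (network_of I))) * real (max_reachability (network_of I))))"

end

theory Submission
  imports Defs
begin

text \<open>
  Suppose that \<open>M\<close> approximates the problem, and let \<open>L\<close> be in NP. The computation of a verifier
  on an input \<open>x\<close> and a certificate of fixed length is described by variables (the control state
  and the stack symbols at each time) and clauses which forbid the simultaneous values of at most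
  three variables. From these a trip network is built in which a node \<open>s\<close> can reach a node \<open>t\<close>
  temporally iff there is an accepting computation: on the way from \<open>s\<close>, a path first walks, for
  each variable, through a chain belonging to one value, then takes a bridge edge, and then crosses
  all clauses. A clause is crossed with the first edge of a trip whose last edge lies on the chain of
  the corresponding forbidden value, so this is possible only if that chain was not used before.
  Attaching \<open>K\<close> sources to \<open>s\<close> and \<open>K\<close> sinks to \<open>t\<close>, where \<open>K\<close> is a large power of the number of
  other nodes, turns this into a gap of more than \<open>r(n)\<close>. If \<open>x\<close> is in \<open>L\<close>, the temporalisation
  returned by \<open>M\<close> therefore lets a source reach a sink, and a certificate can be read off by
  comparing starting times with that of the bridge; it remains to run the verifier on it. So \<open>L\<close> is
  in P.

  Polynomial time is dealt with in a class of string functions which is closed under composition,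
  case distinction and bounded recursion on strings, and whose members are computed by structured
  programs on finitely many stacks. A stack is a Turing machine tape, so these programs decide
  languages in P; conversely they can simulate Turing machines, so the class also contains the
  functions computed by \<open>M\<close> and by the verifier. The computation described by the clauses is that
  of such a program, because the content of a stack relative to its top changes only locally.
\<close>


section \<open>Programs on stacks\<close>

text \<open>The value of the temporalisation returned by \<open>M\<close> is never computed: that
  would require evaluating temporal reachability in polynomial time. Only starting times are
  compared, and the verifier has the last word. So nothing has to be shown about the networks of
  inputs outside \<open>L\<close>, and the gap is used in one direction only: a value too large for
  a temporalisation without a path from a source to a sink yields a solution of the constraints. The
  gadget rests on two facts. The bridge is the only edge of its trip, so it can be used at one fixed
  time only, which splits all events into earlier and later ones. A trip has a single starting time,
  so if its last edge is used before the bridge, its first edge departs before the bridge as well.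
  Hence a clause is crossed only through a literal that was not chosen, whatever the temporalisation
  does. The certificate becomes legible through clauses that are always true: for each of its cells,
  one clause lists the values True, False, False, so that the position of one trip relative to the
  bridge reveals the value.\<close>

datatype prog =
    Skip
  | Push nat nat
  | Pop nat "nat \<Rightarrow> prog"
  | Seq prog prog
  | Loop nat "nat \<Rightarrow> prog"

type_synonym store = "nat \<Rightarrow> nat list"

definition top_symbol :: "nat list \<Rightarrow> nat" where
  "top_symbol w = (case w of [] \<Rightarrow> 0 | c # _ \<Rightarrow> c)"

lemma top_symbol_simps [simp]: "top_symbol [] = 0" "top_symbol (c # w) = c"
  by (simp_all add: top_symbol_def)

text \<open>The cost is chosen so that it equals the number of steps of the control in
  \<open>exec_sm\<close>. A loop body starts with the symbol already removed and may itself push on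
  or empty the stack that is looped over; \<open>main_loop\<close> and \<open>scan\<close> depend on
  this.\<close>

inductive exec :: "prog \<Rightarrow> store \<Rightarrow> nat \<Rightarrow> store \<Rightarrow> bool" where
  exec_Skip: "exec Skip \<sigma> 1 \<sigma>"
| exec_Push: "exec (Push k s) \<sigma> 1 (\<sigma>(k := s # \<sigma> k))"
| exec_Pop: "exec (B (top_symbol (\<sigma> k))) (\<sigma>(k := tl (\<sigma> k))) t \<sigma>' \<Longrightarrow> exec (Pop k B) \<sigma> (Suc t) \<sigma>'"
| exec_Seq: "exec P \<sigma> t \<sigma>' \<Longrightarrow> exec Q \<sigma>' t' \<sigma>'' \<Longrightarrow> exec (Seq P Q) \<sigma> (Suc (t + t')) \<sigma>''"
| exec_Loop_Nil: "\<sigma> k = [] \<Longrightarrow> exec (Loop k B) \<sigma> 1 \<sigma>"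
| exec_Loop_Cons: "\<sigma> k = c # w \<Longrightarrow> exec (B c) (\<sigma>(k := w)) t \<sigma>' \<Longrightarrow> exec (Loop k B) \<sigma>' t' \<sigma>'' \<Longrightarrow>
    exec (Loop k B) \<sigma> (Suc (t + t')) \<sigma>''"

text \<open>The number \<open>A\<close> bounds both the stack indices and the stack symbols; the symbol \<open>0\<close> is
  reserved for reading an empty stack.\<close>

primrec wf_prog :: "nat \<Rightarrow> prog \<Rightarrow> bool" where
  "wf_prog A Skip \<longleftrightarrow> True"
| "wf_prog A (Push k s) \<longleftrightarrow> k < A \<and> 0 < s \<and> s < A"
| "wf_prog A (Pop k B) \<longleftrightarrow> k < A \<and> (\<forall>c. wf_prog A (B c))"
| "wf_prog A (Seq P Q) \<longleftrightarrow> wf_prog A P \<and> wf_prog A Q"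
| "wf_prog A (Loop k B) \<longleftrightarrow> k < A \<and> (\<forall>c. wf_prog A (B c))"

lemma wf_prog_mono: "wf_prog A P \<Longrightarrow> A \<le> A' \<Longrightarrow> wf_prog A' P"
  by (induction P) auto

text \<open>One unit of time pushes at most one symbol. All bounds on output lengths come from here,
  both for functions in \<open>FP\<close> and for the stacks of a simulated machine.\<close>

lemma exec_length: "exec P \<sigma> t \<sigma>' \<Longrightarrow> length (\<sigma>' k) \<le> length (\<sigma> k) + t"
proof (induction arbitrary: k rule: exec.induct)
  case (exec_Pop B \<sigma> j t \<sigma>')
  then show ?case by (smt (verit) fun_upd_apply add_Suc_right diff_le_self le_SucI le_trans length_tl nat_add_left_cancel_le add.commute)
next
  case (exec_Seq P \<sigma> t \<sigma>' Q t' \<sigma>'')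
  show ?case using exec_Seq.IH(1)[of k] exec_Seq.IH(2)[of k] by linarith
next
  case (exec_Loop_Cons \<sigma> j c w B t \<sigma>' t' \<sigma>'')
  have "length ((\<sigma>(j := w)) k) \<le> length (\<sigma> k)" using exec_Loop_Cons.hyps(1) by auto
  then show ?case using exec_Loop_Cons.IH(1)[of k] exec_Loop_Cons.IH(2)[of k] by linarith
qed auto

definition runs :: "prog \<Rightarrow> store \<Rightarrow> nat \<Rightarrow> store \<Rightarrow> bool" where
  "runs P \<sigma> T \<sigma>' \<longleftrightarrow> (\<exists>t\<le>T. exec P \<sigma> t \<sigma>')"

lemma runs_mono: "runs P \<sigma> T \<sigma>' \<Longrightarrow> T \<le> T' \<Longrightarrow> runs P \<sigma> T' \<sigma>'"
  unfolding runs_def by (meson le_trans)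

lemma runs_Skip: "runs Skip \<sigma> 1 \<sigma>"
  unfolding runs_def using exec_Skip by blast

lemma runs_Push: "\<sigma>' = \<sigma>(k := s # \<sigma> k) \<Longrightarrow> runs (Push k s) \<sigma> 1 \<sigma>'"
  unfolding runs_def using exec_Push by blast

lemma runs_Pop: "runs (B (top_symbol (\<sigma> k))) (\<sigma>(k := tl (\<sigma> k))) T \<sigma>' \<Longrightarrow> runs (Pop k B) \<sigma> (Suc T) \<sigma>'"
  unfolding runs_def using exec_Pop Suc_le_mono by blast

lemma runs_Seq:
  assumes "runs P \<sigma> T \<sigma>'" "runs Q \<sigma>' T' \<sigma>''"
  shows "runs (Seq P Q) \<sigma> (Suc (T + T')) \<sigma>''"
proof -
  obtain t t' where "t \<le> T" "t' \<le> T'" "exec P \<sigma> t \<sigma>'" "exec Q \<sigma>' t' \<sigma>''"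
    using assms unfolding runs_def by blast
  then show ?thesis unfolding runs_def by (intro exI[of _ "Suc (t + t')"]) (auto intro: exec_Seq)
qed

lemma runs_Loop_Nil: "\<sigma> k = [] \<Longrightarrow> runs (Loop k B) \<sigma> 1 \<sigma>"
  unfolding runs_def using exec_Loop_Nil by blast

lemma runs_Loop_Cons:
  assumes "\<sigma> k = c # w" "runs (B c) (\<sigma>(k := w)) T \<sigma>'" "runs (Loop k B) \<sigma>' T' \<sigma>''"
  shows "runs (Loop k B) \<sigma> (Suc (T + T')) \<sigma>''"
proof -
  obtain t t' where "t \<le> T" "t' \<le> T'" "exec (B c) (\<sigma>(k := w)) t \<sigma>'" "exec (Loop k B) \<sigma>' t' \<sigma>''"
    using assms unfolding runs_def by blast
  then show ?thesis
    unfolding runs_def by (intro exI[of _ "Suc (t + t')"]) (auto intro: exec_Loop_Cons assms(1))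
qed

text \<open>The rule for loops that merely run through a stack: \<open>F u v\<close> is the store in
  which the symbols \<open>u\<close> have been consumed and \<open>v\<close> is still to
  come.\<close>

lemma runs_Loop_list:
  assumes "\<And>u c v. w = u @ c # v \<Longrightarrow> runs (B c) ((F u (c # v))(k := v)) T (F (u @ [c]) v)"
    and "\<And>u v. w = u @ v \<Longrightarrow> F u v k = v"
  shows "runs (Loop k B) (F [] w) (length w * Suc T + 1) (F w [])"
proof -
  have "w = u @ v \<Longrightarrow> runs (Loop k B) (F u v) (length v * Suc T + 1) (F w [])" for u v
  proof (induction v arbitrary: u)
    case Nil
    then show ?case using assms(2)[of w "[]"] runs_Loop_Nil[of "F w []" k] by simp
  next
    case (Cons c v)
    have "runs (Loop k B) (F (u @ [c]) v) (length v * Suc T + 1) (F w [])"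
      using Cons.IH[of "u @ [c]"] Cons.prems by simp
    from runs_Loop_Cons[OF assms(2)[OF Cons.prems] assms(1)[OF Cons.prems] this]
    show ?case by (rule runs_mono) simp
  qed
  from this[of "[]" w] show ?thesis by simp
qed

section \<open>Moving, copying and clearing stacks\<close>

definition mv :: "nat \<Rightarrow> nat \<Rightarrow> nat \<Rightarrow> prog" where
  "mv A r d = Loop r (\<lambda>c. Push d (if 0 < c \<and> c < A then c else 1))"

definition mv2 :: "nat \<Rightarrow> nat \<Rightarrow> nat \<Rightarrow> nat \<Rightarrow> prog" where
  "mv2 A r d d' = Loop r (\<lambda>c. Seq (Push d (if 0 < c \<and> c < A then c else 1))
     (Push d' (if 0 < c \<and> c < A then c else 1)))"

definition clear :: "nat \<Rightarrow> prog" where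
  "clear r = Loop r (\<lambda>c. Skip)"

text \<open>A branch has to be well-formed for every symbol, also for those that never occur; this
  is why the program replaces symbols out of range by 1.\<close>

lemma wf_prog_mv [simp]: "wf_prog B (mv A r d) \<longleftrightarrow> r < B \<and> d < B \<and> 1 < B \<and> (\<forall>c. 0 < c \<and> c < A \<longrightarrow> c < B)"
  by (auto simp: mv_def)

lemma wf_prog_mv2 [simp]:
  "wf_prog B (mv2 A r d d') \<longleftrightarrow> r < B \<and> d < B \<and> d' < B \<and> 1 < B \<and> (\<forall>c. 0 < c \<and> c < A \<longrightarrow> c < B)"
  by (auto simp: mv2_def)

lemma wf_prog_clear [simp]: "wf_prog B (clear r) \<longleftrightarrow> r < B"
  by (simp add: clear_def)

lemma runs_mv:
  assumes "r \<noteq> d" "\<forall>c\<in>set (\<sigma> r). 0 < c \<and> c < A"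
    and "\<sigma>' = \<sigma>(r := [], d := rev (\<sigma> r) @ \<sigma> d)"
  shows "runs (mv A r d) \<sigma> (length (\<sigma> r) * 2 + 1) \<sigma>'"
proof -
  define F where "F u v = \<sigma>(r := v, d := rev u @ \<sigma> d)" for u v
  have "runs (Loop r (\<lambda>c. Push d (if 0 < c \<and> c < A then c else 1))) (F [] (\<sigma> r))
      (length (\<sigma> r) * Suc 1 + 1) (F (\<sigma> r) [])"
  proof (rule runs_Loop_list)
    fix u c v assume "\<sigma> r = u @ c # v"
    then show "runs (Push d (if 0 < c \<and> c < A then c else 1)) ((F u (c # v))(r := v)) 1 (F (u @ [c]) v)"
      using assms(1,2) by (intro runs_Push) (auto simp: F_def)
  qed (use assms(1) in \<open>auto simp: F_def\<close>)
  moreover have "F [] (\<sigma> r) = \<sigma>" "F (\<sigma> r) [] = \<sigma>'" by (auto simp: F_def assms(3))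
  ultimately show ?thesis by (simp add: mv_def numeral_2_eq_2)
qed

lemma runs_mv2:
  assumes "r \<noteq> d" "r \<noteq> d'" "d \<noteq> d'" "\<forall>c\<in>set (\<sigma> r). 0 < c \<and> c < A"
    and "\<sigma>' = \<sigma>(r := [], d := rev (\<sigma> r) @ \<sigma> d, d' := rev (\<sigma> r) @ \<sigma> d')"
  shows "runs (mv2 A r d d') \<sigma> (length (\<sigma> r) * 4 + 1) \<sigma>'"
proof -
  define F where "F u v = \<sigma>(r := v, d := rev u @ \<sigma> d, d' := rev u @ \<sigma> d')" for u v
  let ?g = "\<lambda>c. if 0 < c \<and> c < A then c else 1"
  have "runs (Loop r (\<lambda>c. Seq (Push d (?g c)) (Push d' (?g c)))) (F [] (\<sigma> r))
      (length (\<sigma> r) * Suc (Suc (1 + 1)) + 1) (F (\<sigma> r) [])"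
  proof (rule runs_Loop_list)
    fix u c v assume "\<sigma> r = u @ c # v"
    then show "runs (Seq (Push d (?g c)) (Push d' (?g c))) ((F u (c # v))(r := v)) (Suc (1 + 1)) (F (u @ [c]) v)"
      using assms(1-4) by (intro runs_Seq[OF runs_Push[OF refl] runs_Push]) (auto simp: F_def fun_eq_iff)
  qed (use assms(1,2) in \<open>auto simp: F_def\<close>)
  moreover have "F [] (\<sigma> r) = \<sigma>" "F (\<sigma> r) [] = \<sigma>'" by (auto simp: F_def assms(5))
  ultimately show ?thesis by (simp add: mv2_def numeral_eq_Suc)
qed

lemma runs_clear:
  assumes "\<sigma>' = \<sigma>(r := [])"
  shows "runs (clear r) \<sigma> (length (\<sigma> r) * 2 + 1) \<sigma>'"
proof -
  have "runs (Loop r (\<lambda>c. Skip)) (\<sigma>(r := \<sigma> r)) (length (\<sigma> r) * Suc 1 + 1) (\<sigma>(r := []))"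
    by (rule runs_Loop_list[where F = "\<lambda>u v. \<sigma>(r := v)"]) (use runs_Skip in auto)
  then show ?thesis by (simp add: clear_def assms mult_2_right)
qed

primrec clears :: "nat \<Rightarrow> nat \<Rightarrow> prog" where
  "clears b 0 = Skip"
| "clears b (Suc n) = Seq (clears b n) (clear (b + n))"

lemma wf_prog_clears: "b + n \<le> A \<Longrightarrow> wf_prog A (clears b n)"
  by (induction n) auto

lemma runs_clears:
  assumes "\<And>k. b \<le> k \<Longrightarrow> k < b + n \<Longrightarrow> length (\<sigma> k) \<le> L"
  shows "runs (clears b n) \<sigma> (n * (2 * L + 2) + 1) (\<lambda>k. if b \<le> k \<and> k < b + n then [] else \<sigma> k)"
  using assms
proof (induction n)
  case 0
  have "(\<lambda>k. if b \<le> k \<and> k < b + 0 then [] else \<sigma> k) = \<sigma>" by (intro ext) auto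
  then show ?case using runs_Skip[of \<sigma>] by (metis add_0 clears.simps(1) mult_0)
next
  case (Suc n)
  let ?s = "\<lambda>k. if b \<le> k \<and> k < b + n then [] else \<sigma> k"
  have "runs (Seq (clears b n) (clear (b + n))) \<sigma>
      (Suc (n * (2 * L + 2) + 1 + (length (?s (b + n)) * 2 + 1)))
      (\<lambda>k. if b \<le> k \<and> k < b + Suc n then [] else \<sigma> k)"
    by (rule runs_Seq[OF Suc.IH runs_clear]) (use Suc.prems in \<open>auto simp: fun_eq_iff\<close>)
  moreover have "length (?s (b + n)) \<le> L" using Suc.prems[of "b + n"] by simp
  ultimately show ?case by (simp, elim runs_mono, simp)
qed


section \<open>Polynomial-time functions on strings\<close>

definition ev :: "nat \<Rightarrow> bool list list \<Rightarrow> bool list" where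
  "ev i e = (if i < length e then e ! i else [])"

lemma ev_Cons_0 [simp]: "ev 0 (w # e) = w"
  and ev_Cons_Suc [simp]: "ev (Suc i) (w # e) = ev i e"
  and ev_tl [simp]: "ev i (tl e) = ev (Suc i) e"
  by (auto simp: ev_def nth_tl)

lemma ev_numeral [simp]: "ev (numeral i) (w # e) = ev (pred_numeral i) e"
  by (simp add: numeral_eq_Suc)

text \<open>The summand 2 keeps the base above 1, so that a single power can absorb constants, sums
  and products.\<close>

definition sz :: "bool list list \<Rightarrow> nat" where
  "sz e = sum_list (map length e) + 2"

lemma sz_ge_2: "2 \<le> sz e" by (simp add: sz_def)

lemma length_ev_le: "length (ev i e) \<le> sz e"
  by (auto simp: ev_def sz_def intro: le_trans[OF member_le_sum_list[of _ "map length e"]])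

definition pbd :: "nat \<Rightarrow> (bool list list \<Rightarrow> nat) \<Rightarrow> bool" where
  "pbd m T \<longleftrightarrow> (\<exists>c. \<forall>e. length e = m \<longrightarrow> T e \<le> sz e ^ c)"

lemma pbd_mono: "pbd m T \<Longrightarrow> (\<And>e. length e = m \<Longrightarrow> S e \<le> T e) \<Longrightarrow> pbd m S"
  unfolding pbd_def by (meson le_trans)

lemma pbd_sz: "pbd m sz"
  unfolding pbd_def by (intro exI[of _ 1]) simp

lemma pbd_ev: "pbd m (\<lambda>e. length (ev i e))"
  by (rule pbd_mono[OF pbd_sz]) (rule length_ev_le)

lemma pbd_const: "pbd m (\<lambda>e. k)"
proof -
  have "k \<le> sz e ^ k" for e
    using le_trans[OF less_imp_le[OF less_exp] power_mono[OF sz_ge_2]] by simp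
  then show ?thesis unfolding pbd_def by blast
qed

lemma pbd_mult: assumes "pbd m S" "pbd m T" shows "pbd m (\<lambda>e. S e * T e)"
proof -
  obtain c d where "\<forall>e. length e = m \<longrightarrow> S e \<le> sz e ^ c" "\<forall>e. length e = m \<longrightarrow> T e \<le> sz e ^ d"
    using assms unfolding pbd_def by blast
  then have "\<forall>e. length e = m \<longrightarrow> S e * T e \<le> sz e ^ (c + d)"
    by (auto simp: power_add intro: mult_mono)
  then show ?thesis unfolding pbd_def by blast
qed

lemma pbd_power: "pbd m S \<Longrightarrow> pbd m (\<lambda>e. S e ^ k)"
  by (induction k) (auto intro: pbd_mult pbd_const simp: pbd_const[of m 1, simplified])

lemma pbd_add: assumes "pbd m S" "pbd m T" shows "pbd m (\<lambda>e. S e + T e)"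
proof (rule pbd_mono)
  \<comment> \<open>A sum is at most this product, so only the addition of 1 needs an argument of
    its own: it costs a factor 2, hence one more factor \<open>sz e\<close>.\<close>
  show "pbd m (\<lambda>e. (S e + 1) * (T e + 1))"
  proof (rule pbd_mult)
    have *: "pbd m (\<lambda>e. R e + 1)" if R: "pbd m R" for R
    proof (rule pbd_mono)
      show "pbd m (\<lambda>e. sz e * (sz e ^ (SOME c. \<forall>e. length e = m \<longrightarrow> R e \<le> sz e ^ c)))"
        by (intro pbd_mult pbd_power pbd_sz)
      fix e :: "bool list list" assume e: "length e = m"
      let ?c = "SOME c. \<forall>e. length e = m \<longrightarrow> R e \<le> sz e ^ c"
      have "\<forall>e. length e = m \<longrightarrow> R e \<le> sz e ^ ?c"
        using R unfolding pbd_def by (rule someI_ex)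
      then have "R e \<le> sz e ^ ?c" using e by blast
      moreover have "1 \<le> sz e ^ ?c" using sz_ge_2[of e] by simp
      ultimately have "R e + 1 \<le> 2 * sz e ^ ?c" by linarith
      also have "\<dots> \<le> sz e * sz e ^ ?c" using sz_ge_2 by (rule mult_right_mono) simp
      finally show "R e + 1 \<le> sz e * sz e ^ ?c" .
    qed
    show "pbd m (\<lambda>e. S e + 1)" "pbd m (\<lambda>e. T e + 1)" by (intro * assms)+
  qed
qed simp

lemma pbd_Suc: "pbd m S \<Longrightarrow> pbd m (\<lambda>e. Suc (S e))"
  using pbd_add[of m S "\<lambda>_. 1"] pbd_const[of m 1] by simp

lemmas pbd_intros = pbd_ev pbd_const pbd_add pbd_mult pbd_power pbd_Suc

lemma pbd_sum_list: "(\<And>g. g \<in> set gs \<Longrightarrow> pbd m g) \<Longrightarrow> pbd m (\<lambda>e. sum_list (map (\<lambda>g. g e) gs))"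
  by (induction gs) (auto intro: pbd_add pbd_const)

lemma pbd_comp:
  assumes "pbd n T" "pbd m S" "\<And>e. length e = m \<Longrightarrow> sz (g e) \<le> S e"
    "\<And>e. length e = m \<Longrightarrow> length (g e) = n"
  shows "pbd m (\<lambda>e. T (g e))"
proof -
  obtain c where c: "\<forall>e. length e = n \<longrightarrow> T e \<le> sz e ^ c" using assms(1) unfolding pbd_def by blast
  show ?thesis
  proof (rule pbd_mono[OF pbd_power[OF assms(2), of c]])
    fix e :: "bool list list" assume e: "length e = m"
    have "T (g e) \<le> sz (g e) ^ c" using c assms(4)[OF e] by blast
    also have "\<dots> \<le> S e ^ c" using assms(3)[OF e] by (rule power_mono) simp
    finally show "T (g e) \<le> S e ^ c" .
  qed
qed

section \<open>Programs computing functions on strings\<close>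

definition bits :: "bool list \<Rightarrow> nat list" where
  "bits = map bit_symbol"

lemma bits_simps [simp]: "bits [] = []" "bits (b # w) = bit_symbol b # bits w"
    "bits (v @ w) = bits v @ bits w" "length (bits w) = length w" "rev (bits w) = bits (rev w)"
  by (simp_all add: bits_def rev_map)

lemma bits_range: "\<forall>c\<in>set (bits w). 0 < c \<and> c < 3"
  by (auto simp: bits_def bit_symbol_def)

text \<open>Computability for every choice of registers: the program reads its arguments from the
  stacks \<open>rs\<close>, pushes the result on the stack \<open>d\<close> and may use the stacks from \<open>b\<close> on as
  scratch space.\<close>

definition computes ::
    "nat \<Rightarrow> nat list \<Rightarrow> nat \<Rightarrow> nat \<Rightarrow> (bool list list \<Rightarrow> bool list) \<Rightarrow> nat \<Rightarrow> prog \<Rightarrow> (bool list list \<Rightarrow> nat) \<Rightarrow> bool"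
  where "computes m rs d b f A P T \<longleftrightarrow> wf_prog A P \<and> pbd m T \<and>
     (\<forall>\<sigma> e. (\<forall>k\<ge>b. \<sigma> k = []) \<longrightarrow> map \<sigma> rs = map bits e \<longrightarrow>
        runs P \<sigma> (T e) (\<sigma>(d := bits (f e) @ \<sigma> d)))"

definition FP :: "nat \<Rightarrow> (bool list list \<Rightarrow> bool list) \<Rightarrow> bool" where
  "FP m f \<longleftrightarrow> (\<forall>rs d b. length rs = m \<longrightarrow> (\<forall>r\<in>set rs. r < b \<and> r \<noteq> d) \<longrightarrow> d < b \<longrightarrow>
     (\<exists>P A T. computes m rs d b f A P T))"

lemma FP_I:
  assumes "\<And>rs d b. length rs = m \<Longrightarrow> \<forall>r\<in>set rs. r < b \<and> r \<noteq> d \<Longrightarrow> d < b \<Longrightarrow>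
     \<exists>P A T. computes m rs d b f A P T"
  shows "FP m f"
  using assms unfolding FP_def by blast

lemma FP_E:
  assumes "FP m f" "length rs = m" "\<forall>r\<in>set rs. r < b \<and> r \<noteq> d" "d < b"
  obtains P A T where "wf_prog A P" "pbd m T"
    "\<And>\<sigma> e. \<forall>k\<ge>b. \<sigma> k = [] \<Longrightarrow> map \<sigma> rs = map bits e \<Longrightarrow>
        runs P \<sigma> (T e) (\<sigma>(d := bits (f e) @ \<sigma> d))"
  using assms unfolding FP_def computes_def by metis

lemma FP_cong:
  assumes "FP m f" "\<And>e. length e = m \<Longrightarrow> f e = g e"
  shows "FP m g"
proof (rule FP_I)
  fix rs :: "nat list" and d b assume r: "length rs = m" "\<forall>r\<in>set rs. r < b \<and> r \<noteq> d" "d < b"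
  have l: "map \<sigma> rs = map bits e \<Longrightarrow> length e = m" for \<sigma> :: store and e :: "bool list list"
    by (metis length_map r(1))
  show "\<exists>P A T. computes m rs d b g A P T"
    using FP_E[OF assms(1) r] assms(2) l unfolding computes_def by metis
qed

text \<open>The result is pushed on a stack that is empty at first, so \<open>exec_length\<close>
  bounds its length by the running time.\<close>

lemma pbd_length_FP:
  assumes "FP m f" shows "pbd m (\<lambda>e. length (f e))"
proof -
  obtain P A T where *: "pbd m T" "\<And>\<sigma> e. \<forall>k\<ge>Suc m. \<sigma> k = [] \<Longrightarrow> map \<sigma> [1..<Suc m] = map bits e \<Longrightarrow>
        runs P \<sigma> (T e) (\<sigma>(0 := bits (f e) @ \<sigma> 0))"
    by (rule FP_E[OF assms, of "[1..<Suc m]" "Suc m" 0]) auto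
  show ?thesis
  proof (rule pbd_mono[OF *(1)])
    fix e :: "bool list list" assume e: "length e = m"
    define \<sigma> where "\<sigma> k = (if 1 \<le> k \<and> k \<le> m then bits (e ! (k - 1)) else [])" for k
    have "map \<sigma> [1..<Suc m] = map bits e"
      by (rule nth_equalityI) (auto simp: \<sigma>_def e simp del: upt_Suc)
    then have "runs P \<sigma> (T e) (\<sigma>(0 := bits (f e) @ \<sigma> 0))"
      by (intro *(2)) (auto simp: \<sigma>_def)
    then obtain t where "t \<le> T e" "exec P \<sigma> t (\<sigma>(0 := bits (f e) @ \<sigma> 0))"
      unfolding runs_def by blast
    with exec_length[OF this(2), of 0] show "length (f e) \<le> T e" by (simp add: \<sigma>_def)
  qed
qed

lemma FP_const: "FP m (\<lambda>e. w)"
proof (rule FP_I)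
  fix rs d b assume r: "length (rs :: nat list) = m" "\<forall>r\<in>set rs. r < b \<and> r \<noteq> d" "d < b"
  have "\<exists>P. wf_prog (d + 3) P \<and> (\<forall>\<sigma>. runs P \<sigma> (2 * length w + 1) (\<sigma>(d := bits w @ \<sigma> d)))"
  proof (induction w)
    case Nil
    show ?case using runs_Skip by (intro exI[of _ Skip]) auto
  next
    case (Cons c w)
    then obtain P where P: "wf_prog (d + 3) P" "\<And>\<sigma>. runs P \<sigma> (2 * length w + 1) (\<sigma>(d := bits w @ \<sigma> d))"
      by blast
    have "runs (Seq P (Push d (bit_symbol c))) \<sigma> (Suc (2 * length w + 1 + 1)) (\<sigma>(d := bits (c # w) @ \<sigma> d))" for \<sigma>
      by (rule runs_Seq[OF P(2) runs_Push]) auto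
    moreover have "wf_prog (d + 3) (Seq P (Push d (bit_symbol c)))"
      using P(1) by (simp add: bit_symbol_def)
    moreover have "Suc (2 * length w + 1 + 1) = 2 * length (c # w) + 1" by simp
    ultimately show ?case by metis
  qed
  then show "\<exists>P A T. computes m rs d b (\<lambda>e. w) A P T"
    unfolding computes_def using pbd_const by metis
qed

lemma FP_ev: "FP m (ev i)"
proof (cases "i < m")
  case False
  then show ?thesis by (intro FP_cong[OF FP_const[of m "[]"]]) (simp add: ev_def)
next
  case True
  show ?thesis
  proof (rule FP_I)
    fix rs d b assume r: "length (rs :: nat list) = m" "\<forall>r\<in>set rs. r < b \<and> r \<noteq> d" "d < b"
    let ?r = "rs ! i"
    have rb: "?r < b" "?r \<noteq> d" using r True by auto
    \<comment> \<open>Reading a stack destroys it. Moving to scratch reverses the argument; moving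
      back to its register and to \<open>d\<close> at the same time reverses it again and restores
      the register.\<close>
    let ?P = "Seq (mv 3 ?r b) (mv2 3 b ?r d)"
    have "runs ?P \<sigma> (Suc (length (ev i e) * 2 + 1 + (length (ev i e) * 4 + 1)))
       (\<sigma>(d := bits (ev i e) @ \<sigma> d))"
      if \<sigma>: "\<forall>k\<ge>b. \<sigma> k = []" "map \<sigma> rs = map bits e" for \<sigma> e
    proof -
      have le: "length e = m" using \<sigma>(2) r(1) by (metis length_map)
      have ri: "\<sigma> ?r = bits (ev i e)" using arg_cong[OF \<sigma>(2), of "\<lambda>xs. xs ! i"] True r(1) le
        by (simp add: ev_def)
      let ?s = "\<sigma>(?r := [], b := rev (bits (ev i e)))"
      have 1: "runs (mv 3 ?r b) \<sigma> (length (\<sigma> ?r) * 2 + 1) ?s"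
        using rb \<sigma>(1) by (intro runs_mv) (auto simp: ri bits_range simp flip: bits_simps(5))
      have 2: "runs (mv2 3 b ?r d) ?s (length (?s b) * 4 + 1) (\<sigma>(d := bits (ev i e) @ \<sigma> d))"
        using rb r(3) \<sigma>(1) bits_range by (intro runs_mv2) (auto simp: ri fun_eq_iff)
      show ?thesis using runs_Seq[OF 1 2] by (simp add: ri)
    qed
    moreover have "wf_prog (b + 3) ?P" using rb r(3) by auto
    moreover have "pbd m (\<lambda>e. Suc (length (ev i e) * 2 + 1 + (length (ev i e) * 4 + 1)))"
      by (intro pbd_intros)
    ultimately show "\<exists>P A T. computes m rs d b (ev i) A P T"
      unfolding computes_def by blast
  qed
qed

lemma map_upd_notin: "d \<notin> set rs \<Longrightarrow> map (\<sigma>(d := w)) rs = map \<sigma> rs"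
  by (induction rs) auto

lemma FP_append:
  assumes "FP m f" "FP m g" shows "FP m (\<lambda>e. f e @ g e)"
proof (rule FP_I)
  fix rs d b assume r: "length (rs :: nat list) = m" "\<forall>r\<in>set rs. r < b \<and> r \<noteq> d" "d < b"
  obtain P A T where P: "wf_prog A P" "pbd m T" "\<And>\<sigma> e. \<forall>k\<ge>b. \<sigma> k = [] \<Longrightarrow> map \<sigma> rs = map bits e \<Longrightarrow>
        runs P \<sigma> (T e) (\<sigma>(d := bits (f e) @ \<sigma> d))"
    by (rule FP_E[OF assms(1) r]) blast
  obtain P' A' T' where P': "wf_prog A' P'" "pbd m T'" "\<And>\<sigma> e. \<forall>k\<ge>b. \<sigma> k = [] \<Longrightarrow> map \<sigma> rs = map bits e \<Longrightarrow>
        runs P' \<sigma> (T' e) (\<sigma>(d := bits (g e) @ \<sigma> d))"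
    by (rule FP_E[OF assms(2) r]) blast
  \<comment> \<open>The program for \<open>g\<close> runs first, because results are pushed in front
    of what \<open>d\<close> holds already.\<close>
  have "runs (Seq P' P) \<sigma> (Suc (T' e + T e)) (\<sigma>(d := bits (f e @ g e) @ \<sigma> d))"
    if \<sigma>: "\<forall>k\<ge>b. \<sigma> k = []" "map \<sigma> rs = map bits e" for \<sigma> e
  proof -
    have "map (\<sigma>(d := bits (g e) @ \<sigma> d)) rs = map bits e"
      using \<sigma>(2) r(2) by (subst map_upd_notin) auto
    from runs_Seq[OF P'(3)[OF \<sigma>] P(3)[OF _ this]] \<sigma>(1) r(3) show ?thesis by simp
  qed
  moreover have "wf_prog (max A A') (Seq P' P)" using P(1) P'(1) by (auto intro: wf_prog_mono)
  moreover have "pbd m (\<lambda>e. Suc (T' e + T e))" by (intro pbd_intros P P')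
  ultimately show "\<exists>P A T. computes m rs d b (\<lambda>e. f e @ g e) A P T"
    unfolding computes_def by blast
qed

text \<open>Each result gets a scratch stack of its own, and the scratch space of the next program
  starts above it.\<close>

lemma computes_list:
  assumes "\<And>g. g \<in> set gs \<Longrightarrow> FP m g" "length rs = m" "\<forall>r\<in>set rs. r < b"
  shows "\<exists>P A T. wf_prog A P \<and> pbd m T \<and> (\<forall>\<sigma> e. (\<forall>k\<ge>b. \<sigma> k = []) \<longrightarrow> map \<sigma> rs = map bits e \<longrightarrow>
    runs P \<sigma> (T e) (\<lambda>k. if b \<le> k \<and> k < b + length gs then bits ((gs ! (k - b)) e) else \<sigma> k))"
  using assms
proof (induction gs rule: rev_induct)
  case Nil
  have eq: "(\<lambda>k. if b \<le> k \<and> k < b + length [] then bits (([] ! (k - b)) e) else \<sigma> k) = \<sigma>" for \<sigma> :: store and e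
    by (intro ext) auto
  show ?case unfolding eq using pbd_const[of m 1] runs_Skip
    by (intro exI[of _ Skip] exI[of _ 0] exI[of _ "\<lambda>_. 1"]) simp
next
  case (snoc g gs)
  obtain P A T where P: "wf_prog A P" "pbd m T"
    "\<And>\<sigma> e. \<forall>k\<ge>b. \<sigma> k = [] \<Longrightarrow> map \<sigma> rs = map bits e \<Longrightarrow> runs P \<sigma> (T e)
        (\<lambda>k. if b \<le> k \<and> k < b + length gs then bits ((gs ! (k - b)) e) else \<sigma> k)"
    using snoc.IH snoc.prems by auto
  let ?d = "b + length gs"
  obtain P' A' T' where P': "wf_prog A' P'" "pbd m T'" "\<And>\<sigma> e. \<forall>k\<ge>Suc ?d. \<sigma> k = [] \<Longrightarrow> map \<sigma> rs = map bits e \<Longrightarrow>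
        runs P' \<sigma> (T' e) (\<sigma>(?d := bits (g e) @ \<sigma> ?d))"
    by (rule FP_E[of m g rs "Suc ?d" ?d]) (use snoc.prems in fastforce)+
  have "runs (Seq P P') \<sigma> (Suc (T e + T' e))
      (\<lambda>k. if b \<le> k \<and> k < b + length (gs @ [g]) then bits (((gs @ [g]) ! (k - b)) e) else \<sigma> k)"
    if \<sigma>: "\<forall>k\<ge>b. \<sigma> k = []" "map \<sigma> rs = map bits e" for \<sigma> e
  proof -
    let ?s = "\<lambda>k. if b \<le> k \<and> k < b + length gs then bits ((gs ! (k - b)) e) else \<sigma> k"
    have "map ?s rs = map \<sigma> rs" using snoc.prems(3) by (intro map_cong) auto
    then have "map ?s rs = map bits e" using \<sigma> by simp
    note runs_Seq[OF P(3)[OF \<sigma>] P'(3)[OF _ this]]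
    moreover have "?s(?d := bits (g e) @ ?s ?d) =
        (\<lambda>k. if b \<le> k \<and> k < b + length (gs @ [g]) then bits (((gs @ [g]) ! (k - b)) e) else \<sigma> k)"
    proof
      fix k
      consider "k < b" | "b \<le> k" "k - b < length gs" | "k = ?d" | "k > ?d" by linarith
      then show "(?s(?d := bits (g e) @ ?s ?d)) k =
          (if b \<le> k \<and> k < b + length (gs @ [g]) then bits (((gs @ [g]) ! (k - b)) e) else \<sigma> k)"
        by cases (use \<sigma>(1) in \<open>auto simp: nth_append\<close>)
    qed
    ultimately show ?thesis using \<sigma>(1) by simp
  qed
  moreover have "wf_prog (max A A') (Seq P P')" using P(1) P'(1) by (auto intro: wf_prog_mono)
  moreover have "pbd m (\<lambda>e. Suc (T e + T' e))" by (intro pbd_intros P P')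
  ultimately show ?case by blast
qed

text \<open>The intermediate results are the argument registers of \<open>f\<close>. They must be
  cleared afterwards, since programs rely on empty scratch stacks.\<close>

lemma FP_comp:
  assumes f: "FP (length gs) f" and gs: "\<And>g. g \<in> set gs \<Longrightarrow> FP m g"
  shows "FP m (\<lambda>e. f (map (\<lambda>g. g e) gs))"
proof (rule FP_I)
  fix rs d b assume r: "length (rs :: nat list) = m" "\<forall>r\<in>set rs. r < b \<and> r \<noteq> d" "d < b"
  let ?n = "length gs"
  let ?M = "\<lambda>e. map (\<lambda>g. g e) gs"
  obtain P A T where P: "wf_prog A P" "pbd m T"
    "\<And>\<sigma> e. \<forall>k\<ge>b. \<sigma> k = [] \<Longrightarrow> map \<sigma> rs = map bits e \<Longrightarrow> runs P \<sigma> (T e)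
        (\<lambda>k. if b \<le> k \<and> k < b + ?n then bits ((gs ! (k - b)) e) else \<sigma> k)"
    using computes_list[of gs m rs b, OF gs r(1)] r(2) by blast
  obtain P' A' T' where P': "wf_prog A' P'" "pbd ?n T'"
    "\<And>\<sigma> e. \<forall>k\<ge>b + ?n. \<sigma> k = [] \<Longrightarrow> map \<sigma> [b..<b + ?n] = map bits e \<Longrightarrow>
        runs P' \<sigma> (T' e) (\<sigma>(d := bits (f e) @ \<sigma> d))"
    by (rule FP_E[OF f, of "[b..<b + ?n]" "b + ?n" d]) (use r in auto)
  have szM: "sz (?M e) = sum_list (map (\<lambda>g. g e) (map (\<lambda>g e. length (g e)) gs)) + 2" for e
    by (simp add: sz_def o_def)
  have pS: "pbd m (\<lambda>e. sz (?M e))"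
    unfolding szM by (intro pbd_add pbd_sum_list pbd_const) (auto intro: pbd_length_FP gs)
  let ?T = "\<lambda>e. Suc (T e + (Suc (T' (?M e) + (?n * (2 * sz (?M e) + 2) + 1))))"
  have "runs (Seq P (Seq P' (clears b ?n))) \<sigma> (?T e) (\<sigma>(d := bits (f (?M e)) @ \<sigma> d))"
    if \<sigma>: "\<forall>k\<ge>b. \<sigma> k = []" "map \<sigma> rs = map bits e" for \<sigma> e
  proof -
    let ?s = "\<lambda>k. if b \<le> k \<and> k < b + ?n then bits ((gs ! (k - b)) e) else \<sigma> k"
    have m: "map ?s [b..<b + ?n] = map bits (?M e)" by (rule nth_equalityI) auto
    let ?s' = "?s(d := bits (f (?M e)) @ ?s d)"
    have c: "runs (clears b ?n) ?s' (?n * (2 * sz (?M e) + 2) + 1) (\<lambda>k. if b \<le> k \<and> k < b + ?n then [] else ?s' k)"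
    proof (rule runs_clears)
      fix k assume k: "b \<le> k" "k < b + ?n"
      then have "length (?s' k) = length (ev (k - b) (?M e))" using r(3) by (auto simp: ev_def)
      then show "length (?s' k) \<le> sz (?M e)" using length_ev_le by simp
    qed
    have "(\<lambda>k. if b \<le> k \<and> k < b + ?n then [] else ?s' k) = \<sigma>(d := bits (f (?M e)) @ \<sigma> d)"
      using \<sigma>(1) r(3) by (auto simp: fun_eq_iff)
    with runs_Seq[OF P(3)[OF \<sigma>] runs_Seq[OF P'(3)[OF _ m] c]] \<sigma>(1) show ?thesis by simp
  qed
  moreover have "wf_prog (A + A' + b + ?n) (Seq P (Seq P' (clears b ?n)))" using P(1) P'(1)
    by (auto intro: wf_prog_mono wf_prog_clears)
  moreover have "pbd m ?T"
    by (intro pbd_intros P pS pbd_comp[OF P'(2) pS]) auto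
  ultimately show "\<exists>P A T. computes m rs d b (\<lambda>e. f (?M e)) A P T"
    unfolding computes_def by blast
qed


text \<open>After its first symbol has been popped, the scratch stack with the value of
  \<open>n\<close> serves as the additional argument register of \<open>g c\<close>.\<close>

lemma FP_case:
  assumes n: "FP m n" and z: "FP m z" and g: "\<And>c. FP (Suc m) (g c)"
  shows "FP m (\<lambda>e. case n e of [] \<Rightarrow> z e | c # s \<Rightarrow> g c (s # e))"
proof (rule FP_I)
  fix rs :: "nat list" and d b assume r: "length rs = m" "\<forall>r\<in>set rs. r < b \<and> r \<noteq> d" "d < b"
  obtain Pn An Tn where Pn: "wf_prog An Pn" "pbd m Tn"
    "\<And>\<sigma> e. \<forall>k\<ge>Suc b. \<sigma> k = [] \<Longrightarrow> map \<sigma> rs = map bits e \<Longrightarrow>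
        runs Pn \<sigma> (Tn e) (\<sigma>(b := bits (n e) @ \<sigma> b))"
  proof -
    have *: "\<forall>r\<in>set rs. r < Suc b \<and> r \<noteq> b" "b < Suc b" using r by auto
    show thesis by (rule FP_E[OF n r(1) *]) (rule that)
  qed
  obtain Pz Az Tz where Pz: "wf_prog Az Pz" "pbd m Tz"
    "\<And>\<sigma> e. \<forall>k\<ge>Suc b. \<sigma> k = [] \<Longrightarrow> map \<sigma> rs = map bits e \<Longrightarrow>
        runs Pz \<sigma> (Tz e) (\<sigma>(d := bits (z e) @ \<sigma> d))"
  proof -
    have *: "\<forall>r\<in>set rs. r < Suc b \<and> r \<noteq> d" "d < Suc b" using r by auto
    show thesis by (rule FP_E[OF z r(1) *]) (rule that)
  qed
  have "\<exists>P A T. wf_prog A P \<and> pbd (Suc m) T \<and> (\<forall>\<sigma> e. (\<forall>k\<ge>Suc b. \<sigma> k = []) \<longrightarrow> map \<sigma> (b # rs) = map bits e \<longrightarrow>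
        runs P \<sigma> (T e) (\<sigma>(d := bits (g c e) @ \<sigma> d)))" for c
  proof -
    have *: "length (b # rs) = Suc m" "\<forall>r\<in>set (b # rs). r < Suc b \<and> r \<noteq> d" "d < Suc b"
      using r by auto
    show ?thesis by (rule FP_E[OF g *, of c]) blast
  qed
  then obtain Pg Ag Tg where Pg: "\<And>c. wf_prog (Ag c) (Pg c)" "\<And>c. pbd (Suc m) (Tg c)"
    "\<And>c \<sigma> e. \<forall>k\<ge>Suc b. \<sigma> k = [] \<Longrightarrow> map \<sigma> (b # rs) = map bits e \<Longrightarrow>
        runs (Pg c) \<sigma> (Tg c e) (\<sigma>(d := bits (g c e) @ \<sigma> d))"
    by metis
  \<comment> \<open>The symbol 0 signals an empty stack, and 2 is the bit True.\<close>
  define B where "B c = (if c = 0 then Pz else Pg (c = 2))" for c :: nat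
  let ?P = "Seq Pn (Seq (Pop b B) (clear b))"
  let ?T = "\<lambda>e. Suc (Tn e + Suc (Suc (Tz e + Tg True (tl (n e) # e) + Tg False (tl (n e) # e)) + (length (n e) * 2 + 1)))"
  have "runs ?P \<sigma> (?T e) (\<sigma>(d := bits (case n e of [] \<Rightarrow> z e | c # s \<Rightarrow> g c (s # e)) @ \<sigma> d))"
    if \<sigma>: "\<forall>k\<ge>b. \<sigma> k = []" "map \<sigma> rs = map bits e" for \<sigma> e
  proof -
    let ?s = "\<sigma>(b := bits (n e))"
    have b: "b \<notin> set rs" "b \<noteq> d" using r by auto
    have 1: "runs Pn \<sigma> (Tn e) ?s" using Pn(3)[OF _ \<sigma>(2)] \<sigma>(1) by simp
    let ?w = "case n e of [] \<Rightarrow> z e | c # s \<Rightarrow> g c (s # e)"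
    let ?s' = "\<sigma>(b := bits (tl (n e)), d := bits ?w @ \<sigma> d)"
    have m: "map (\<sigma>(b := bits s)) (b # rs) = map bits (s # e)" for s
      using \<sigma>(2) b by (simp add: map_upd_notin)
    have 2: "runs (Pop b B) ?s (Suc (Tz e + Tg True (tl (n e) # e) + Tg False (tl (n e) # e))) ?s'"
    proof (cases "n e")
      case Nil
      have "runs Pz ?s (Tz e) (?s(d := bits (z e) @ ?s d))"
        by (rule Pz(3)) (use \<sigma> b Nil in \<open>auto simp: map_upd_notin\<close>)
      then have "runs (B (top_symbol (?s b))) (?s(b := tl (?s b))) (Tz e) ?s'"
        using Nil b by (simp add: B_def)
      from runs_Pop[where B = B and k = b, OF this] show ?thesis by (rule runs_mono) simp
    next
      case (Cons c s)
      have "runs (Pg c) (\<sigma>(b := bits s)) (Tg c (s # e)) ((\<sigma>(b := bits s))(d := bits (g c (s # e)) @ (\<sigma>(b := bits s)) d))"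
        by (rule Pg(3)) (use \<sigma> m in auto)
      then have "runs (B (top_symbol (?s b))) (?s(b := tl (?s b))) (Tg c (s # e)) ?s'"
        using Cons b by (auto simp: B_def bit_symbol_def)
      from runs_Pop[where B = B and k = b, OF this] show ?thesis by (rule runs_mono) (use Cons in \<open>cases c; simp\<close>)
    qed
    have 3: "runs (clear b) ?s' (length (?s' b) * 2 + 1) (\<sigma>(d := bits ?w @ \<sigma> d))"
      using b \<sigma>(1) by (intro runs_clear) (auto simp: fun_eq_iff)
    show ?thesis
      by (rule runs_mono[OF runs_Seq[OF 1 runs_Seq[OF 2 3]]]) (use b in simp)
  qed
  moreover have "wf_prog (An + Az + Ag True + Ag False + b + 3) ?P"
  proof -
    have "wf_prog (An + Az + Ag True + Ag False + b + 3) (Pg c)" for c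
      by (rule wf_prog_mono[OF Pg(1)]) (cases c; simp)
    then show ?thesis using Pn(1) Pz(1) by (auto simp: B_def intro: wf_prog_mono)
  qed
  moreover have "pbd m ?T"
  proof -
    have S: "pbd m (\<lambda>e. length (n e) + sz e)" by (intro pbd_add pbd_length_FP n pbd_sz)
    have "pbd m (\<lambda>e. Tg c (tl (n e) # e))" for c
      by (rule pbd_comp[OF Pg(2) S]) (auto simp: sz_def)
    then show ?thesis by (intro pbd_intros pbd_length_FP n Pn Pz)
  qed
  ultimately show "\<exists>P A T. computes m rs d b (\<lambda>e. case n e of [] \<Rightarrow> z e | c # s \<Rightarrow> g c (s # e)) A P T"
    unfolding computes_def by blast
qed

text \<open>The string is reversed first, because the value at \<open>c # s\<close> needs the one at \<open>s\<close>.\<close>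

lemma FP_rec:
  assumes n: "FP m n" and z: "FP m z" and g: "\<And>c. FP (Suc (Suc m)) (g c)"
    and R0: "\<And>e. length e = m \<Longrightarrow> R e [] = z e"
    and RS: "\<And>e c s. length e = m \<Longrightarrow> R e (c # s) = g c (R e s # s # e)"
    and bound: "\<And>e s. length e = m \<Longrightarrow> length (R e s) \<le> (sz e + length s) ^ C"
  shows "FP m (\<lambda>e. R e (n e))"
proof (rule FP_I)
  fix rs :: "nat list" and d b assume r: "length rs = m" "\<forall>r\<in>set rs. r < b \<and> r \<noteq> d" "d < b"
  \<comment> \<open>Roles during the recursion: \<open>b\<close> holds the suffix treated so far,
    \<open>b + 1\<close> the rest of the reversed input, \<open>b + 2\<close> the current value,
    \<open>b + 3\<close> the new value, and \<open>b + 4\<close> is used to carry the new value back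
    to \<open>b + 2\<close> in the right order.\<close>
  let ?b1 = "b + 1" let ?b2 = "b + 2" let ?b3 = "b + 3" let ?b4 = "b + 4"
  obtain Pn An Tn where Pn: "wf_prog An Pn" "pbd m Tn"
    "\<And>\<sigma> e. \<forall>k\<ge>Suc b. \<sigma> k = [] \<Longrightarrow> map \<sigma> rs = map bits e \<Longrightarrow>
        runs Pn \<sigma> (Tn e) (\<sigma>(b := bits (n e) @ \<sigma> b))"
  proof -
    have *: "\<forall>r\<in>set rs. r < Suc b \<and> r \<noteq> b" "b < Suc b" using r by auto
    show thesis by (rule FP_E[OF n r(1) *]) (rule that)
  qed
  obtain Pz Az Tz where Pz: "wf_prog Az Pz" "pbd m Tz"
    "\<And>\<sigma> e. \<forall>k\<ge>?b3. \<sigma> k = [] \<Longrightarrow> map \<sigma> rs = map bits e \<Longrightarrow>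
        runs Pz \<sigma> (Tz e) (\<sigma>(?b2 := bits (z e) @ \<sigma> ?b2))"
  proof -
    have *: "\<forall>r\<in>set rs. r < ?b3 \<and> r \<noteq> ?b2" "?b2 < ?b3" using r by auto
    show thesis by (rule FP_E[OF z r(1) *]) (rule that)
  qed
  have "\<exists>P A T. wf_prog A P \<and> pbd (Suc (Suc m)) T \<and> (\<forall>\<sigma> e. (\<forall>k\<ge>?b4. \<sigma> k = []) \<longrightarrow> map \<sigma> (?b2 # b # rs) = map bits e \<longrightarrow>
        runs P \<sigma> (T e) (\<sigma>(?b3 := bits (g c e) @ \<sigma> ?b3)))" for c
  proof -
    have *: "length (?b2 # b # rs) = Suc (Suc m)" "\<forall>r\<in>set (?b2 # b # rs). r < ?b4 \<and> r \<noteq> ?b3" "?b3 < ?b4"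
      using r by auto
    show ?thesis by (rule FP_E[OF g *, of c]) blast
  qed
  then obtain Pg Ag Tg where Pg: "\<And>c. wf_prog (Ag c) (Pg c)" "\<And>c. pbd (Suc (Suc m)) (Tg c)"
    "\<And>c \<sigma> e. \<forall>k\<ge>?b4. \<sigma> k = [] \<Longrightarrow> map \<sigma> (?b2 # b # rs) = map bits e \<Longrightarrow>
        runs (Pg c) \<sigma> (Tg c e) (\<sigma>(?b3 := bits (g c e) @ \<sigma> ?b3))"
    by metis
  \<comment> \<open>A common bound for all strings that occur. The hypothesis \<open>bound\<close>
    is essential here: without it, repeated squaring of lengths would be possible.\<close>
  define U where "U e = (sz e + length (n e)) ^ C + sz e + length (n e)" for e
  obtain cF cT where cc: "\<forall>e. length e = Suc (Suc m) \<longrightarrow> Tg False e \<le> sz e ^ cF"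
      "\<forall>e. length e = Suc (Suc m) \<longrightarrow> Tg True e \<le> sz e ^ cT"
    using Pg(2)[of False] Pg(2)[of True] unfolding pbd_def by blast
  define TB where "TB e = Suc (U e ^ cF + U e ^ cT + Suc (U e * 2 + 1 + Suc (U e * 2 + 1 + Suc (U e * 2 + 1 + 1))))" for e
  define B where "B c = Seq (Pg (c = 2)) (Seq (clear ?b2) (Seq (mv 3 ?b3 ?b4) (Seq (mv 3 ?b4 ?b2)
      (Push b (if c = 2 then 2 else 1)))))" for c :: nat
  let ?P = "Seq Pn (Seq (mv 3 b ?b1) (Seq Pz (Seq (Loop ?b1 B)
     (Seq (clear b) (Seq (mv 3 ?b2 ?b1) (mv 3 ?b1 d))))))"
  let ?T = "\<lambda>e. Suc (Tn e + Suc (length (n e) * 2 + 1 + Suc (Tz e + Suc (length (n e) * Suc (TB e) + 1 +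
     Suc (length (n e) * 2 + 1 + Suc (U e * 2 + 1 + (U e * 2 + 1)))))))"
  have "runs ?P \<sigma> (?T e) (\<sigma>(d := bits (R e (n e)) @ \<sigma> d))"
    if \<sigma>: "\<forall>k\<ge>b. \<sigma> k = []" "map \<sigma> rs = map bits e" for \<sigma> e
  proof -
    have em: "length e = m" using \<sigma>(2) r(1) by (metis length_map)
    have nb: "b + k \<notin> set rs" "b \<notin> set rs" "b + k \<noteq> d" "b \<noteq> d" for k using r by force+
    have Ub: "length (R e s) \<le> U e" if "length s \<le> length (n e)" for s
    proof -
      have "length (R e s) \<le> (sz e + length s) ^ C" using bound[OF em] .
      also have "\<dots> \<le> (sz e + length (n e)) ^ C" using that by (intro power_mono) auto
      finally show ?thesis by (simp add: U_def)
    qed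
    define F where "F u v = \<sigma>(b := bits (rev (map (\<lambda>c. c = (2::nat)) u)), ?b1 := v,
        ?b2 := bits (R e (rev (map (\<lambda>c. c = 2) u))))" for u v :: "nat list"
    have 1: "runs Pn \<sigma> (Tn e) (\<sigma>(b := bits (n e)))" using Pn(3)[OF _ \<sigma>(2)] \<sigma>(1) by simp
    have 2: "runs (mv 3 b ?b1) (\<sigma>(b := bits (n e))) (length ((\<sigma>(b := bits (n e))) b) * 2 + 1)
       (\<sigma>(?b1 := rev (bits (n e))))"
      by (rule runs_mv) (use bits_range[of "n e"] \<sigma>(1) in \<open>auto simp: fun_eq_iff simp del: bits_simps(5)\<close>)
    have 3: "runs Pz (\<sigma>(?b1 := rev (bits (n e)))) (Tz e) (F [] (rev (bits (n e))))"
    proof -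
      have "runs Pz (\<sigma>(?b1 := rev (bits (n e)))) (Tz e)
        ((\<sigma>(?b1 := rev (bits (n e))))(?b2 := bits (z e) @ (\<sigma>(?b1 := rev (bits (n e)))) ?b2))"
        by (rule Pz(3)) (use \<sigma> nb(1)[of 1] in \<open>auto simp: map_upd_notin\<close>)
      moreover have "(\<sigma>(?b1 := rev (bits (n e))))(?b2 := bits (z e) @ (\<sigma>(?b1 := rev (bits (n e)))) ?b2)
          = F [] (rev (bits (n e)))"
        using \<sigma>(1) R0[OF em] by (auto simp: F_def fun_eq_iff)
      ultimately show ?thesis by simp
    qed
    have 4: "runs (Loop ?b1 B) (F [] (rev (bits (n e)))) (length (rev (bits (n e))) * Suc (TB e) + 1) (F (rev (bits (n e))) [])"
    proof (rule runs_Loop_list)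
      fix u v assume "rev (bits (n e)) = u @ v" show "F u v ?b1 = v" by (simp add: F_def)
    next
      fix u c v assume w: "rev (bits (n e)) = u @ c # v"
      define s where "s = rev (map (\<lambda>c. c = (2::nat)) u)"
      have "c \<in> set (rev (bits (n e)))" using w by simp
      then have cb: "c = bit_symbol (c = 2)" by (auto simp: bits_def bit_symbol_def)
      have ls: "length s < length (n e)" using arg_cong[OF w, of length] by (simp add: s_def)
      have Fu: "F u x = \<sigma>(b := bits s, ?b1 := x, ?b2 := bits (R e s))" for x
        by (simp add: F_def s_def)
      have Fuc: "F (u @ [c]) x = \<sigma>(b := bits ((c = 2) # s), ?b1 := x, ?b2 := bits (R e ((c = 2) # s)))" for x
        by (simp add: F_def s_def)
      let ?w = "R e ((c = 2) # s)"
      let ?s0 = "\<sigma>(b := bits s, ?b1 := v, ?b2 := bits (R e s))"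
      let ?s1 = "\<sigma>(b := bits s, ?b1 := v, ?b2 := bits (R e s), ?b3 := bits ?w)"
      let ?s2 = "\<sigma>(b := bits s, ?b1 := v, ?b3 := bits ?w)"
      let ?s3 = "\<sigma>(b := bits s, ?b1 := v, ?b4 := rev (bits ?w))"
      let ?s4 = "\<sigma>(b := bits s, ?b1 := v, ?b2 := bits ?w)"
      let ?x = "R e s # s # e"
      have lx: "length ?x = Suc (Suc m)" using em by simp
      have sx: "sz ?x \<le> U e" using bound[OF em, of s] ls
        by (auto simp: U_def sz_def intro!: le_trans[OF bound[OF em, of s]] add_mono power_mono)
      have b1: "runs (Pg (c = 2)) ?s0 (Tg (c = 2) ?x) ?s1"
      proof -
        have "runs (Pg (c = 2)) ?s0 (Tg (c = 2) ?x) (?s0(?b3 := bits (g (c = 2) ?x) @ ?s0 ?b3))"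
          by (rule Pg(3)) (use \<sigma> nb(2) nb(1)[of 1] nb(1)[of 2] in \<open>auto simp: map_upd_notin\<close>)
        moreover have "?s0(?b3 := bits (g (c = 2) ?x) @ ?s0 ?b3) = ?s1"
          using \<sigma>(1) RS[OF em, of "c = 2" s] by (simp add: fun_eq_iff)
        ultimately show ?thesis by simp
      qed
      have b2: "runs (clear ?b2) ?s1 (length (?s1 ?b2) * 2 + 1) ?s2"
        by (rule runs_clear) (use \<sigma>(1) in \<open>auto simp: fun_eq_iff\<close>)
      have b3: "runs (mv 3 ?b3 ?b4) ?s2 (length (?s2 ?b3) * 2 + 1) ?s3"
        by (rule runs_mv) (use \<sigma>(1) bits_range[of ?w] in \<open>auto simp: fun_eq_iff simp del: bits_simps(5)\<close>)
      have b4: "runs (mv 3 ?b4 ?b2) ?s3 (length (?s3 ?b4) * 2 + 1) ?s4"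
        by (rule runs_mv) (use \<sigma>(1) bits_range[of "rev ?w"] in \<open>auto simp: fun_eq_iff\<close>)
      have b5: "runs (Push b (if c = 2 then 2 else 1)) ?s4 1 (F (u @ [c]) v)"
        unfolding Fuc by (rule runs_Push) (auto simp: fun_eq_iff bit_symbol_def)
      have "runs (B c) ?s0 (Suc (Tg (c = 2) ?x + Suc (length (?s1 ?b2) * 2 + 1 + Suc (length (?s2 ?b3) * 2 + 1 +
          Suc (length (?s3 ?b4) * 2 + 1 + 1))))) (F (u @ [c]) v)"
        unfolding B_def by (intro runs_Seq[OF b1] runs_Seq[OF b2] runs_Seq[OF b3] runs_Seq[OF b4] b5)
      then have "runs (B c) ?s0 (TB e) (F (u @ [c]) v)"
      proof (rule runs_mono)
        have "Tg (c = 2) ?x \<le> U e ^ cF + U e ^ cT"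
        proof (cases "c = 2")
          case True
          have "Tg True ?x \<le> sz ?x ^ cT" using cc lx by blast
          also have "\<dots> \<le> U e ^ cT" using sx by (rule power_mono) simp
          finally show ?thesis using True by simp
        next
          case False
          have "Tg False ?x \<le> sz ?x ^ cF" using cc lx by blast
          also have "\<dots> \<le> U e ^ cF" using sx by (rule power_mono) simp
          finally show ?thesis using False by simp
        qed
        moreover have "length (R e s) \<le> U e" "length ?w \<le> U e" using ls by (auto intro!: Ub)
        ultimately show "Suc (Tg (c = 2) ?x + Suc (length (?s1 ?b2) * 2 + 1 + Suc (length (?s2 ?b3) * 2 + 1 +
          Suc (length (?s3 ?b4) * 2 + 1 + 1)))) \<le> TB e" by (simp add: TB_def)
      qed
      moreover have "(F u (c # v))(?b1 := v) = ?s0" unfolding Fu by (auto simp: fun_eq_iff)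
      ultimately show "runs (B c) ((F u (c # v))(?b1 := v)) (TB e) (F (u @ [c]) v)" by simp
    qed
    have inv: "rev (map (\<lambda>c. c = 2) (rev (bits (n e)))) = n e"
      by (simp add: rev_map bits_def bit_symbol_def o_def)
    have Fe: "F (rev (bits (n e))) [] = \<sigma>(b := bits (n e), ?b2 := bits (R e (n e)))"
      unfolding F_def inv using \<sigma>(1) by (auto simp: fun_eq_iff)
    let ?w = "R e (n e)"
    let ?s5 = "\<sigma>(b := bits (n e), ?b2 := bits ?w)"
    have 5: "runs (clear b) ?s5 (length (?s5 b) * 2 + 1) (\<sigma>(?b2 := bits ?w))"
      by (rule runs_clear) (use \<sigma>(1) in \<open>auto simp: fun_eq_iff\<close>)
    let ?s6 = "\<sigma>(?b2 := bits ?w)"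
    have 6: "runs (mv 3 ?b2 ?b1) ?s6 (length (?s6 ?b2) * 2 + 1) (\<sigma>(?b1 := rev (bits ?w)))"
      by (rule runs_mv) (use \<sigma>(1) bits_range[of ?w] in \<open>auto simp: fun_eq_iff simp del: bits_simps(5)\<close>)
    let ?s7 = "\<sigma>(?b1 := rev (bits ?w))"
    have 7: "runs (mv 3 ?b1 d) ?s7 (length (?s7 ?b1) * 2 + 1) (\<sigma>(d := bits ?w @ \<sigma> d))"
      by (rule runs_mv) (use \<sigma>(1) r(3) bits_range[of "rev ?w"] in \<open>auto simp: fun_eq_iff\<close>)
    have "runs ?P \<sigma> (Suc (Tn e + Suc (length ((\<sigma>(b := bits (n e))) b) * 2 + 1 + Suc (Tz e + Suc (length (rev (bits (n e))) * Suc (TB e) + 1 +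
     Suc (length (?s5 b) * 2 + 1 + Suc (length (?s6 ?b2) * 2 + 1 + (length (?s7 ?b1) * 2 + 1))))))))
       (\<sigma>(d := bits ?w @ \<sigma> d))"
      by (intro runs_Seq[OF 1] runs_Seq[OF 2] runs_Seq[OF 3] runs_Seq[OF 4[unfolded Fe]] runs_Seq[OF 5] runs_Seq[OF 6] 7)
    then show ?thesis by (rule runs_mono) (use Ub[of "n e"] in simp)
  qed
  moreover have "wf_prog (An + Az + Ag True + Ag False + b + 6) ?P"
  proof -
    have "wf_prog (An + Az + Ag True + Ag False + b + 6) (Pg c)" for c
      by (rule wf_prog_mono[OF Pg(1)]) (cases c; simp)
    then show ?thesis using Pn(1) Pz(1) r(3) by (auto simp: B_def intro: wf_prog_mono)
  qed
  moreover have "pbd m ?T"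
  proof -
    have S: "pbd m (\<lambda>e. length (n e))" by (intro pbd_length_FP n)
    have U: "pbd m U" unfolding U_def by (intro pbd_intros S pbd_sz)
    have "pbd m TB" unfolding TB_def by (intro pbd_intros U)
    then show ?thesis by (intro pbd_intros S U Pn Pz)
  qed
  ultimately show "\<exists>P A T. computes m rs d b (\<lambda>e. R e (n e)) A P T"
    unfolding computes_def by blast
qed

section \<open>Composition in few arguments, tests and conditionals\<close>

lemma FP_comp1: "FP 1 (\<lambda>e. F (ev 0 e)) \<Longrightarrow> FP m f \<Longrightarrow> FP m (\<lambda>e. F (f e))"
  using FP_comp[of "[f]" "\<lambda>e. F (ev 0 e)" m] by simp

lemma FP_comp2:
  "FP 2 (\<lambda>e. F (ev 0 e) (ev 1 e)) \<Longrightarrow> FP m f \<Longrightarrow> FP m g \<Longrightarrow> FP m (\<lambda>e. F (f e) (g e))"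
  using FP_comp[of "[f, g]" "\<lambda>e. F (ev 0 e) (ev 1 e)" m] by (auto simp: numeral_2_eq_2)

lemma FP_comp3:
  "FP 3 (\<lambda>e. F (ev 0 e) (ev 1 e) (ev 2 e)) \<Longrightarrow> FP m f \<Longrightarrow> FP m g \<Longrightarrow> FP m h \<Longrightarrow>
    FP m (\<lambda>e. F (f e) (g e) (h e))"
  using FP_comp[of "[f, g, h]" "\<lambda>e. F (ev 0 e) (ev 1 e) (ev 2 e)" m]
  by (auto simp: numeral_3_eq_3 numeral_2_eq_2)

lemma FP_tl_env:
  assumes "FP m f" shows "FP (Suc m) (\<lambda>e. f (tl e))"
proof -
  let ?gs = "map (\<lambda>i. ev (Suc i)) [0..<m]"
  have "FP (Suc m) (\<lambda>e. f (map (\<lambda>g. g e) ?gs))"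
    by (rule FP_comp) (use assms FP_ev in auto)
  then show ?thesis
    by (rule FP_cong) (auto intro!: arg_cong[of _ _ f] nth_equalityI simp: nth_tl ev_def)
qed

lemma FP_Cons: "FP m f \<Longrightarrow> FP m (\<lambda>e. c # f e)"
  using FP_append[OF FP_const[of m "[c]"]] by fastforce

lemma FP_tl:
  assumes "FP m f" shows "FP m (\<lambda>e. tl (f e))"
proof -
  have "FP m (\<lambda>e. case f e of [] \<Rightarrow> [] | c # s \<Rightarrow> ev 0 (s # e))"
    by (rule FP_case[where g = "\<lambda>c. ev 0"]) (intro assms FP_const FP_ev)+
  then show ?thesis by (rule FP_cong) (auto split: list.splits)
qed

lemma FP_if_Nil:
  assumes "FP m n" "FP m f" "FP m g" shows "FP m (\<lambda>e. if n e = [] then f e else g e)"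
proof -
  have "FP m (\<lambda>e. case n e of [] \<Rightarrow> f e | c # s \<Rightarrow> (\<lambda>e. g (tl e)) (s # e))"
    by (rule FP_case[where g = "\<lambda>c e. g (tl e)"]) (intro assms FP_tl_env)+
  then show ?thesis by (rule FP_cong) (auto split: list.splits)
qed

definition hdb :: "bool list \<Rightarrow> bool" where
  "hdb w = (case w of [] \<Rightarrow> False | c # _ \<Rightarrow> c)"

lemma hdb_simps [simp]: "hdb [] = False" "hdb (c # w) = c"
  by (simp_all add: hdb_def)

lemma FP_if_hdb:
  assumes "FP m n" "FP m f" "FP m g" shows "FP m (\<lambda>e. if hdb (n e) then f e else g e)"
proof -
  have "FP m (\<lambda>e. case n e of [] \<Rightarrow> g e | c # s \<Rightarrow> (if c then \<lambda>e. f (tl e) else (\<lambda>e. g (tl e))) (s # e))"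
    by (rule FP_case[where g = "\<lambda>c. if c then \<lambda>e. f (tl e) else (\<lambda>e. g (tl e))"])
      (auto intro: assms FP_tl_env)
  then show ?thesis by (rule FP_cong) (auto split: list.splits)
qed

lemma FP_if: "FP m (\<lambda>e. [Q e]) \<Longrightarrow> FP m f \<Longrightarrow> FP m g \<Longrightarrow> FP m (\<lambda>e. if Q e then f e else g e)"
  using FP_if_hdb[of m "\<lambda>e. [Q e]" f g] by simp

lemma FP_If_const: "(c \<Longrightarrow> FP m f) \<Longrightarrow> (\<not> c \<Longrightarrow> FP m g) \<Longrightarrow> FP m (\<lambda>e. if c then f e else g e)"
  by (cases c) simp_all


subsection \<open>Unary numbers and loops\<close>

definition un :: "nat \<Rightarrow> bool list" where "un n = replicate n True"

lemma un_simps [simp]: "un 0 = []" "un (Suc n) = True # un n" "length (un n) = n"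
  by (simp_all add: un_def)

text \<open>A number written in unary has polynomially bounded size, so that loops may run up to it.
  Binary numbers occur only inside encodings and when starting times are compared.\<close>

definition FN :: "nat \<Rightarrow> (bool list list \<Rightarrow> nat) \<Rightarrow> bool" where
  "FN m h \<longleftrightarrow> FP m (\<lambda>e. un (h e))"

lemma FN_length:
  assumes "FP m f" shows "FN m (\<lambda>e. length (f e))"
  unfolding FN_def
  by (rule FP_rec[where n = f and z = "\<lambda>_. []" and g = "\<lambda>c e. True # ev 0 e" and C = 1])
    (auto intro: assms FP_const FP_Cons FP_ev)

lemma FN_var: "FN m (\<lambda>e. length (ev i e))"
  by (intro FN_length FP_ev)

lemma FN_const: "FN m (\<lambda>e. k)"
  unfolding FN_def by (rule FP_const)

lemma FN_add: "FN m f \<Longrightarrow> FN m g \<Longrightarrow> FN m (\<lambda>e. f e + g e)"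
  unfolding FN_def un_def replicate_add by (rule FP_append)

lemma FN_Suc: "FN m f \<Longrightarrow> FN m (\<lambda>e. Suc (f e))"
  using FN_add[of m f "\<lambda>_. 1"] FN_const[of m 1] by simp

lemma pbd_FN: "FN m f \<Longrightarrow> pbd m f"
  using pbd_length_FP[of m "\<lambda>e. un (f e)"] by (simp add: FN_def)

text \<open>Since \<open>F\<close> does not lengthen strings, the start value bounds all iterates,
  as bounded recursion demands.\<close>

lemma FP_iter:
  assumes F: "FP 1 (\<lambda>e. F (ev 0 e))" and len: "\<And>w. length (F w) \<le> length w"
    and n: "FN m n" and f: "FP m f"
  shows "FP m (\<lambda>e. (F ^^ n e) (f e))"
proof -
  obtain C where C: "\<And>e. length e = m \<Longrightarrow> length (f e) \<le> sz e ^ C"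
    using pbd_length_FP[OF f] unfolding pbd_def by blast
  have L: "length ((F ^^ k) w) \<le> length w" for k w
    by (induction k) (auto intro: le_trans[OF len])
  have "FP m (\<lambda>e. (\<lambda>e s. (F ^^ length s) (f e)) e (un (n e)))"
  proof (rule FP_rec[where R = "\<lambda>e s. (F ^^ length s) (f e)" and n = "\<lambda>e. un (n e)" and
        z = f and g = "\<lambda>c e. F (ev 0 e)" and C = C])
    show "FP m (\<lambda>e. un (n e))" using n by (simp add: FN_def)
    show "FP (Suc (Suc m)) (\<lambda>e. F (ev 0 e))" by (intro FP_comp1[OF F] FP_ev)
    fix e :: "bool list list" and s :: "bool list" assume e: "length e = m"
    have "length ((F ^^ length s) (f e)) \<le> length (f e)" by (rule L)
    also have "\<dots> \<le> sz e ^ C" by (rule C[OF e])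
    also have "\<dots> \<le> (sz e + length s) ^ C" by (rule power_mono) auto
    finally show "length ((F ^^ length (s :: bool list)) (f e)) \<le> (sz e + length s) ^ C" .
  qed (use f in auto)
  then show ?thesis by simp
qed

lemma FP_drop:
  assumes "FN m n" "FP m f" shows "FP m (\<lambda>e. drop (n e) (f e))"
proof -
  have "FP m (\<lambda>e. (tl ^^ n e) (f e))"
    by (rule FP_iter[OF FP_tl[OF FP_ev] _ assms]) simp
  moreover have "(tl ^^ k) w = drop k w" for k and w :: "bool list"
    by (induction k) (auto simp: drop_Suc tl_drop)
  ultimately show ?thesis by simp
qed

lemma FN_minus: "FN m f \<Longrightarrow> FN m g \<Longrightarrow> FN m (\<lambda>e. f e - g e)"
  using FP_drop[of m g "\<lambda>e. un (f e)"] by (simp add: FN_def un_def)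

text \<open>Recursion on the unary bound meets suffixes of lengths 0, 1, 2 and so on; such a suffix
  is itself the loop index in unary. The body receives it as an additional first argument.\<close>

lemma FP_for:
  assumes body: "FP (Suc m) (\<lambda>e. body (length (ev 0 e)) (tl e))" and n: "FN m n"
  shows "FP m (\<lambda>e. concat (map (\<lambda>i. body i e) [0..<n e]))"
proof -
  obtain C where C: "\<And>e. length e = Suc m \<Longrightarrow> length (body (length (ev 0 e)) (tl e)) \<le> sz e ^ C"
    using pbd_length_FP[OF body] unfolding pbd_def by blast
  have "FP m (\<lambda>e. (\<lambda>e s. concat (map (\<lambda>i. body i e) [0..<length s])) e (un (n e)))"
  proof (rule FP_rec[where R = "\<lambda>e s. concat (map (\<lambda>i. body i e) [0..<length s])" and
        n = "\<lambda>e. un (n e)" and z = "\<lambda>_. []" and C = "Suc C" and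
        g = "\<lambda>c e. ev 0 e @ body (length (ev 0 (tl e))) (tl (tl e))"])
    show "FP m (\<lambda>e. un (n e))" using n by (simp add: FN_def)
    show "FP (Suc (Suc m)) (\<lambda>e. ev 0 e @ body (length (ev 0 (tl e))) (tl (tl e)))"
      by (intro FP_append FP_ev FP_tl_env[OF body])
    fix e :: "bool list list" and s :: "bool list" assume e: "length e = m"
    have "length (body i e) \<le> (sz e + length s) ^ C" if "i < length (s :: bool list)" for i
    proof -
      have "length (body i e) \<le> sz (un i # e) ^ C" using C[of "un i # e"] e by simp
      also have "\<dots> \<le> (sz e + length s) ^ C" using that by (intro power_mono) (auto simp: sz_def)
      finally show ?thesis .
    qed
    then have "length (concat (map (\<lambda>i. body i e) [0..<length s])) \<le> length s * (sz e + length s) ^ C"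
      using sum_list_mono[of "[0..<length s]" "\<lambda>i. length (body i e)" "\<lambda>i. (sz e + length s) ^ C"]
      by (simp add: length_concat o_def sum_list_triv)
    also have "\<dots> \<le> (sz e + length s) ^ Suc C" by simp
    finally show "length (concat (map (\<lambda>i. body i e) [0..<length s])) \<le> (sz e + length s) ^ Suc C" .
  qed (auto intro: FP_const)
  then show ?thesis by simp
qed

lemma concat_map_un: "concat (map (\<lambda>i. un k) [0..<n]) = un (n * k)"
  by (induction n) (auto simp: un_def add.commute simp flip: replicate_add)

lemma FN_mult: assumes "FN m f" "FN m g" shows "FN m (\<lambda>e. f e * g e)"
  using FP_for[of m "\<lambda>i e. un (g e)" f] FP_tl_env[of m "\<lambda>e. un (g e)"] assms
  by (simp add: FN_def concat_map_un)

lemma FN_power: "FN m f \<Longrightarrow> FN m (\<lambda>e. f e ^ k)"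
  by (induction k) (auto intro: FN_mult FN_const simp: FN_const[of m 1, simplified])

lemma FN_poly: "FN m f \<Longrightarrow> FN m (\<lambda>e. poly p (f e))"
  by (induction p) (auto intro: FN_mult FN_add FN_const)

lemma FN_if: "FP m (\<lambda>e. [Q e]) \<Longrightarrow> FN m f \<Longrightarrow> FN m g \<Longrightarrow> FN m (\<lambda>e. if Q e then f e else g e)"
  unfolding FN_def if_distrib[of un] by (rule FP_if)

lemma FB_eq: assumes "FN m f" "FN m g" shows "FP m (\<lambda>e. [f e = g e])"
proof -
  have "FP m (\<lambda>e. if un (f e - g e) @ un (g e - f e) = [] then [True] else [False])"
    by (intro FP_if_Nil FP_append FP_const FN_minus[unfolded FN_def] assms[unfolded FN_def])
  then show ?thesis by (rule FP_cong) (auto simp: un_def)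
qed

lemma FB_hdb: assumes "FP m f" shows "FP m (\<lambda>e. [hdb (f e)])"
  by (rule FP_cong[OF FP_if_hdb[OF assms FP_const[of _ "[True]"] FP_const[of _ "[False]"]]]) auto

lemma FB_hdb_eq: assumes "FP m f" "FP m g" shows "FP m (\<lambda>e. [hdb (f e) = hdb (g e)])"
  by (rule FP_cong[OF FP_if_hdb[OF assms(1) FB_hdb[OF assms(2)]
      FP_if_hdb[OF assms(2) FP_const[of _ "[False]"] FP_const[of _ "[True]"]]]]) auto

text \<open>One symbol is written for every counterexample; the test is whether anything was
  written.\<close>

lemma FB_all:
  assumes "FP (Suc m) (\<lambda>e. [Q (length (ev 0 e)) (tl e)])" "FN m n"
  shows "FP m (\<lambda>e. [\<forall>i<n e. Q i e])"
proof -
  have "FP m (\<lambda>e. if concat (map (\<lambda>i. if Q i e then [] else [True]) [0..<n e]) = [] then [True] else [False])"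
    by (intro FP_if_Nil FP_for FP_const FP_if assms)
  moreover have "concat (map (\<lambda>i. if Q i e then [] else [True]) [0..<k]) = [] \<longleftrightarrow> (\<forall>i<k. Q i e)" for e k
    by (induction k) (auto simp: less_Suc_eq)
  ultimately show ?thesis by (elim FP_cong) (simp only:, simp)
qed

subsection \<open>String functions\<close>

lemma FP_rev: assumes "FP m f" shows "FP m (\<lambda>e. rev (f e))"
  by (rule FP_rec[where n = f and z = "\<lambda>_. []" and g = "\<lambda>c e. ev 0 e @ [c]" and C = 1])
    (auto intro: assms FP_const FP_append FP_ev)

lemma enc_string_simps [simp]: "enc_string [] = [False]" "enc_string (c # s) = True # c # enc_string s"
  by (simp_all add: enc_string_def enc_list_def)

lemma length_enc_string: "length (enc_string s) = 2 * length s + 1"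
  by (induction s) auto

lemma FP_enc_string: assumes "FP m f" shows "FP m (\<lambda>e. enc_string (f e))"
proof (rule FP_rec[where n = f and z = "\<lambda>_. [False]" and g = "\<lambda>c e. True # c # ev 0 e" and C = 2])
  fix e :: "bool list list" and s :: "bool list"
  have "length (enc_string s) \<le> 2 * (sz e + length s)"
    using sz_ge_2[of e] unfolding length_enc_string distrib_left by linarith
  also have "\<dots> \<le> (sz e + length s) ^ 2"
    unfolding power2_eq_square by (rule mult_right_mono) (use sz_ge_2[of e] in auto)
  finally show "length (enc_string s) \<le> (sz e + length s) ^ 2" .
  show "FP (Suc (Suc m)) (\<lambda>e. True # c # ev 0 e)" for c by (intro FP_Cons FP_ev)
qed (auto intro: assms FP_const)

fun inc :: "bool list \<Rightarrow> bool list" where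
  "inc [] = [True]"
| "inc (False # s) = True # s"
| "inc (True # s) = False # inc s"

lemma length_inc: "length (inc s) \<le> length s + 1"
  by (induction s rule: inc.induct) auto

lemma FP_inc: assumes "FP m f" shows "FP m (\<lambda>e. inc (f e))"
proof (rule FP_rec[where n = f and z = "\<lambda>_. [True]" and C = 1 and
      g = "\<lambda>c e. if c then False # ev 0 e else True # ev 1 e"])
  fix e :: "bool list list" and s :: "bool list"
  show "length (inc s) \<le> (sz e + length s) ^ 1" using length_inc[of s] by (simp add: sz_def)
next
  fix e :: "bool list list" and c and s :: "bool list"
  show "inc (c # s) = (if c then False # ev 0 (inc s # s # e) else True # ev 1 (inc s # s # e))"
    by (cases c) auto
next
  fix c show "FP (Suc (Suc m)) (\<lambda>e. if c then False # ev 0 e else True # ev 1 e)"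
    by (cases c) (auto intro: FP_Cons FP_ev)
qed (auto intro: assms FP_const)

lemma binary_0 [simp]: "binary 0 = []"
  by (simp add: binary.simps)

lemma binary_double: "n > 0 \<Longrightarrow> binary (2 * n) = False # binary n"
  "binary (Suc (2 * n)) = True # binary n"
  by (subst binary.simps, simp)+

lemma binary_Suc: "binary (Suc n) = inc (binary n)"
proof (induction n rule: less_induct)
  case (less n)
  show ?case
  proof (cases "even n")
    case True
    then obtain k where k: "n = 2 * k" by (elim evenE)
    then show ?thesis by (cases "k = 0") (use binary_double[of 0] in \<open>auto simp: binary_double\<close>)
  next
    case False
    then obtain k where k: "n = Suc (2 * k)" by (auto elim: oddE)
    then have "binary (Suc k) = inc (binary k)" by (intro less) simp
    moreover have "Suc n = 2 * Suc k" using k by simp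
    ultimately show ?thesis by (simp only: binary_double(1)[OF zero_less_Suc])
        (simp add: k binary_double(2))
  qed
qed

lemma length_binary: "length (binary n) \<le> n"
  by (induction n) (use length_inc in \<open>auto simp: binary_Suc intro: le_trans\<close>)

text \<open>Unary becomes binary by counting: one \<open>inc\<close> for each symbol of the unary
  number.\<close>

lemma FP_enc_nat: assumes "FN m f" shows "FP m (\<lambda>e. enc_nat (f e))"
proof -
  have "FP m (\<lambda>e. (\<lambda>e s. binary (length s)) e (un (f e)))"
  proof (rule FP_rec[where R = "\<lambda>e s. binary (length s)" and n = "\<lambda>e. un (f e)" and
        z = "\<lambda>_. []" and g = "\<lambda>c e. inc (ev 0 e)" and C = 1])
    fix e :: "bool list list" and s :: "bool list"
    show "length (binary (length s)) \<le> (sz e + length s) ^ 1"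
      using length_binary[of "length s"] by simp
  qed (use assms in \<open>auto intro: FP_const FP_inc FP_ev simp: FN_def binary_Suc\<close>)
  then show ?thesis unfolding enc_nat_def by (intro FP_enc_string) simp
qed

text \<open>Lists of literals are kept as terminated unary blocks, so that an entry is found by
  dropping the preceding blocks.\<close>

definition enc_nats :: "nat list \<Rightarrow> bool list" where
  "enc_nats ns = concat (map (\<lambda>k. un k @ [False]) ns)"

lemma enc_nats_simps [simp]: "enc_nats [] = []" "enc_nats (k # ns) = un k @ False # enc_nats ns"
  "enc_nats (ms @ ns) = enc_nats ms @ enc_nats ns"
  by (simp_all add: enc_nats_def)

fun drop_block :: "bool list \<Rightarrow> bool list" where
  "drop_block [] = []"
| "drop_block (c # s) = (if c then drop_block s else s)"

fun first_block :: "bool list \<Rightarrow> bool list" where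
  "first_block [] = []"
| "first_block (c # s) = (if c then True # first_block s else [])"

lemma blocks_un [simp]: "drop_block (un k @ False # s) = s" "first_block (un k @ False # s) = un k"
  by (induction k) auto

lemma length_drop_block: "length (drop_block s) \<le> length s"
  by (induction s) auto

lemma length_first_block: "length (first_block s) \<le> length s"
  by (induction s) auto

lemma FP_drop_block: assumes "FP m f" shows "FP m (\<lambda>e. drop_block (f e))"
proof (rule FP_rec[where n = f and z = "\<lambda>_. []" and g = "\<lambda>c e. if c then ev 0 e else ev 1 e" and C = 1])
  fix e :: "bool list list" and s :: "bool list"
  show "length (drop_block s) \<le> (sz e + length s) ^ 1" using length_drop_block[of s] by simp
qed (auto intro: assms FP_const FP_ev FP_If_const)

lemma FP_first_block: assumes "FP m f" shows "FP m (\<lambda>e. first_block (f e))"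
proof (rule FP_rec[where n = f and z = "\<lambda>_. []" and g = "\<lambda>c e. if c then True # ev 0 e else []" and C = 1])
  fix e :: "bool list list" and s :: "bool list"
  show "length (first_block s) \<le> (sz e + length s) ^ 1" using length_first_block[of s] by simp
  show "FP (Suc (Suc m)) (\<lambda>e. if c then True # ev 0 e else [])" for c
    by (intro FP_If_const FP_Cons FP_ev FP_const)
qed (auto intro: assms FP_const)

lemma nth_enc_nats: "i < length ns \<Longrightarrow> length (first_block ((drop_block ^^ i) (enc_nats ns))) = ns ! i"
proof (induction ns arbitrary: i)
  case (Cons k ns)
  show ?case
  proof (cases i)
    case (Suc j)
    then have "(drop_block ^^ i) (enc_nats (k # ns)) = (drop_block ^^ j) (enc_nats ns)"
      by (simp add: funpow_Suc_right del: funpow.simps)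
    then show ?thesis using Cons Suc by simp
  qed simp
qed simp

definition nth_block :: "bool list \<Rightarrow> nat \<Rightarrow> nat" where
  "nth_block w i = length (first_block ((drop_block ^^ i) w))"

lemma FN_nth_block: "FP m f \<Longrightarrow> FN m n \<Longrightarrow> FN m (\<lambda>e. nth_block (f e) (n e))"
  unfolding nth_block_def
  by (intro FN_length FP_first_block FP_iter[OF FP_drop_block[OF FP_ev]] length_drop_block)

subsection \<open>Parsing\<close>

text \<open>Recursion on suffixes cannot tell flags from digits, because it meets the right end
  first. Therefore positions are counted from the left: digit \<open>i\<close> exists iff the flags
  at the positions 0, 2, ..., \<open>2 * i\<close> are all set.\<close>

definition unstr :: "bool list \<Rightarrow> bool list" where
  "unstr w = concat (map (\<lambda>i. if \<forall>j<Suc i. hdb (drop (2 * j) w) then [hdb (drop (Suc (2 * i)) w)] else [])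
     [0..<length w])"

lemma drop_enc_string: "j \<le> length x \<Longrightarrow> drop (2 * j) (enc_string x @ r) = enc_string (drop j x) @ r"
proof (induction x arbitrary: j)
  case (Cons c x) then show ?case by (cases j) auto
qed simp

lemma hdb_drop_enc_string:
  "j \<le> length x \<Longrightarrow> hdb (drop (2 * j) (enc_string x @ r)) \<longleftrightarrow> j < length x"
  by (subst drop_enc_string) (cases "j = length x"; auto simp: Cons_nth_drop_Suc[symmetric])+

lemma hdb_drop_enc_string':
  assumes "j < length x" shows "hdb (drop (Suc (2 * j)) (enc_string x @ r)) = x ! j"
proof -
  have "drop (Suc (2 * j)) (enc_string x @ r) = drop 1 (drop (2 * j) (enc_string x @ r))"
    unfolding drop_drop by (simp del: drop_append)
  also have "\<dots> = drop 1 (enc_string (drop j x) @ r)" using assms by (subst drop_enc_string) auto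
  finally show ?thesis using assms by (simp add: Cons_nth_drop_Suc[symmetric])
qed

lemma concat_map_nth:
  "length x \<le> n \<Longrightarrow> concat (map (\<lambda>i. if i < length x then [x ! i] else []) [0..<n]) = x"
proof -
  assume "length x \<le> n"
  then have "[0..<n] = [0..<length x] @ [length x..<n]" by (metis le_add_diff_inverse upt_add_eq_append zero_le)
  moreover have "concat (map (\<lambda>i. if i < length x then [x ! i] else []) [length x..<n]) = []"
    by simp
  moreover have "concat (map (\<lambda>i. if i < length x then [x ! i] else []) [0..<length x]) =
     concat (map (\<lambda>i. [x ! i]) [0..<length x])"
    by (intro arg_cong[of _ _ concat] map_cong) auto
  moreover have "concat (map (\<lambda>i. [x ! i]) [0..<length x]) = x"
    by (simp add: map_nth concat_map_singleton)
  ultimately show ?thesis by simp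
qed

lemma unstr_enc_string [simp]: "unstr (enc_string x @ r) = x"
proof -
  let ?w = "enc_string x @ r"
  have *: "(\<forall>j<Suc i. hdb (drop (2 * j) ?w)) \<longleftrightarrow> i < length x" for i
  proof (cases "i < length x")
    case True
    then show ?thesis using hdb_drop_enc_string[of _ x r] by auto
  next
    case False
    then show ?thesis using hdb_drop_enc_string[of "length x" x r] by (auto intro!: exI[of _ "length x"])
  qed
  have "unstr ?w = concat (map (\<lambda>i. if i < length x then [x ! i] else []) [0..<length ?w])"
    unfolding unstr_def * using hdb_drop_enc_string'[of _ x r]
    by (intro arg_cong[of _ _ concat] map_cong) auto
  also have "\<dots> = x" by (rule concat_map_nth) (simp add: length_enc_string)
  finally show ?thesis .
qed

lemma FP_unstr: assumes "FP m f" shows "FP m (\<lambda>e. unstr (f e))"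
proof -
  have "FP 1 (\<lambda>e. unstr (ev 0 e))"
    unfolding unstr_def
    by (intro FP_for FP_if FB_all FB_hdb FP_drop FP_const FN_length FN_Suc FN_mult FN_const; simp)
      (intro FP_ev FN_var FN_Suc FN_mult FN_const)+
  then show ?thesis by (rule FP_comp1[OF _ assms])
qed

definition skip_string :: "bool list \<Rightarrow> bool list" where
  "skip_string w = drop (Suc (2 * length (unstr w))) w"

lemma skip_string_enc [simp]: "skip_string (enc_string x @ r) = r"
  by (simp add: skip_string_def length_enc_string)

lemma FP_skip_string: "FP m f \<Longrightarrow> FP m (\<lambda>e. skip_string (f e))"
  unfolding skip_string_def by (intro FP_drop FN_Suc FN_mult FN_const FN_length FP_unstr)

subsection \<open>Comparing rational numbers\<close>

fun val :: "bool list \<Rightarrow> nat" where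
  "val [] = 0"
| "val (c # s) = of_bool c + 2 * val s"

lemma val_binary [simp]: "val (binary n) = n"
proof (induction n rule: less_induct)
  case (less n)
  show ?case
  proof (cases "n = 0")
    case False
    then have "val (binary (n div 2)) = n div 2" by (intro less) simp
    then show ?thesis using False by (subst binary.simps) (simp add: of_bool_def; presburger)
  qed simp
qed

lemma val_append: "val (s @ t) = val s + 2 ^ length s * val t"
  by (induction s) auto

lemma val_zeros [simp]: "val (replicate n False) = 0"
  by (induction n) auto

lemma val_less: "val s < 2 ^ length s"
  by (induction s) (auto simp: of_bool_def)

text \<open>Positions behind the end of \<open>y\<close> count as the digit 0, by the default value
  of \<open>hdb\<close>; so no case distinction on lengths is needed later.\<close>

lemma val_take_Suc: "val (take (Suc n) y) = val (take n y) + 2 ^ n * of_bool (hdb (drop n y))"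
proof (cases "n < length y")
  case True
  then show ?thesis
    by (simp add: take_Suc_conv_app_nth val_append hd_drop_conv_nth Cons_nth_drop_Suc[symmetric])
qed simp

text \<open>Addition and comparison run through the first number with the most significant digit
  first, so that recursion on suffixes meets the least significant digit first. The first
  symbol of \<open>add_rev y s\<close> is the carry.\<close>

fun add_rev :: "bool list \<Rightarrow> bool list \<Rightarrow> bool list" where
  "add_rev y [] = [False]"
| "add_rev y (c # s) = (let a = hdb (add_rev y s); d = hdb (drop (length s) y) in
     (if c = d then c else a) # ((c = d) = a) # tl (add_rev y s))"

lemma length_add_rev: "length (add_rev y s) = length s + 1"
  by (induction s) (auto simp: Let_def)

lemma val_add_rev: "val (rev (add_rev y s)) = val (rev s) + val (take (length s) y)"
proof (induction s)
  case (Cons c s)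
  obtain a t where at: "add_rev y s = a # t" "length t = length s"
    using length_add_rev[of y s] by (cases "add_rev y s") auto
  show ?case using Cons at
    by (auto simp: val_append val_take_Suc Let_def algebra_simps split: if_splits)
qed simp

text \<open>The zeros make the first number long enough for the recursion on it to meet every digit
  of the second.\<close>

definition add :: "bool list \<Rightarrow> bool list \<Rightarrow> bool list" where
  "add x y = rev (add_rev y (rev (x @ replicate (length y) False)))"

lemma val_add: "val (add x y) = val x + val y"
  by (simp add: add_def val_add_rev val_append)

lemma length_add: "length (add x y) = length x + length y + 1"
  by (simp add: add_def length_add_rev)

lemma FP_zeros: assumes "FP m f" shows "FP m (\<lambda>e. replicate (length (f e)) False)"
  by (rule FP_rec[where n = f and z = "\<lambda>_. []" and g = "\<lambda>c e. False # ev 0 e" and C = 1])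
    (auto intro: assms FP_const FP_Cons FP_ev)

lemma FP_add: assumes "FP m f" "FP m g" shows "FP m (\<lambda>e. add (f e) (g e))"
proof -
  have "FP 2 (\<lambda>e. add (ev 0 e) (ev 1 e))"
    unfolding add_def
  proof (rule FP_rev, rule FP_rec[where R = "\<lambda>e. add_rev (ev 1 e)" and
        n = "\<lambda>e. rev (ev 0 e @ replicate (length (ev 1 e)) False)" and z = "\<lambda>_. [False]" and C = 1 and g = "\<lambda>c e.
      (if hdb (drop (length (ev 1 e)) (ev 3 e)) = hdb [c] then [c] else [hdb (ev 0 e)]) @
      [(hdb (drop (length (ev 1 e)) (ev 3 e)) = hdb [c]) = hdb (ev 0 e)] @ tl (ev 0 e)"])
    show "FP 2 (\<lambda>e. rev (ev 0 e @ replicate (length (ev 1 e)) False))"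
      by (intro FP_rev FP_append FP_zeros FP_ev)
  next
    fix c
    have *: "FP m (\<lambda>e. [P e = Q e])" if "FP m (\<lambda>e. [P e])" "FP m (\<lambda>e. [Q e])" for m P Q
      using FB_hdb_eq[OF that] by simp
    show "FP (Suc (Suc 2)) (\<lambda>e. (if hdb (drop (length (ev 1 e)) (ev 3 e)) = hdb [c] then [c] else [hdb (ev 0 e)]) @
      [(hdb (drop (length (ev 1 e)) (ev 3 e)) = hdb [c]) = hdb (ev 0 e)] @ tl (ev 0 e))"
      by (intro FP_append FP_if FB_hdb_eq FP_drop FN_var FP_ev FP_const FB_hdb * FP_tl)
  next
    fix e :: "bool list list" and s :: "bool list"
    show "length (add_rev (ev 1 e) s) \<le> (sz e + length s) ^ 1"
      by (simp add: length_add_rev sz_def)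
  qed (auto simp: Let_def intro: FP_const)
  then show ?thesis by (rule FP_comp2[OF _ assms])
qed

fun mult :: "bool list \<Rightarrow> bool list \<Rightarrow> bool list" where
  "mult y [] = []"
| "mult y (c # s) = add (False # mult y s) (if c then y else [])"

lemma val_mult: "val (mult y s) = val y * val s"
  by (induction s) (auto simp: val_add algebra_simps)

lemma length_mult: "length (mult y s) \<le> length s * (length y + 2)"
  by (induction s) (auto simp: length_add)

lemma FP_mult: assumes "FP m f" "FP m g" shows "FP m (\<lambda>e. mult (f e) (g e))"
proof -
  have "FP 2 (\<lambda>e. mult (ev 0 e) (ev 1 e))"
  proof (rule FP_rec[where R = "\<lambda>e. mult (ev 0 e)" and n = "ev 1" and z = "\<lambda>_. []" and C = 2 and
        g = "\<lambda>c e. add (False # ev 0 e) (if c then ev 2 e else [])"])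
    fix c show "FP (Suc (Suc 2)) (\<lambda>e. add (False # ev 0 e) (if c then ev 2 e else []))"
      by (intro FP_add FP_Cons FP_ev FP_If_const FP_const)
  next
    fix e :: "bool list list" and s :: "bool list" assume "length e = 2"
    then have "length (ev 0 e) + 2 \<le> sz e" by (auto simp: sz_def ev_def numeral_2_eq_2 length_Suc_conv)
    then have "length s * (length (ev 0 e) + 2) \<le> (sz e + length s) * (sz e + length s)"
      by (intro mult_mono) auto
    then show "length (mult (ev 0 e) s) \<le> (sz e + length s) ^ 2"
      using length_mult[of "ev 0 e" s] by (simp add: power2_eq_square)
  qed (auto intro: FP_const FP_ev)
  then show ?thesis by (rule FP_comp2[OF _ assms])
qed

fun less_rev :: "bool list \<Rightarrow> bool list \<Rightarrow> bool list" where
  "less_rev y [] = []"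
| "less_rev y (c # s) = (if c = hdb (drop (length s) y) then less_rev y s else [\<not> c])"

lemma hdb_less_rev: "hdb (less_rev y s) \<longleftrightarrow> val (rev s) < val (take (length s) y)"
proof (induction s)
  case (Cons c s)
  have "val (rev s) < 2 ^ length s" using val_less[of "rev s"] by simp
  moreover have "val (take (length s) y) < 2 ^ length s"
    by (rule less_le_trans[OF val_less]) simp
  ultimately show ?case using Cons by (cases c) (auto simp: val_append val_take_Suc)
qed simp

definition less_bin :: "bool list \<Rightarrow> bool list \<Rightarrow> bool" where
  "less_bin x y = hdb (less_rev y (rev (x @ replicate (length y) False)))"

lemma less_bin: "less_bin x y \<longleftrightarrow> val x < val y"
  by (simp add: less_bin_def hdb_less_rev val_append)

lemma FB_less_bin: assumes "FP m f" "FP m g" shows "FP m (\<lambda>e. [less_bin (f e) (g e)])"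
proof -
  have "FP 2 (\<lambda>e. [less_bin (ev 0 e) (ev 1 e)])"
    unfolding less_bin_def
  proof (rule FB_hdb, rule FP_rec[where R = "\<lambda>e. less_rev (ev 1 e)" and
        n = "\<lambda>e. rev (ev 0 e @ replicate (length (ev 1 e)) False)" and z = "\<lambda>_. []" and C = 1 and g = "\<lambda>c e.
      (if hdb (drop (length (ev 1 e)) (ev 3 e)) = hdb [c] then ev 0 e else [\<not> c])"])
    show "FP 2 (\<lambda>e. rev (ev 0 e @ replicate (length (ev 1 e)) False))"
      by (intro FP_rev FP_append FP_zeros FP_ev)
  next
    fix c
    show "FP (Suc (Suc 2)) (\<lambda>e. (if hdb (drop (length (ev 1 e)) (ev 3 e)) = hdb [c] then ev 0 e else [\<not> c]))"
      by (intro FP_if FB_hdb_eq FP_drop FN_var FP_ev FP_const)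
  next
    fix e :: "bool list list" and s :: "bool list"
    have "length (less_rev (ev 1 e) s) \<le> Suc (length s)" by (induction s) auto
    then show "length (less_rev (ev 1 e) s) \<le> (sz e + length s) ^ 1"
      by (simp add: sz_def)
  qed (auto intro: FP_const)
  then show ?thesis by (rule FP_comp2[OF _ assms])
qed

definition num_of :: "bool list \<Rightarrow> bool list" where "num_of w = unstr (tl w)"
definition den_of :: "bool list \<Rightarrow> bool list" where "den_of w = unstr (tl (skip_string (tl w)))"

definition less_rat :: "bool list \<Rightarrow> bool list \<Rightarrow> bool" where
  "less_rat v w = (if hdb v
     then if hdb w then less_bin (mult (num_of w) (den_of v)) (mult (num_of v) (den_of w)) else True
     else if hdb w then False else less_bin (mult (num_of v) (den_of w)) (mult (num_of w) (den_of v)))"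

text \<open>Denominators are positive, so fractions are compared by cross multiplication. Only
  absolute values are stored in binary, and for two negative numbers the comparison is
  reversed.\<close>

lemma less_rat_enc: "less_rat (enc_rat p @ r) (enc_rat q @ r') \<longleftrightarrow> p < q"
proof -
  obtain a b c d where ab: "quotient_of p = (a, b)" and cd: "quotient_of q = (c, d)"
    by (meson surj_pair)
  have pos: "b > 0" "d > 0" using quotient_of_denom_pos ab cd by auto
  have [simp]: "hdb (enc_rat p @ r) \<longleftrightarrow> a < 0" "val (num_of (enc_rat p @ r)) = nat \<bar>a\<bar>"
      "val (den_of (enc_rat p @ r)) = nat b"
      "hdb (enc_rat q @ r') \<longleftrightarrow> c < 0" "val (num_of (enc_rat q @ r')) = nat \<bar>c\<bar>"
      "val (den_of (enc_rat q @ r')) = nat d"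
    using pos by (simp_all add: enc_rat_def ab cd enc_int_def enc_nat_def num_of_def den_of_def)
  have pq: "p < q \<longleftrightarrow> a * d < c * b" using rat_less_code[of p q] ab cd by (simp add: mult.commute)
  have n: "nat x * nat y < nat u * nat v \<longleftrightarrow> x * y < u * v"
    if "x \<ge> 0" "y \<ge> 0" "u \<ge> 0" "v \<ge> 0" for x y u v
    using that by (simp flip: nat_mult_distrib) (smt (verit) nat_less_eq_zless mult_nonneg_nonneg)
  consider "a < 0" "c < 0" | "a < 0" "c \<ge> 0" | "a \<ge> 0" "c < 0" | "a \<ge> 0" "c \<ge> 0" by linarith
  then show ?thesis
  proof cases
    case 1 then show ?thesis using pos n[of "-c" b "-a" d] by (auto simp: less_rat_def pq less_bin val_mult)
  next
    case 2
    then have "a * d < 0" "0 \<le> c * b" using pos by (auto simp: mult_neg_pos)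
    then show ?thesis using 2 unfolding pq less_rat_def by simp
  next
    case 3
    then have "c * b < 0" "0 \<le> a * d" using pos by (auto simp: mult_neg_pos)
    then show ?thesis using 3 unfolding pq less_rat_def by simp
  next
    case 4 then show ?thesis using pos n[of a d c b] by (auto simp: less_rat_def pq less_bin val_mult)
  qed
qed

lemma FB_less_rat: assumes "FP m f" "FP m g" shows "FP m (\<lambda>e. [less_rat (f e) (g e)])"
proof -
  have "FP m (\<lambda>e. if hdb (f e)
     then if hdb (g e) then [less_bin (mult (num_of (g e)) (den_of (f e))) (mult (num_of (f e)) (den_of (g e)))] else [True]
     else if hdb (g e) then [False] else [less_bin (mult (num_of (f e)) (den_of (g e))) (mult (num_of (g e)) (den_of (f e)))])"
    unfolding num_of_def den_of_def
    by (intro FP_if_hdb FB_less_bin FP_mult FP_unstr FP_tl FP_skip_string FP_const assms)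
  then show ?thesis by (rule FP_cong) (simp add: less_rat_def)
qed

text \<open>The two bits dropped at first are the marker of the list entry and the sign of the
  numerator; the third one is the sign of the denominator.\<close>

definition skip_rat :: "bool list \<Rightarrow> bool list" where
  "skip_rat w = skip_string (tl (skip_string (tl (tl w))))"

lemma skip_rat_enc: "skip_rat (True # enc_rat q @ r) = r"
  by (cases "quotient_of q") (simp add: skip_rat_def enc_rat_def enc_int_def enc_nat_def)

lemma skip_rat_iter: "i \<le> length ts \<Longrightarrow>
  (skip_rat ^^ i) (enc_list enc_rat ts) = enc_list enc_rat (drop i ts)"
proof (induction i)
  case (Suc i)
  then have "drop i ts = ts ! i # drop (Suc i) ts" by (simp add: Cons_nth_drop_Suc)
  then show ?case using Suc skip_rat_enc[of "ts ! i"] by (simp add: enc_list_def)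
qed simp

definition nth_rat :: "bool list \<Rightarrow> nat \<Rightarrow> bool list" where
  "nth_rat w i = tl ((skip_rat ^^ i) w)"

lemma nth_rat_enc: "i < length ts \<Longrightarrow> \<exists>r. nth_rat (enc_list enc_rat ts) i = enc_rat (ts ! i) @ r"
  using skip_rat_iter[of i ts] by (simp add: nth_rat_def) (simp add: enc_list_def Cons_nth_drop_Suc[symmetric])

lemma FP_nth_rat: "FP m f \<Longrightarrow> FN m n \<Longrightarrow> FP m (\<lambda>e. nth_rat (f e) (n e))"
  unfolding nth_rat_def
proof (intro FP_tl FP_iter)
  show "FP 1 (\<lambda>e. skip_rat (ev 0 e))"
    unfolding skip_rat_def by (intro FP_skip_string FP_tl FP_ev)
qed (auto simp: skip_rat_def skip_string_def)


section \<open>From programs to Turing machines\<close>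

datatype stack_op = Nop | PushOp nat | PopOp

fun apply_op :: "stack_op \<Rightarrow> nat list \<Rightarrow> nat list" where
  "apply_op Nop w = w"
| "apply_op (PushOp s) w = s # w"
| "apply_op PopOp w = tl w"

definition sm_step ::
    "('q \<Rightarrow> nat) \<Rightarrow> ('q \<Rightarrow> stack_op) \<Rightarrow> ('q \<Rightarrow> nat \<Rightarrow> 'q) \<Rightarrow> 'q \<times> store \<Rightarrow> 'q \<times> store" where
  "sm_step stk op nxt = (\<lambda>(q, \<sigma>).
     (nxt q (top_symbol (\<sigma> (stk q))), \<sigma>(stk q := apply_op (op q) (\<sigma> (stk q)))))"

text \<open>The control state of a running program is the list of the programs still to be executed.
  Only finitely many such lists occur, because a loop re-creates its own continuation.\<close>

fun ctl_stack :: "prog list \<Rightarrow> nat" where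
  "ctl_stack (Push k s # K) = k"
| "ctl_stack (Pop k B # K) = k"
| "ctl_stack (Loop k B # K) = k"
| "ctl_stack K = 0"

fun ctl_op :: "prog list \<Rightarrow> stack_op" where
  "ctl_op (Push k s # K) = PushOp s"
| "ctl_op (Pop k B # K) = PopOp"
| "ctl_op (Loop k B # K) = PopOp"
| "ctl_op K = Nop"

fun ctl_next :: "prog list \<Rightarrow> nat \<Rightarrow> prog list" where
  "ctl_next [] a = []"
| "ctl_next (Skip # K) a = K"
| "ctl_next (Push k s # K) a = K"
| "ctl_next (Pop k B # K) a = B a # K"
| "ctl_next (Seq P Q # K) a = P # Q # K"
| "ctl_next (Loop k B # K) a = (if a = 0 then K else B a # Loop k B # K)"

definition ok_store :: "nat \<Rightarrow> store \<Rightarrow> bool" where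
  "ok_store A \<sigma> \<longleftrightarrow> (\<forall>k. \<forall>c\<in>set (\<sigma> k). 0 < c \<and> c < A)"

lemma ok_store_upd: "ok_store A \<sigma> \<Longrightarrow> \<forall>c\<in>set w. 0 < c \<and> c < A \<Longrightarrow> ok_store A (\<sigma>(k := w))"
  by (auto simp: ok_store_def)

lemma in_set_tlD: "x \<in> set (tl xs) \<Longrightarrow> x \<in> set xs"
  by (cases xs) auto

lemma ok_store_tl: "ok_store A \<sigma> \<Longrightarrow> ok_store A (\<sigma>(k := tl (\<sigma> k)))"
  by (rule ok_store_upd) (auto simp: ok_store_def dest!: in_set_tlD)

lemma ok_store_top: "ok_store A \<sigma> \<Longrightarrow> 0 < A \<Longrightarrow> top_symbol (\<sigma> k) < A"
  by (cases "\<sigma> k") (auto simp: ok_store_def, metis list.set_intros(1))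

lemma exec_ok_store: "exec P \<sigma> t \<sigma>' \<Longrightarrow> wf_prog A P \<Longrightarrow> ok_store A \<sigma> \<Longrightarrow> ok_store A \<sigma>'"
proof (induction rule: exec.induct)
  case (exec_Push k s \<sigma>)
  then show ?case by (intro ok_store_upd) (auto simp: ok_store_def)
next
  case (exec_Loop_Cons \<sigma> k c w B t \<sigma>' t' \<sigma>'')
  then have "ok_store A (\<sigma>(k := w))" using ok_store_tl[of A \<sigma> k] by simp
  moreover have "wf_prog A (B c)" using exec_Loop_Cons.prems by simp
  ultimately show ?case using exec_Loop_Cons.IH exec_Loop_Cons.prems(1) by blast
next
  case (exec_Pop B \<sigma> k t \<sigma>')
  then show ?case using ok_store_tl[of A \<sigma> k] by (metis wf_prog.simps(3))
qed auto

text \<open>The continuation \<open>K\<close> is arbitrary so that the induction hypothesis applies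
  below \<open>Seq\<close> and \<open>Loop\<close>. The store must be free of the symbol 0, because
  the control recognises the end of a loop by reading 0.\<close>

lemma exec_sm:
  assumes "exec P \<sigma> t \<sigma>'" "wf_prog A P" "ok_store A \<sigma>"
  shows "(sm_step ctl_stack ctl_op ctl_next ^^ t) (P # K, \<sigma>) = (K, \<sigma>')"
  using assms
proof (induction arbitrary: K rule: exec.induct)
  case (exec_Pop B \<sigma> k t \<sigma>')
  have "(sm_step ctl_stack ctl_op ctl_next ^^ t) (B (top_symbol (\<sigma> k)) # K, \<sigma>(k := tl (\<sigma> k))) = (K, \<sigma>')"
    using exec_Pop ok_store_tl[of A \<sigma> k] by (metis wf_prog.simps(3))
  moreover have "sm_step ctl_stack ctl_op ctl_next (Pop k B # K, \<sigma>) = (B (top_symbol (\<sigma> k)) # K, \<sigma>(k := tl (\<sigma> k)))"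
    by (simp add: sm_step_def)
  ultimately show ?case by (simp add: funpow_Suc_right del: funpow.simps)
next
  case (exec_Seq P \<sigma> t \<sigma>' Q t' \<sigma>'')
  then have "ok_store A \<sigma>'" using exec_ok_store by auto
  moreover have "sm_step ctl_stack ctl_op ctl_next (Seq P Q # K, \<sigma>) = (P # Q # K, \<sigma>)"
    by (simp add: sm_step_def)
  ultimately show ?case using exec_Seq
    by (simp add: funpow_Suc_right funpow_add add.commute[of t] del: funpow.simps)
next
  case (exec_Loop_Cons \<sigma> k c w B t \<sigma>' t' \<sigma>'')
  have ok: "ok_store A (\<sigma>(k := w))" using ok_store_tl[of A \<sigma> k] exec_Loop_Cons by simp
  then have "ok_store A \<sigma>'" using exec_ok_store[of "B c"] exec_Loop_Cons by auto
  moreover have "0 < c" using exec_Loop_Cons by (auto simp: ok_store_def, metis list.set_intros(1))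
  then have "sm_step ctl_stack ctl_op ctl_next (Loop k B # K, \<sigma>) = (B c # Loop k B # K, \<sigma>(k := w))"
    using exec_Loop_Cons by (simp add: sm_step_def)
  moreover have "wf_prog A (B c)" using exec_Loop_Cons.prems by simp
  ultimately have "(sm_step ctl_stack ctl_op ctl_next ^^ t) (sm_step ctl_stack ctl_op ctl_next (Loop k B # K, \<sigma>)) =
      (Loop k B # K, \<sigma>')" "ok_store A \<sigma>'"
    using exec_Loop_Cons.IH(1)[OF _ ok] by (simp_all only:)
  then show ?case using exec_Loop_Cons.IH(2)[OF exec_Loop_Cons.prems(1)]
    by (simp add: funpow_Suc_right funpow_add add.commute[of t] del: funpow.simps)
qed (auto simp: sm_step_def)

primrec conts :: "nat \<Rightarrow> prog \<Rightarrow> prog list \<Rightarrow> prog list set" where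
  "conts A Skip = (\<lambda>K. {Skip # K})"
| "conts A (Push k s) = (\<lambda>K. {Push k s # K})"
| "conts A (Pop k B) = (\<lambda>K. insert (Pop k B # K) (\<Union>c<A. conts A (B c) K))"
| "conts A (Seq P Q) = (\<lambda>K. insert (Seq P Q # K) (conts A P (Q # K) \<union> conts A Q K))"
| "conts A (Loop k B) = (\<lambda>K. insert (Loop k B # K) (\<Union>c<A. conts A (B c) (Loop k B # K)))"

lemma finite_conts: "finite (conts A P K)"
  by (induction P arbitrary: K) auto

lemma conts_start: "P # K \<in> conts A P K"
  by (cases P) auto

lemma conts_next: "K' \<in> conts A P K \<Longrightarrow> a < A \<Longrightarrow> ctl_next K' a \<in> insert K (conts A P K)"
proof (induction P arbitrary: K)
  case (Pop k B)
  then show ?case using conts_start by fastforce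
next
  case (Seq P Q)
  then show ?case using conts_start[of P "Q # K" A] conts_start[of Q K A] by fastforce
next
  case (Loop k B)
  show ?case
  proof (cases "K' = Loop k B # K")
    case True
    then show ?thesis using Loop.prems(2) conts_start[of "B a" "Loop k B # K" A] by auto
  next
    case False
    then obtain c where c: "c < A" "K' \<in> conts A (B c) (Loop k B # K)" using Loop.prems(1) by auto
    then have "ctl_next K' a \<in> insert (Loop k B # K) (conts A (B c) (Loop k B # K))"
      using Loop.IH[of "B c"] Loop.prems(2) by blast
    then show ?thesis using c(1) by auto
  qed
qed auto

lemma conts_wf:
  "K' \<in> conts A P K \<Longrightarrow> wf_prog A P \<Longrightarrow> 0 < A \<Longrightarrow>
    ctl_stack K' < A \<and> (\<forall>s. ctl_op K' = PushOp s \<longrightarrow> 0 < s \<and> s < A)"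
  by (induction P arbitrary: K) auto

lemma ctl_push: "ctl_op K = PushOp s \<Longrightarrow> ctl_next K a = ctl_next K b"
  by (cases K rule: ctl_op.cases) auto

text \<open>The state after a push must not depend on the symbol read: the Turing machine
  \<open>tm_of\<close> picks the new state in its second phase, when its head has already left the
  old top.\<close>

definition stack_machine ::
    "nat \<Rightarrow> nat \<Rightarrow> (nat \<Rightarrow> nat) \<Rightarrow> (nat \<Rightarrow> stack_op) \<Rightarrow> (nat \<Rightarrow> nat \<Rightarrow> nat) \<Rightarrow> nat \<Rightarrow> bool" where
  "stack_machine A Q stk op nxt h \<longleftrightarrow> h < Q \<and> op h = Nop \<and> (\<forall>a. nxt h a = h) \<and>
     (\<forall>q<Q. stk q < A \<and> (\<forall>s. op q = PushOp s \<longrightarrow> 0 < s \<and> s < A \<and> (\<forall>a. nxt q a = nxt q 0)) \<and>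
        (\<forall>a<A. nxt q a < Q))"

lemma sm_step_ok:
  assumes "stack_machine A Q stk op nxt h" "q < Q" "ok_store A \<sigma>" "0 < A"
    and "sm_step stk op nxt (q, \<sigma>) = (q', \<sigma>')"
  shows "q' < Q \<and> ok_store A \<sigma>'"
proof -
  have "\<forall>c\<in>set (apply_op (op q) (\<sigma> (stk q))). 0 < c \<and> c < A"
    using assms(1-3) by (cases "op q") (auto simp: stack_machine_def ok_store_def dest: in_set_tlD)
  then show ?thesis using assms ok_store_top[OF assms(3,4), of "stk q"]
    by (auto simp: sm_step_def stack_machine_def intro: ok_store_upd)
qed

lemma stack_machine_exists:
  assumes P: "wf_prog A P" and A: "0 < A"
  shows "\<exists>Q stk op nxt h. stack_machine A Q stk op nxt h \<and>
    (\<forall>\<sigma> t \<sigma>'. ok_store A \<sigma> \<longrightarrow> exec P \<sigma> t \<sigma>' \<longrightarrow> (sm_step stk op nxt ^^ t) (0, \<sigma>) = (h, \<sigma>'))"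
proof -
  let ?C = "insert [] (conts A P [])"
  have "finite (?C - {[P]})" using finite_conts by auto
  from finite_distinct_list[OF this] obtain cs' where cs': "set cs' = ?C - {[P]}" "distinct cs'"
    by (elim exE conjE)
  \<comment> \<open>States are positions in this list; the initial control state comes first because
    the run has to start in state 0.\<close>
  define cs where "cs = [P] # cs'"
  have cs: "set cs = ?C" "distinct cs" "cs ! 0 = [P]"
    using cs' conts_start[of P "[]" A] by (auto simp: cs_def)
  define Q where "Q = length cs"
  define ix where "ix K = (SOME i. i < Q \<and> cs ! i = K)" for K
  have ix: "ix K < Q" "cs ! ix K = K" if "K \<in> ?C" for K
  proof -
    have "\<exists>i. i < Q \<and> cs ! i = K" using that unfolding Q_def cs(1)[symmetric] in_set_conv_nth by blast
    from someI_ex[OF this] show "ix K < Q" "cs ! ix K = K" by (auto simp: ix_def)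
  qed
  have ix': "ix (cs ! q) = q" if "q < Q" for q
    using ix[of "cs ! q"] that cs(1,2) unfolding Q_def by (metis nth_mem nth_eq_iff_index_eq)
  define stk where "stk q = ctl_stack (cs ! q)" for q
  define op where "op q = ctl_op (cs ! q)" for q
  define nxt where "nxt q a = ix (ctl_next (cs ! q) a)" for q a
  define h where "h = ix []"
  have nextC: "ctl_next K a \<in> ?C" if "K \<in> ?C" "a < A" for K a
    using that conts_next[of K A P "[]" a] by auto
  have h: "h < Q" "cs ! h = []" using ix by (auto simp: h_def)
  have csC: "cs ! q \<in> ?C" if "q < Q" for q using that cs(1) unfolding Q_def by (metis nth_mem)
  have sm: "stack_machine A Q stk op nxt h"
    unfolding stack_machine_def
  proof (intro conjI allI impI)
    fix q assume q: "q < Q"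
    show "stk q < A" using csC[OF q] conts_wf[OF _ P A, of "cs ! q" "[]"] A by (auto simp: stk_def)
    fix s assume s: "op q = PushOp s"
    then have "cs ! q \<in> conts A P []" using csC[OF q] by (auto simp: op_def)
    then show "0 < s" "s < A" using conts_wf[OF _ P A, of "cs ! q" "[]"] s by (auto simp: op_def)
    show "nxt q a = nxt q 0" for a using s ctl_push unfolding nxt_def op_def by metis
  next
    fix q a assume "q < Q" "a < A" then show "nxt q a < Q"
      unfolding nxt_def by (intro ix nextC csC)
  qed (use h in \<open>auto simp: op_def nxt_def h_def[symmetric]\<close>)
  have sim: "(sm_step ctl_stack ctl_op ctl_next ^^ t) (cs ! q, \<sigma>) = (K, \<sigma>') \<Longrightarrow> q < Q \<Longrightarrow> ok_store A \<sigma> \<Longrightarrow>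
      (sm_step stk op nxt ^^ t) (q, \<sigma>) = (ix K, \<sigma>')" for t q \<sigma> K \<sigma>'
  proof (induction t arbitrary: q \<sigma>)
    case 0 then show ?case using ix' by auto
  next
    case (Suc t)
    let ?a = "top_symbol (\<sigma> (stk q))"
    have a: "?a < A" using ok_store_top[OF Suc.prems(3) A] .
    obtain q' \<sigma>1 where s: "sm_step stk op nxt (q, \<sigma>) = (q', \<sigma>1)" by (meson surj_pair)
    have ok: "q' < Q" "ok_store A \<sigma>1" using sm_step_ok[OF sm Suc.prems(2,3) A s] by auto
    have "cs ! q' = ctl_next (cs ! q) ?a" using s ix(2)[OF nextC[OF csC[OF Suc.prems(2)] a]]
      by (auto simp: sm_step_def nxt_def)
    then have "sm_step ctl_stack ctl_op ctl_next (cs ! q, \<sigma>) = (cs ! q', \<sigma>1)"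
      using s by (auto simp: sm_step_def stk_def op_def)
    then show ?case using Suc.IH[OF _ ok] Suc.prems(1) s
      by (simp add: funpow_Suc_right del: funpow.simps)
  qed
  have Q0: "0 < Q" by (simp add: Q_def cs_def)
  have "ok_store A \<sigma> \<longrightarrow> exec P \<sigma> t \<sigma>' \<longrightarrow> (sm_step stk op nxt ^^ t) (0, \<sigma>) = (h, \<sigma>')" for \<sigma> t \<sigma>'
    using sim[of t 0 \<sigma> "[]" \<sigma>'] exec_sm[of P \<sigma> t \<sigma>' A "[]"] P Q0 by (simp add: cs(3) h_def)
  then show ?thesis using sm by blast
qed

lemma sm_halted:
  assumes "stack_machine A Q stk op nxt h"
  shows "(sm_step stk op nxt ^^ t) (h, \<sigma>) = (h, \<sigma>)"
proof -
  have "op h = Nop" "\<And>a. nxt h a = h" using assms unfolding stack_machine_def by blast+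
  then show ?thesis by (induction t) (auto simp: sm_step_def)
qed

section \<open>Stacks on the tapes of a Turing machine\<close>

definition tape_stack :: "nat list \<Rightarrow> tape \<Rightarrow> bool" where
  "tape_stack w T \<longleftrightarrow> (\<forall>i::nat. fst T (snd T + int i) = (if i < length w then w ! i else 0))"

lemma read_tape_stack: "tape_stack w T \<Longrightarrow> read_tape T = top_symbol w"
  by (cases w) (auto simp: tape_stack_def read_tape_def dest: spec[of _ 0])

lemma act_stay: "act (read_tape T, Stay) T = T"
  by (simp add: act_def read_tape_def)

lemma tape_stack_push:
  assumes "tape_stack w T"
  shows "tape_stack (s # w) (act (s, Stay) (act (read_tape T, MoveLeft) T))"
  unfolding tape_stack_def
proof
  fix i
  show "fst (act (s, Stay) (act (read_tape T, MoveLeft) T))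
       (snd (act (s, Stay) (act (read_tape T, MoveLeft) T)) + int i) =
      (if i < length (s # w) then (s # w) ! i else 0)"
    using assms[unfolded tape_stack_def, rule_format, of "i - 1"]
    by (cases i) (auto simp: act_def read_tape_def)
qed

lemma tape_stack_pop:
  assumes "tape_stack w T"
  shows "tape_stack (tl w) (act (0, MoveRight) T)"
  unfolding tape_stack_def
proof
  fix i
  show "fst (act (0, MoveRight) T) (snd (act (0, MoveRight) T) + int i) =
      (if i < length (tl w) then tl w ! i else 0)"
    using assms[unfolded tape_stack_def, rule_format, of "Suc i"]
    by (cases w) (auto simp: act_def algebra_simps)
qed

text \<open>Stack 0 is the input tape, and tape 1 is kept free for the output.\<close>

definition tape_of :: "nat \<Rightarrow> nat" where
  "tape_of k = (if k = 0 then 0 else Suc k)"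

lemma tape_of_neq: "tape_of k \<noteq> 1" "tape_of k = tape_of l \<longleftrightarrow> k = l"
  by (auto simp: tape_of_def)

lemma tape_of_less: "k < A \<Longrightarrow> tape_of k < Suc A"
  by (auto simp: tape_of_def)

text \<open>One step of the stack machine takes two steps of the Turing machine: a push first moves
  the head to the left and then writes. Tape 1 is only written when the machine halts, with the
  top of stack 1.\<close>

definition tm_acts ::
    "nat \<Rightarrow> (nat \<Rightarrow> nat) \<Rightarrow> (nat \<Rightarrow> stack_op) \<Rightarrow> nat \<Rightarrow> nat \<Rightarrow> bool \<Rightarrow> nat list \<Rightarrow> nat \<Rightarrow> nat \<times> move" where
  "tm_acts Q stk op h q snd_phase ss i =
     (if \<not> snd_phase then
        if q = h then (if i = 1 then ss ! tape_of 1 else ss ! i, Stay)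
        else (ss ! i, if i = tape_of (stk q) \<and> (\<exists>s. op q = PushOp s) then MoveLeft else Stay)
      else if i = tape_of (stk q) then
        (case op q of Nop \<Rightarrow> (ss ! i, Stay) | PushOp s \<Rightarrow> (s, Stay) | PopOp \<Rightarrow> (0, MoveRight))
      else (ss ! i, Stay))"

definition tm_of ::
    "nat \<Rightarrow> nat \<Rightarrow> (nat \<Rightarrow> nat) \<Rightarrow> (nat \<Rightarrow> stack_op) \<Rightarrow> (nat \<Rightarrow> nat \<Rightarrow> nat) \<Rightarrow> nat \<Rightarrow> tm" where
  "tm_of A Q stk op nxt h = \<lparr>tapes = Suc A, states = 2 * Q, symbols = A,
     delta = (\<lambda>p ss. (let q = p div 2 in
       (if even p then if q = h then 2 * Q else Suc p
        else 2 * nxt q (if \<exists>s. op q = PushOp s then 0 else ss ! tape_of (stk q)),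
        map (tm_acts Q stk op h q (odd p) ss) [0..<Suc A])))\<rparr>"

lemma is_tm_tm_of:
  assumes "stack_machine A Q stk op nxt h" "3 \<le> A"
  shows "is_tm (tm_of A Q stk op nxt h)"
proof -
  let ?M = "tm_of A Q stk op nxt h"
  have "case delta ?M p ss of (q', as) \<Rightarrow>
           q' \<le> states ?M \<and> length as = tapes ?M \<and> (\<forall>(s', m) \<in> set as. s' < symbols ?M)"
    if p: "p < states ?M" and l: "length ss = tapes ?M" and ss: "\<forall>s\<in>set ss. s < symbols ?M" for p ss
  proof -
    let ?q = "p div 2"
    have q: "?q < Q" using p by (simp add: tm_of_def)
    have ssi: "ss ! i < A" if "i < Suc A" for i
      using ss l that by (simp add: tm_of_def)
    have stk: "stk ?q < A" using assms q by (auto simp: stack_machine_def)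
    have "ss ! tape_of (stk ?q) < A" by (intro ssi tape_of_less stk)
    then have nx: "nxt ?q (if \<exists>s. op ?q = PushOp s then 0 else ss ! tape_of (stk ?q)) < Q"
      using assms q by (auto simp: stack_machine_def)
    have fa: "fst (tm_acts Q stk op h ?q b ss i) < A" if "i < Suc A" for i b
    proof -
      have "\<And>s. op ?q = PushOp s \<Longrightarrow> s < A" using assms q by (auto simp: stack_machine_def)
      then show ?thesis using ssi[OF that] ssi[of 2] assms(2)
        by (auto simp: tm_acts_def tape_of_def numeral_2_eq_2 split: stack_op.splits)
    qed
    have "case x of (s', m) \<Rightarrow> s' < A" if x: "x \<in> set (map (tm_acts Q stk op h ?q (odd p) ss) [0..<Suc A])" for x
    proof -
      obtain i where "i < Suc A" "x = tm_acts Q stk op h ?q (odd p) ss i"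
        using x unfolding set_map set_upt by fastforce
      then show ?thesis using fa[of i "odd p"] by (simp add: case_prod_beta)
    qed
    moreover have "(if even p then if ?q = h then 2 * Q else Suc p
        else 2 * nxt ?q (if \<exists>s. op ?q = PushOp s then 0 else ss ! tape_of (stk ?q))) \<le> 2 * Q"
      using nx p by (auto simp: tm_of_def)
    ultimately show ?thesis by (simp add: tm_of_def Let_def del: upt_Suc)
  qed
  then show ?thesis using assms(2) unfolding is_tm_def by (auto simp: tm_of_def)
qed

definition tm_inv :: "nat \<Rightarrow> store \<Rightarrow> tape list \<Rightarrow> bool" where
  "tm_inv A \<sigma> ts \<longleftrightarrow> length ts = Suc A \<and> (\<forall>k<A. tape_stack (\<sigma> k) (ts ! tape_of k)) \<and> ts ! 1 = (\<lambda>_. 0, 0)"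

lemma tm_step_tm_of:
  assumes "p < 2 * Q" "length ts = Suc A"
  shows "tm_step (tm_of A Q stk op nxt h) (p, ts) =
    (fst (delta (tm_of A Q stk op nxt h) p (map read_tape ts)),
     map (\<lambda>i. act (tm_acts Q stk op h (p div 2) (odd p) (map read_tape ts) i) (ts ! i)) [0..<Suc A])"
  using assms
  by (auto simp: tm_step_def tm_of_def Let_def simp del: upt_Suc intro!: nth_equalityI)

lemma tm_of_step:
  assumes sm: "stack_machine A Q stk op nxt h" and A: "3 \<le> A" and q: "q < Q" "q \<noteq> h"
    and inv: "tm_inv A \<sigma> ts" and step: "sm_step stk op nxt (q, \<sigma>) = (q', \<sigma>')"
  shows "\<exists>ts'. (tm_step (tm_of A Q stk op nxt h) ^^ 2) (2 * q, ts) = (2 * q', ts') \<and> tm_inv A \<sigma>' ts'"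
proof -
  let ?M = "tm_of A Q stk op nxt h"
  let ?j = "tape_of (stk q)"
  have l: "length ts = Suc A" using inv by (simp add: tm_inv_def)
  have stk: "stk q < A" using sm q by (auto simp: stack_machine_def)
  have j: "?j < Suc A" "?j \<noteq> 1" using tape_of_less[OF stk] tape_of_neq by auto
  define ts1 where "ts1 = map (\<lambda>i. act (tm_acts Q stk op h q False (map read_tape ts) i) (ts ! i)) [0..<Suc A]"
  define ts2 where "ts2 = map (\<lambda>i. act (tm_acts Q stk op h q True (map read_tape ts1) i) (ts1 ! i)) [0..<Suc A]"
  have l1: "length ts1 = Suc A" "length ts2 = Suc A" by (simp_all add: ts1_def ts2_def del: upt_Suc)
  have s1: "tm_step ?M (2 * q, ts) = (Suc (2 * q), ts1)"
    using q l by (subst tm_step_tm_of) (auto simp: ts1_def tm_of_def Let_def simp del: upt_Suc)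
  have rd: "read_tape (ts ! ?j) = top_symbol (\<sigma> (stk q))"
    using inv stk by (auto simp: tm_inv_def intro: read_tape_stack)
  have e1: "ts1 ! i = ts ! i" if "i < Suc A" "i \<noteq> ?j \<or> (\<forall>s. op q \<noteq> PushOp s)" for i
    using that q l by (auto simp: ts1_def tm_acts_def act_stay simp del: upt_Suc)
  have q': "nxt q (if \<exists>s. op q = PushOp s then 0 else map read_tape ts1 ! ?j) = q'"
  proof (cases "\<exists>s. op q = PushOp s")
    case True
    then have "nxt q a = nxt q 0" for a using sm q unfolding stack_machine_def by blast
    then show ?thesis using step True by (simp add: sm_step_def) metis
  next
    case False
    then show ?thesis using step e1[of ?j] rd j l1 by (auto simp: sm_step_def)
  qed
  have s2: "tm_step ?M (Suc (2 * q), ts1) = (2 * q', ts2)"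
    using q l1 q' by (subst tm_step_tm_of) (auto simp: ts2_def tm_of_def Let_def simp del: upt_Suc)
  have e2: "ts2 ! i = ts ! i" if "i < Suc A" "i \<noteq> ?j" for i
    using that e1[of i] l1 by (auto simp: ts2_def tm_acts_def act_stay simp del: upt_Suc)
  have T: "tape_stack (\<sigma> (stk q)) (ts ! ?j)" using inv stk by (auto simp: tm_inv_def)
  have "tape_stack (apply_op (op q) (\<sigma> (stk q))) (ts2 ! ?j)"
  proof (cases "op q")
    case Nop
    then show ?thesis using T e1[of ?j] j l1 by (auto simp: ts2_def tm_acts_def act_stay simp del: upt_Suc)
  next
    case (PushOp s)
    have "ts2 ! ?j = act (s, Stay) (act (read_tape (ts ! ?j), MoveLeft) (ts ! ?j))"
      using PushOp j l q by (simp add: ts2_def ts1_def tm_acts_def del: upt_Suc)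
    then show ?thesis using tape_stack_push[OF T] PushOp by simp
  next
    case PopOp
    have "ts2 ! ?j = act (0, MoveRight) (ts ! ?j)"
      using PopOp j l q e1[of ?j] by (simp add: ts2_def tm_acts_def del: upt_Suc)
    then show ?thesis using tape_stack_pop[OF T] PopOp by simp
  qed
  moreover have "\<sigma>' = \<sigma>(stk q := apply_op (op q) (\<sigma> (stk q)))" using step by (simp add: sm_step_def)
  moreover have "ts2 ! 1 = ts ! 1" using e2[of 1] j A by simp
  ultimately have "tm_inv A \<sigma>' ts2" using inv e2 l1 j tape_of_neq tape_of_less
    by (auto simp: tm_inv_def)
  then show ?thesis using s1 s2 by (simp add: numeral_2_eq_2)
qed

lemma tm_of_run:
  assumes sm: "stack_machine A Q stk op nxt h" and A: "3 \<le> A"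
  shows "(sm_step stk op nxt ^^ t) (q, \<sigma>) = (h, \<sigma>') \<Longrightarrow> q < Q \<Longrightarrow> ok_store A \<sigma> \<Longrightarrow> tm_inv A \<sigma> ts \<Longrightarrow>
    \<exists>t'\<le>2 * t. \<exists>ts'. (tm_step (tm_of A Q stk op nxt h) ^^ t') (2 * q, ts) = (2 * h, ts') \<and> tm_inv A \<sigma>' ts'"
proof (induction t arbitrary: q \<sigma> ts)
  case 0 then show ?case by auto
next
  case (Suc t)
  show ?case
  proof (cases "q = h")
    case True
    then have "\<sigma>' = \<sigma>" using Suc.prems(1) sm_halted[OF sm, of "Suc t" \<sigma>] by simp
    then show ?thesis using True Suc.prems(4) by (intro exI[of _ 0]) auto
  next
    case False
    obtain q1 \<sigma>1 where s: "sm_step stk op nxt (q, \<sigma>) = (q1, \<sigma>1)" by (meson surj_pair)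
    have ok: "q1 < Q" "ok_store A \<sigma>1" using sm_step_ok[OF sm Suc.prems(2,3) _ s] A by auto
    obtain ts1 where ts1: "(tm_step (tm_of A Q stk op nxt h) ^^ 2) (2 * q, ts) = (2 * q1, ts1)" "tm_inv A \<sigma>1 ts1"
      using tm_of_step[OF sm A Suc.prems(2) False Suc.prems(4) s] by blast
    have "(sm_step stk op nxt ^^ t) (q1, \<sigma>1) = (h, \<sigma>')"
      using Suc.prems(1) s by (simp add: funpow_Suc_right del: funpow.simps)
    from Suc.IH[OF this ok ts1(2)] obtain t' ts' where
      t': "t' \<le> 2 * t" "(tm_step (tm_of A Q stk op nxt h) ^^ t') (2 * q1, ts1) = (2 * h, ts')" "tm_inv A \<sigma>' ts'"
      by blast
    have "(tm_step (tm_of A Q stk op nxt h) ^^ (t' + 2)) (2 * q, ts) = (2 * h, ts')"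
      unfolding funpow_add o_apply ts1(1) by (rule t'(2))
    then show ?thesis using t' by (intro exI[of _ "t' + 2"]) auto
  qed
qed

lemma tm_halted: "fst c = states M \<Longrightarrow> (tm_step M ^^ t) c = c"
  by (induction t) (auto simp: tm_step_def)

lemma FP_imp_P_class:
  assumes "FP 1 (\<lambda>e. [ev 0 e \<in> L])"
  shows "L \<in> P_class"
proof -
  obtain P A T where P: "wf_prog A P" "pbd 1 T" "\<And>\<sigma> e. \<forall>k\<ge>2. \<sigma> k = [] \<Longrightarrow> map \<sigma> [0] = map bits e \<Longrightarrow>
        runs P \<sigma> (T e) (\<sigma>(1 := bits [ev 0 e \<in> L] @ \<sigma> 1))"
    by (rule FP_E[OF assms, of "[0]" 2 1]) auto
  define A' where "A' = max A 3"
  have A': "wf_prog A' P" "3 \<le> A'" "0 < A'" using P(1) by (auto simp: A'_def intro: wf_prog_mono)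
  obtain Q stk op nxt h where sm: "stack_machine A' Q stk op nxt h" and
    run: "\<And>\<sigma> t \<sigma>'. ok_store A' \<sigma> \<Longrightarrow> exec P \<sigma> t \<sigma>' \<Longrightarrow> (sm_step stk op nxt ^^ t) (0, \<sigma>) = (h, \<sigma>')"
    using stack_machine_exists[OF A'(1,3)] by blast
  have hQ: "h < Q" using sm by (simp add: stack_machine_def)
  let ?M = "tm_of A' Q stk op nxt h"
  obtain c where c: "\<And>e. length e = 1 \<Longrightarrow> T e \<le> sz e ^ c" using P(2) unfolding pbd_def by blast
  \<comment> \<open>The base is \<open>sz [x]\<close>, the factor 2 accounts for the two phases of
    each step, and the summand 1 for the final step, which writes the output.\<close>
  define p :: "nat poly" where "p = [:1:] + [:2:] * [:2, 1:] ^ c"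
  have pp: "poly p n = 1 + 2 * (n + 2) ^ c" for n by (simp add: p_def poly_power algebra_simps)
  have "outputs_within ?M (poly p (length x)) x [x \<in> L]" for x
  proof -
    define \<sigma> :: store where "\<sigma> = (\<lambda>_. [])(0 := bits x)"
    have ok: "ok_store A' \<sigma>" using bits_range[of x] A'(2)
      by (fastforce simp: \<sigma>_def ok_store_def)
    have "runs P \<sigma> (T [x]) (\<sigma>(1 := bits [ev 0 [x] \<in> L] @ \<sigma> 1))"
      by (rule P(3)) (auto simp: \<sigma>_def)
    then obtain t where t: "t \<le> T [x]" "exec P \<sigma> t (\<sigma>(1 := bits [x \<in> L]))"
      by (auto simp: runs_def \<sigma>_def)
    have inv: "tm_inv A' \<sigma> (input_tape x # replicate A' (\<lambda>_. 0, 0))"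
    proof -
      have "tape_stack (bits x) (input_tape x)"
        by (auto simp: tape_stack_def input_tape_def bits_def)
      moreover have "tape_stack [] (\<lambda>_. 0, 0)" by (simp add: tape_stack_def)
      ultimately show ?thesis using A'(2) by (auto simp: tm_inv_def \<sigma>_def tape_of_def)
    qed
    obtain t' ts where t': "t' \<le> 2 * t" "tm_inv A' (\<sigma>(1 := bits [x \<in> L])) ts"
      "(tm_step ?M ^^ t') (2 * 0, input_tape x # replicate A' (\<lambda>_. 0, 0)) = (2 * h, ts)"
      using tm_of_run[OF sm A'(2) run[OF ok t(2)] _ ok inv] hQ by auto
    have init: "init_config ?M x = (2 * 0, input_tape x # replicate A' (\<lambda>_. 0, 0))"
      by (simp add: init_config_def tm_of_def)
    have lts: "length ts = Suc A'" using t'(2) by (simp add: tm_inv_def)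
    define ts' where "ts' = map (\<lambda>i. act (tm_acts Q stk op h h False (map read_tape ts) i) (ts ! i)) [0..<Suc A']"
    have fin: "tm_step ?M (2 * h, ts) = (2 * Q, ts')"
      using hQ lts by (subst tm_step_tm_of) (auto simp: ts'_def tm_of_def Let_def simp del: upt_Suc)
    have "tape_stack (bits [x \<in> L]) (ts ! 2)"
      using t'(2) A'(2) unfolding tm_inv_def by (auto simp: tape_of_def numeral_2_eq_2 dest!: spec[of _ "1::nat"])
    then have "read_tape (ts ! 2) = bit_symbol (x \<in> L)" by (simp add: read_tape_stack)
    moreover have "ts ! 1 = (\<lambda>_. 0, 0)" using t'(2) by (simp add: tm_inv_def)
    ultimately have "ts' ! 1 = ((\<lambda>_. 0)(0 := bit_symbol (x \<in> L)), 0)"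
      using lts A'(2) by (simp add: ts'_def tm_acts_def tape_of_def act_def numeral_2_eq_2 del: upt_Suc)
    then have out: "tape_output (ts' ! 1) [x \<in> L]" by (simp add: tape_output_def)
    have S: "(tm_step ?M ^^ Suc t') (init_config ?M x) = (2 * Q, ts')"
      using t'(3) fin init by simp
    have "T [x] \<le> (length x + 2) ^ c" using c[of "[x]"] by (simp add: sz_def)
    then have "Suc t' \<le> poly p (length x)" using t(1) t'(1) by (simp add: pp)
    then obtain k where k: "poly p (length x) = k + Suc t'" by (metis le_add_diff_inverse2)
    have "(tm_step ?M ^^ poly p (length x)) (init_config ?M x) = (2 * Q, ts')"
      unfolding k funpow_add o_apply S by (rule tm_halted) (simp add: tm_of_def)
    then show ?thesis using out by (simp add: outputs_within_def tm_of_def)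
  qed
  then show ?thesis unfolding P_class_def using is_tm_tm_of[OF sm A'(2)] by blast
qed


section \<open>Simulating Turing machines\<close>

definition nd :: "nat list \<Rightarrow> nat \<Rightarrow> nat" where
  "nd w i = (if i < length w then w ! i else 0)"

lemma nd_simps [simp]: "nd [] i = 0" "nd (c # w) 0 = c" "nd (c # w) (Suc i) = nd w i"
  by (auto simp: nd_def)

lemma nd_tl: "nd (tl w) i = nd w (Suc i)"
  by (cases w) auto

lemma nd_top_symbol: "top_symbol w = nd w 0"
  by (cases w) auto

text \<open>The tape \<open>j\<close> is held in two stacks, to the left of and from the head position on. With
  \<open>s\<close> the number of tape symbols, the code of a symbol \<open>a\<close> is \<open>a\<close> itself, except that \<open>2 * s\<close>
  is a visited blank and that \<open>s + a\<close> stands for \<open>a\<close> in the cell \<open>0\<close> of tape 1.\<close>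

locale tm_sim =
  fixes M :: tm and b :: nat
  assumes M: "is_tm M"
begin

abbreviation "ns \<equiv> symbols M"
abbreviation "nt \<equiv> tapes M"
definition Lf :: "nat \<Rightarrow> nat" where "Lf j = b + 1 + 2 * j"
definition Rt :: "nat \<Rightarrow> nat" where "Rt j = b + 2 + 2 * j"

lemma ns: "3 \<le> ns" "2 \<le> nt" using M by (auto simp: is_tm_def)

lemma regs [simp]: "Lf i \<noteq> Rt j" "Rt i \<noteq> Lf j" "Lf i = Lf j \<longleftrightarrow> i = j" "Rt i = Rt j \<longleftrightarrow> i = j"
  "Lf i \<noteq> b" "Rt i \<noteq> b" "b \<noteq> Lf i" "b \<noteq> Rt i"
  unfolding Lf_def Rt_def by presburger+

definition decode :: "nat \<Rightarrow> nat" where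
  "decode c = (if c < ns then c else if c < 2 * ns then c - ns else 0)"

text \<open>The output is read from cell 0 of tape 1, whereas two stacks know positions only
  relative to the head. The mark preserves the origin.\<close>

definition marked :: "nat \<Rightarrow> bool" where
  "marked c \<longleftrightarrow> ns \<le> c \<and> c < 2 * ns"

definition encode :: "nat \<Rightarrow> bool \<Rightarrow> nat" where
  "encode a m = (if m then ns + a else if a = 0 then 2 * ns else a)"

lemma decode_less: "decode c < ns" using ns by (auto simp: decode_def)

lemma decode_0 [simp]: "decode 0 = 0" "\<not> marked 0" "decode (2 * ns) = 0" "\<not> marked (2 * ns)"
  using ns by (auto simp: decode_def marked_def)

lemma encode: "a < ns \<Longrightarrow> decode (encode a m) = a" "a < ns \<Longrightarrow> marked (encode a m) = m"
  "a < ns \<Longrightarrow> 0 < encode a m \<and> encode a m < 2 * ns + 1"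
  using ns by (auto simp: decode_def encode_def marked_def)

definition codes :: "nat list \<Rightarrow> bool" where
  "codes w \<longleftrightarrow> (\<forall>c\<in>set w. 0 < c \<and> c < 2 * ns + 1)"

definition tape_rep :: "bool \<Rightarrow> tape \<Rightarrow> nat list \<Rightarrow> nat list \<Rightarrow> bool" where
  "tape_rep m T l r \<longleftrightarrow> codes l \<and> codes r \<and> (\<forall>i::nat.
     fst T (snd T + int i) = decode (nd r i) \<and> fst T (snd T - 1 - int i) = decode (nd l i) \<and>
     (m \<longrightarrow> (marked (nd r i) \<longleftrightarrow> snd T + int i = 0) \<and> (marked (nd l i) \<longleftrightarrow> snd T - 1 - int i = 0)))"

lemma tape_rep_read: "tape_rep m T l r \<Longrightarrow> read_tape T = decode (top_symbol r)"
  by (auto simp: tape_rep_def read_tape_def nd_top_symbol dest!: spec[of _ "0::nat"])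

text \<open>The symbol \<open>c\<close> under the head has been popped before, by
  \<open>gather\<close>. Its mark is carried over to the symbol written in its place.\<close>

definition act_prog :: "nat \<Rightarrow> nat \<Rightarrow> nat \<times> move \<Rightarrow> prog" where
  "act_prog j c a = (let w = encode (fst a) (marked c) in
     case snd a of Stay \<Rightarrow> Push (Rt j) w
     | MoveRight \<Rightarrow> Push (Lf j) w
     | MoveLeft \<Rightarrow> Seq (Push (Rt j) w)
         (Pop (Lf j) (\<lambda>c. Push (Rt j) (if 0 < c \<and> c < 2 * ns + 1 then c else 2 * ns))))"

lemma act_prog:
  assumes rep: "tape_rep m T (\<sigma> (Lf j)) r" and r: "\<sigma> (Rt j) = tl r" and s: "fst a < ns"
  shows "\<exists>\<sigma>'. runs (act_prog j (top_symbol r) a) \<sigma> 4 \<sigma>' \<and> tape_rep m (act a T) (\<sigma>' (Lf j)) (\<sigma>' (Rt j)) \<and>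
    (\<forall>x. x \<noteq> Lf j \<longrightarrow> x \<noteq> Rt j \<longrightarrow> \<sigma>' x = \<sigma> x)"
proof -
  obtain f h where T: "T = (f, h)" by fastforce
  define w where "w = encode (fst a) (marked (top_symbol r))"
  let ?l = "\<sigma> (Lf j)"
  have w: "decode w = fst a" "marked w = marked (nd r 0)" "0 < w \<and> w < 2 * ns + 1"
    using encode[OF s] by (simp_all add: w_def nd_top_symbol)
  have c: "codes ?l" "codes (tl r)" using rep by (auto simp: tape_rep_def codes_def dest: in_set_tlD)
  have R: "f (h + int i) = decode (nd r i)" "m \<Longrightarrow> marked (nd r i) \<longleftrightarrow> h + int i = 0"
    and L: "f (h - 1 - int i) = decode (nd ?l i)" "m \<Longrightarrow> marked (nd ?l i) \<longleftrightarrow> h - 1 - int i = 0" for i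
    using rep unfolding tape_rep_def T by auto
  let ?f = "f(h := fst a)"
  show ?thesis
  proof (cases "snd a")
    case Stay
    let ?s = "\<sigma>(Rt j := w # tl r)"
    have "runs (act_prog j (top_symbol r) a) \<sigma> 4 ?s"
      unfolding act_prog_def using Stay r
      by (auto simp: Let_def w_def intro!: runs_mono[OF runs_Push])
    moreover have "tape_rep m (?f, h) ?l (w # tl r)"
      unfolding tape_rep_def
    proof (intro conjI allI impI)
      fix i
      show "fst (?f, h) (snd (?f, h) + int i) = decode (nd (w # tl r) i)"
        using w R(1)[of i] by (cases i) (auto simp: nd_tl)
      assume "m" then show "marked (nd (w # tl r) i) \<longleftrightarrow> snd (?f, h) + int i = 0"
        using w R(2)[of i] by (cases i) (auto simp: nd_tl)
    qed (use L w c in \<open>auto simp: codes_def\<close>)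
    ultimately show ?thesis using Stay T by (intro exI[of _ ?s]) (auto simp: act_def)
  next
    case MoveRight
    let ?s = "\<sigma>(Lf j := w # ?l)"
    have "runs (act_prog j (top_symbol r) a) \<sigma> 4 ?s"
      unfolding act_prog_def using MoveRight r
      by (auto simp: Let_def w_def intro!: runs_mono[OF runs_Push])
    moreover have "tape_rep m (?f, h + 1) (w # ?l) (tl r)"
      unfolding tape_rep_def
    proof (intro conjI allI impI)
      fix i
      show "fst (?f, h + 1) (snd (?f, h + 1) + int i) = decode (nd (tl r) i)"
        using R(1)[of "Suc i"] by (auto simp: nd_tl algebra_simps)
      show "fst (?f, h + 1) (snd (?f, h + 1) - 1 - int i) = decode (nd (w # ?l) i)"
        using w L(1)[of "i - 1"] by (cases i) (auto simp: algebra_simps)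
      assume m
      then show "marked (nd (tl r) i) \<longleftrightarrow> snd (?f, h + 1) + int i = 0"
        using R(2)[of "Suc i"] by (auto simp: nd_tl algebra_simps)
      from \<open>m\<close> show "marked (nd (w # ?l) i) \<longleftrightarrow> snd (?f, h + 1) - 1 - int i = 0"
        using w R(2)[of 0] L(2)[of "i - 1"] by (cases i) (auto simp: algebra_simps)
    qed (use w c in \<open>auto simp: codes_def\<close>)
    ultimately show ?thesis using MoveRight T r by (intro exI[of _ ?s]) (auto simp: act_def)
  next
    case MoveLeft
    \<comment> \<open>A cell reached for the first time from the right is stored as an explicit
      blank \<open>2 * ns\<close>, since 0 is not a stack symbol.\<close>
    let ?c = "if ?l = [] then 2 * ns else hd ?l"
    have cl: "0 < ?c \<and> ?c < 2 * ns + 1" using c(1) ns by (cases ?l) (auto simp: codes_def)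
    have dl: "decode ?c = decode (nd ?l 0)" "marked ?c = marked (nd ?l 0)" by (cases ?l; simp)+
    let ?s = "\<sigma>(Lf j := tl ?l, Rt j := ?c # w # tl r)"
    have eq: "(if 0 < top_symbol ?l \<and> top_symbol ?l < 2 * ns + 1 then top_symbol ?l else 2 * ns) = ?c"
      using c(1) by (cases ?l) (auto simp: codes_def)
    let ?s1 = "\<sigma>(Rt j := w # tl r)"
    have "runs (Push (Rt j) (if 0 < top_symbol (?s1 (Lf j)) \<and> top_symbol (?s1 (Lf j)) < 2 * ns + 1 then top_symbol (?s1 (Lf j)) else 2 * ns))
       (?s1(Lf j := tl (?s1 (Lf j)))) 1 ?s"
      using eq by (intro runs_Push) (auto simp: fun_eq_iff)
    note p = runs_Pop[where B = "\<lambda>c. Push (Rt j) (if 0 < c \<and> c < 2 * ns + 1 then c else 2 * ns)" and k = "Lf j", OF this]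
    have "runs (Push (Rt j) w) \<sigma> 1 ?s1" using r by (intro runs_Push) simp
    from runs_Seq[OF this p] have "runs (Seq (Push (Rt j) w)
         (Pop (Lf j) (\<lambda>c. Push (Rt j) (if 0 < c \<and> c < 2 * ns + 1 then c else 2 * ns)))) \<sigma> 4 ?s"
      by (rule runs_mono) simp
    moreover have "act_prog j (top_symbol r) a = Seq (Push (Rt j) w)
         (Pop (Lf j) (\<lambda>c. Push (Rt j) (if 0 < c \<and> c < 2 * ns + 1 then c else 2 * ns)))"
      unfolding act_prog_def using MoveLeft by (simp add: Let_def w_def)
    ultimately have "runs (act_prog j (top_symbol r) a) \<sigma> 4 ?s" by simp
    moreover have "tape_rep m (?f, h - 1) (tl ?l) (?c # w # tl r)"
      unfolding tape_rep_def
    proof (intro conjI allI impI)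
      fix i
      show "fst (?f, h - 1) (snd (?f, h - 1) + int i) = decode (nd (?c # w # tl r) i)"
        using w L(1)[of 0] dl R(1)[of "i - 1"]
        by (cases i; cases "i - 1") (auto simp: algebra_simps nd_tl simp del: if_split)
      show "fst (?f, h - 1) (snd (?f, h - 1) - 1 - int i) = decode (nd (tl ?l) i)"
        using L(1)[of "Suc i"] by (auto simp: nd_tl algebra_simps)
      assume m
      then show "marked (nd (?c # w # tl r) i) \<longleftrightarrow> snd (?f, h - 1) + int i = 0"
        using w L(2)[of 0] dl R(2)[of "i - 1"]
        by (cases i; cases "i - 1") (auto simp: algebra_simps nd_tl simp del: if_split)
      from \<open>m\<close> show "marked (nd (tl ?l) i) \<longleftrightarrow> snd (?f, h - 1) - 1 - int i = 0"
        using L(2)[of "Suc i"] by (auto simp: nd_tl algebra_simps)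
    next
      show "codes (tl ?l)" using c(1) by (auto simp: codes_def dest: in_set_tlD)
      show "codes (?c # w # tl r)" using cl w(3) c(2) unfolding codes_def by auto
    qed
    ultimately show ?thesis using MoveLeft T by (intro exI[of _ ?s]) (auto simp: act_def)
  qed
qed

section \<open>Simulating one step, and then a whole run\<close>

primrec acts_prog :: "nat list \<Rightarrow> (nat \<times> move) list \<Rightarrow> nat \<Rightarrow> prog" where
  "acts_prog cs as 0 = Skip"
| "acts_prog cs as (Suc j) = Seq (acts_prog cs as j) (act_prog j (cs ! j) (as ! j))"

lemma acts_prog:
  assumes "\<And>j. j < n \<Longrightarrow> tape_rep (j = 1) (ts ! j) (\<sigma> (Lf j)) (rr j)"
    "\<And>j. j < n \<Longrightarrow> \<sigma> (Rt j) = tl (rr j)" "\<And>j. j < n \<Longrightarrow> fst (as ! j) < ns"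
    "\<And>j. j < n \<Longrightarrow> cs ! j = top_symbol (rr j)"
  shows "\<exists>\<sigma>'. runs (acts_prog cs as n) \<sigma> (5 * n + 1) \<sigma>' \<and>
    (\<forall>j<n. tape_rep (j = 1) (act (as ! j) (ts ! j)) (\<sigma>' (Lf j)) (\<sigma>' (Rt j))) \<and>
    (\<forall>x. (\<forall>j<n. x \<noteq> Lf j \<and> x \<noteq> Rt j) \<longrightarrow> \<sigma>' x = \<sigma> x)"
  using assms
proof (induction n)
  case 0
  then show ?case using runs_Skip[of \<sigma>] by auto
next
  case (Suc n)
  have "\<exists>\<sigma>'. runs (acts_prog cs as n) \<sigma> (5 * n + 1) \<sigma>' \<and>
    (\<forall>j<n. tape_rep (j = 1) (act (as ! j) (ts ! j)) (\<sigma>' (Lf j)) (\<sigma>' (Rt j))) \<and>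
    (\<forall>x. (\<forall>j<n. x \<noteq> Lf j \<and> x \<noteq> Rt j) \<longrightarrow> \<sigma>' x = \<sigma> x)"
    by (rule Suc.IH) (rule Suc.prems, erule less_SucI)+
  then obtain \<sigma>1 where \<sigma>1: "runs (acts_prog cs as n) \<sigma> (5 * n + 1) \<sigma>1"
    "\<forall>j<n. tape_rep (j = 1) (act (as ! j) (ts ! j)) (\<sigma>1 (Lf j)) (\<sigma>1 (Rt j))"
    "\<forall>x. (\<forall>j<n. x \<noteq> Lf j \<and> x \<noteq> Rt j) \<longrightarrow> \<sigma>1 x = \<sigma> x"
    by (elim exE conjE) (rule that)
  have "\<sigma>1 (Lf n) = \<sigma> (Lf n)" "\<sigma>1 (Rt n) = \<sigma> (Rt n)"
    using \<sigma>1(3) by auto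
  then obtain \<sigma>2 where \<sigma>2: "runs (act_prog n (cs ! n) (as ! n)) \<sigma>1 4 \<sigma>2"
    "tape_rep (n = 1) (act (as ! n) (ts ! n)) (\<sigma>2 (Lf n)) (\<sigma>2 (Rt n))"
    "\<forall>x. x \<noteq> Lf n \<longrightarrow> x \<noteq> Rt n \<longrightarrow> \<sigma>2 x = \<sigma>1 x"
    using act_prog[of "n = 1" "ts ! n" \<sigma>1 n "rr n" "as ! n"] Suc.prems[of n] by auto
  have "\<sigma>2 (Lf j) = \<sigma>1 (Lf j)" "\<sigma>2 (Rt j) = \<sigma>1 (Rt j)" if "j < n" for j
    using that \<sigma>2(3) by auto
  then have "\<forall>j<Suc n. tape_rep (j = 1) (act (as ! j) (ts ! j)) (\<sigma>2 (Lf j)) (\<sigma>2 (Rt j))"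
    using \<sigma>1(2) \<sigma>2(2) by (simp add: less_Suc_eq)
  moreover have "runs (acts_prog cs as (Suc n)) \<sigma> (5 * Suc n + 1) \<sigma>2"
    using runs_Seq[OF \<sigma>1(1) \<sigma>2(1)] by (simp add: runs_mono)
  moreover have "\<forall>x. (\<forall>j<Suc n. x \<noteq> Lf j \<and> x \<noteq> Rt j) \<longrightarrow> \<sigma>2 x = \<sigma> x"
    using \<sigma>1(3) \<sigma>2(3) by (metis lessI less_SucI)
  ultimately show ?case by blast
qed

text \<open>A program branches on one stack at a time, but \<open>delta\<close> needs the symbols of
  all tapes. They are accumulated in the argument of \<open>F\<close>, that is, in the choice of the
  branch.\<close>

primrec gather :: "nat \<Rightarrow> nat \<Rightarrow> (nat list \<Rightarrow> prog) \<Rightarrow> prog" where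
  "gather 0 j F = F []"
| "gather (Suc n) j F = Pop (Rt j) (\<lambda>c. gather n (Suc j) (\<lambda>cs. F (c # cs)))"

lemma gather:
  assumes "runs (F (map (\<lambda>i. top_symbol (\<sigma> (Rt i))) [j..<j + n]))
    (\<lambda>x. if \<exists>i. j \<le> i \<and> i < j + n \<and> x = Rt i then tl (\<sigma> x) else \<sigma> x) T \<sigma>'"
  shows "runs (gather n j F) \<sigma> (T + n) \<sigma>'"
  using assms
proof (induction n arbitrary: j F \<sigma>)
  case 0
  have "(\<lambda>x. if \<exists>i. j \<le> i \<and> i < j + 0 \<and> x = Rt i then tl (\<sigma> x) else \<sigma> x) = \<sigma>" by (intro ext) auto
  then show ?case using 0 by simp
next
  case (Suc n)
  let ?s = "\<sigma>(Rt j := tl (\<sigma> (Rt j)))"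
  have upt: "[j..<j + Suc n] = j # [Suc j..<Suc j + n]" by (simp add: upt_conv_Cons)
  have e1: "map (\<lambda>i. top_symbol (\<sigma> (Rt i))) [Suc j..<Suc j + n] = map (\<lambda>i. top_symbol (?s (Rt i))) [Suc j..<Suc j + n]"
    by (intro map_cong) auto
  have e2: "(\<lambda>x. if \<exists>i. Suc j \<le> i \<and> i < Suc j + n \<and> x = Rt i then tl (?s x) else ?s x) =
     (\<lambda>x. if \<exists>i. j \<le> i \<and> i < j + Suc n \<and> x = Rt i then tl (\<sigma> x) else \<sigma> x)"
  proof
    fix x
    show "(if \<exists>i. Suc j \<le> i \<and> i < Suc j + n \<and> x = Rt i then tl (?s x) else ?s x) =
     (if \<exists>i. j \<le> i \<and> i < j + Suc n \<and> x = Rt i then tl (\<sigma> x) else \<sigma> x)"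
    proof (cases "x = Rt j")
      case True
      then have "\<not> (\<exists>i. Suc j \<le> i \<and> i < Suc j + n \<and> x = Rt i)" "\<exists>i. j \<le> i \<and> i < j + Suc n \<and> x = Rt i"
        by auto
      then show ?thesis using True by simp
    next
      case False
      then have *: "(\<exists>i. Suc j \<le> i \<and> i < Suc j + n \<and> x = Rt i) \<longleftrightarrow> (\<exists>i. j \<le> i \<and> i < j + Suc n \<and> x = Rt i)"
        by (metis Suc_le_eq add_Suc add_Suc_right le_eq_less_or_eq less_or_eq_imp_le)
      have "?s x = \<sigma> x" using False by simp
      then show ?thesis by (simp only: *)
    qed
  qed
  have "runs (gather n (Suc j) (\<lambda>cs. F (top_symbol (\<sigma> (Rt j)) # cs))) ?s (T + n) \<sigma>'"
    by (rule Suc.IH) (use Suc.prems in \<open>simp only: e1[symmetric] e2 upt list.map\<close>)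
  from runs_Pop[where B = "\<lambda>c. gather n (Suc j) (\<lambda>cs. F (c # cs))", OF this] show ?case by simp
qed

definition leaf :: "nat \<Rightarrow> nat list \<Rightarrow> prog" where
  "leaf q cs = (case delta M q (map decode cs) of (q', as) \<Rightarrow>
     Seq (acts_prog cs as nt) (if q' = states M then Skip else Push b (Suc q')))"

text \<open>The stack \<open>b\<close> holds the successor of the control state, and it is empty
  exactly when the machine has halted; so the loop stops at the right moment. The guard on
  \<open>s\<close> covers branches that are never taken but must be well-formed.\<close>

definition main_loop :: prog where
  "main_loop = Loop b (\<lambda>s. if s - 1 < states M then gather nt 0 (leaf (s - 1)) else Skip)"

definition conf_rep :: "store \<Rightarrow> config \<Rightarrow> bool" where
  "conf_rep \<sigma> c \<longleftrightarrow> fst c \<le> states M \<and> \<sigma> b = (if fst c = states M then [] else [Suc (fst c)]) \<and>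
     length (snd c) = nt \<and> (\<forall>j<nt. tape_rep (j = 1) (snd c ! j) (\<sigma> (Lf j)) (\<sigma> (Rt j)))"

definition frame :: "store \<Rightarrow> store \<Rightarrow> bool" where
  "frame \<sigma> \<sigma>' \<longleftrightarrow> (\<forall>x. x < b \<or> b + 2 * nt < x \<longrightarrow> \<sigma>' x = \<sigma> x)"

lemma delta_wf:
  assumes "q < states M" "length cs = nt" "delta M q (map decode cs) = (q', as)"
  shows "q' \<le> states M" "length as = nt" "\<And>j. j < nt \<Longrightarrow> fst (as ! j) < ns"
proof -
  have "\<forall>s\<in>set (map decode cs). s < symbols M" using decode_less by auto
  then have "case delta M q (map decode cs) of (q', as) \<Rightarrow>
      q' \<le> states M \<and> length as = tapes M \<and> (\<forall>(s', m) \<in> set as. s' < symbols M)"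
    using M assms(1,2) unfolding is_tm_def by simp
  then have *: "q' \<le> states M \<and> length as = tapes M \<and> (\<forall>(s', m) \<in> set as. s' < symbols M)"
    by (simp add: assms(3))
  then show "q' \<le> states M" "length as = nt" by auto
  show "fst (as ! j) < ns" if "j < nt" for j
    using * that nth_mem[of j as] by (cases "as ! j") auto
qed

lemma main_step:
  assumes rep: "conf_rep \<sigma> c" and q: "fst c \<noteq> states M"
  shows "\<exists>\<sigma>'. runs (gather nt 0 (leaf (fst c))) (\<sigma>(b := [])) (6 * nt + 3) \<sigma>' \<and> conf_rep \<sigma>' (tm_step M c) \<and> frame \<sigma> \<sigma>'"
proof -
  let ?ts = "snd c"
  define cs where "cs = map (\<lambda>i. top_symbol (\<sigma> (Rt i))) [0..<0 + nt]"
  have qs: "fst c < states M" using rep q by (auto simp: conf_rep_def)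
  have lts: "length ?ts = nt" using rep by (simp add: conf_rep_def)
  have tr: "tape_rep (j = 1) (?ts ! j) (\<sigma> (Lf j)) (\<sigma> (Rt j))" if "j < nt" for j
    using rep that by (auto simp: conf_rep_def)
  obtain q' as where d: "delta M (fst c) (map decode cs) = (q', as)" by fastforce
  have lcs: "length cs = nt" by (simp add: cs_def)
  note dw = delta_wf[OF qs lcs d]
  have rd: "map read_tape ?ts = map decode cs"
    using lts tr by (intro nth_equalityI) (auto simp: cs_def intro: tape_rep_read)
  have step: "tm_step M c = (q', map2 act as ?ts)"
    using q d rd by (simp add: tm_step_def)
  let ?s = "\<lambda>x. if \<exists>i. 0 \<le> i \<and> i < 0 + nt \<and> x = Rt i then tl ((\<sigma>(b := [])) x) else (\<sigma>(b := [])) x"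
  have sL: "?s (Lf j) = \<sigma> (Lf j)" for j by auto
  have sR: "?s (Rt j) = tl (\<sigma> (Rt j))" if "j < nt" for j
    using that by auto
  have sb: "?s b = []" by auto
  have "\<exists>\<sigma>'. runs (acts_prog cs as nt) ?s (5 * nt + 1) \<sigma>' \<and>
    (\<forall>j<nt. tape_rep (j = 1) (act (as ! j) (?ts ! j)) (\<sigma>' (Lf j)) (\<sigma>' (Rt j))) \<and>
    (\<forall>x. (\<forall>j<nt. x \<noteq> Lf j \<and> x \<noteq> Rt j) \<longrightarrow> \<sigma>' x = ?s x)"
    by (rule acts_prog[where rr = "\<lambda>j. \<sigma> (Rt j)"])
      (use tr dw(3) sL sR in \<open>auto simp: cs_def\<close>)
  then obtain \<sigma>1 where \<sigma>1: "runs (acts_prog cs as nt) ?s (5 * nt + 1) \<sigma>1"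
    "\<forall>j<nt. tape_rep (j = 1) (act (as ! j) (?ts ! j)) (\<sigma>1 (Lf j)) (\<sigma>1 (Rt j))"
    "\<forall>x. (\<forall>j<nt. x \<noteq> Lf j \<and> x \<noteq> Rt j) \<longrightarrow> \<sigma>1 x = ?s x"
    by blast
  have \<sigma>1b: "\<sigma>1 b = []" using \<sigma>1(3) sb by auto
  define \<sigma>2 where "\<sigma>2 = (if q' = states M then \<sigma>1 else \<sigma>1(b := Suc q' # \<sigma>1 b))"
  have "runs (if q' = states M then Skip else Push b (Suc q')) \<sigma>1 1 \<sigma>2"
  proof (cases "q' = states M")
    case True
    then show ?thesis using runs_Skip[of \<sigma>1] by (simp add: \<sigma>2_def)
  next
    case False
    then show ?thesis using runs_Push[OF refl, where \<sigma> = \<sigma>1 and k = b and s = "Suc q'"] by (simp add: \<sigma>2_def)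
  qed
  note sq = runs_Seq[OF \<sigma>1(1) this]
  have lf: "runs (leaf (fst c) cs) ?s (5 * nt + 3) \<sigma>2"
    unfolding leaf_def d prod.case by (rule runs_mono[OF sq]) simp
  have "cs = map (\<lambda>i. top_symbol ((\<sigma>(b := [])) (Rt i))) [0..<0 + nt]"
    by (simp add: cs_def)
  then have "runs (gather nt 0 (leaf (fst c))) (\<sigma>(b := [])) (5 * nt + 3 + nt) \<sigma>2"
    using lf by (intro gather) simp
  moreover have "conf_rep \<sigma>2 (tm_step M c)"
    using dw lts \<sigma>1(2) \<sigma>1b unfolding step conf_rep_def by (auto simp: \<sigma>2_def)
  moreover have "frame \<sigma> \<sigma>2"
    unfolding frame_def
  proof (intro allI impI)
    fix x assume x: "x < b \<or> b + 2 * nt < x"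
    then have n: "\<forall>j<nt. x \<noteq> Lf j \<and> x \<noteq> Rt j" "x \<noteq> b" by (auto simp: Lf_def Rt_def)
    then have "\<sigma>1 x = ?s x" using \<sigma>1(3) by blast
    moreover have "?s x = \<sigma> x" using n by auto
    ultimately show "\<sigma>2 x = \<sigma> x" using n by (simp add: \<sigma>2_def)
  qed
  ultimately show ?thesis by (auto simp: add.commute)
qed

lemma main_loop:
  "conf_rep \<sigma> c \<Longrightarrow> fst ((tm_step M ^^ t) c) = states M \<Longrightarrow>
    \<exists>\<sigma>'. runs main_loop \<sigma> (t * (6 * nt + 4) + 1) \<sigma>' \<and> conf_rep \<sigma>' ((tm_step M ^^ t) c) \<and> frame \<sigma> \<sigma>'"
proof (induction t arbitrary: \<sigma> c)
  case 0
  then have "\<sigma> b = []" by (simp add: conf_rep_def)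
  then have "runs main_loop \<sigma> 1 \<sigma>" unfolding main_loop_def by (rule runs_Loop_Nil)
  then show ?case using 0 by (auto simp: frame_def)
next
  case (Suc t)
  show ?case
  proof (cases "fst c = states M")
    case True
    then have "\<sigma> b = []" using Suc.prems by (simp add: conf_rep_def)
    then have "runs main_loop \<sigma> 1 \<sigma>" unfolding main_loop_def by (rule runs_Loop_Nil)
    then have "runs main_loop \<sigma> (Suc t * (6 * nt + 4) + 1) \<sigma>" by (rule runs_mono) simp
    moreover have "(tm_step M ^^ Suc t) c = c" using True by (rule tm_halted)
    ultimately show ?thesis using Suc.prems by (auto simp: frame_def)
  next
    case False
    then have sb: "\<sigma> b = Suc (fst c) # []" "fst c < states M" using Suc.prems by (auto simp: conf_rep_def)
    obtain \<sigma>1 where \<sigma>1: "runs (gather nt 0 (leaf (fst c))) (\<sigma>(b := [])) (6 * nt + 3) \<sigma>1"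
      "conf_rep \<sigma>1 (tm_step M c)" "frame \<sigma> \<sigma>1"
      using main_step[OF Suc.prems(1) False] by blast
    obtain \<sigma>2 where \<sigma>2: "runs main_loop \<sigma>1 (t * (6 * nt + 4) + 1) \<sigma>2"
      "conf_rep \<sigma>2 ((tm_step M ^^ t) (tm_step M c))" "frame \<sigma>1 \<sigma>2"
      using Suc.IH[OF \<sigma>1(2)] Suc.prems(2) by (auto simp: funpow_Suc_right simp del: funpow.simps)
    have "runs (if Suc (fst c) - 1 < states M then gather nt 0 (leaf (Suc (fst c) - 1)) else Skip) (\<sigma>(b := [])) (6 * nt + 3) \<sigma>1"
      using \<sigma>1(1) sb(2) by simp
    from runs_Loop_Cons[where B = "\<lambda>s. if s - 1 < states M then gather nt 0 (leaf (s - 1)) else Skip",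
        OF sb(1) this \<sigma>2(1)[unfolded main_loop_def]]
    have "runs main_loop \<sigma> (Suc t * (6 * nt + 4) + 1) \<sigma>2"
      unfolding main_loop_def by (rule runs_mono) simp
    then show ?thesis using \<sigma>2 \<sigma>1(3)
      by (auto simp: funpow_Suc_right frame_def simp del: funpow.simps)
  qed
qed

lemma wf_gather:
  "(\<And>cs. length cs = n \<Longrightarrow> wf_prog A (F cs)) \<Longrightarrow> (\<And>i. i < j + n \<Longrightarrow> Rt i < A) \<Longrightarrow> wf_prog A (gather n j F)"
  by (induction n arbitrary: j F) auto

lemma wf_acts_prog:
  assumes "\<And>j. j < n \<Longrightarrow> fst (as ! j) < ns" "\<And>i. i < n \<Longrightarrow> Rt i < A" "2 * ns < A"
  shows "wf_prog A (acts_prog cs as n)"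
  using assms
proof (induction n)
  case (Suc n)
  have 1: "fst (as ! n) < ns" "Rt n < A" using Suc.prems by auto
  have "wf_prog A (act_prog n (cs ! n) (as ! n))"
    using encode(3)[OF 1(1), of "marked (cs ! n)"] 1(2) Suc.prems(3) ns
    by (cases "snd (as ! n)") (auto simp: act_prog_def Let_def Lf_def Rt_def)
  then show ?case using Suc by simp
qed simp

lemma wf_main_loop:
  assumes "2 * ns < A" "states M + 1 < A" "b + 2 * nt < A"
  shows "wf_prog A main_loop"
proof -
  have R: "Rt i < A" if "i < nt" for i using that assms(3) by (simp add: Rt_def)
  have "wf_prog A (leaf q cs)" if q: "q < states M" "length cs = nt" for q cs
  proof -
    obtain q' as where d: "delta M q (map decode cs) = (q', as)" by fastforce
    note dw = delta_wf[OF q d]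
    show ?thesis using dw assms R by (auto simp: leaf_def d intro!: wf_acts_prog)
  qed
  then show ?thesis using assms(3) R by (auto simp: main_loop_def intro!: wf_gather)
qed

section \<open>Reading off the output tape\<close>

abbreviation "X \<equiv> b + 1 + 2 * nt"
abbreviation "Y \<equiv> b + 2 + 2 * nt"
abbreviation "Z \<equiv> b + 3 + 2 * nt"

text \<open>Everything to the left of the origin is thrown away. At the marked cell the body moves
  all the remaining cells to \<open>X\<close>; this empties the stack of the loop and thereby ends
  it.\<close>

definition scan :: prog where
  "scan = Loop (Rt 1) (\<lambda>c. if marked c then Seq (Push X (encode (c - ns) False)) (mv (2 * ns + 1) (Rt 1) X) else Skip)"

text \<open>The cells arrive from right to left. A symbol that is not a bit cuts off all that lies
  to its right, so clearing \<open>Y\<close> there leaves the longest prefix of bits.\<close>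

definition prefix_prog :: prog where
  "prefix_prog = Loop X (\<lambda>c. if c = 1 \<or> c = 2 then Push Y c else clear Y)"

lemma Rt1 [simp]: "Rt 1 \<noteq> X" "Rt 1 \<noteq> Y" "Rt 1 \<noteq> Z" "X \<noteq> Rt 1" "Y \<noteq> Rt 1" "Z \<noteq> Rt 1"
  using ns(2) by (auto simp: Rt_def)

lemma scan:
  "\<sigma> (Rt 1) = u @ c # v \<Longrightarrow> \<forall>x\<in>set u. \<not> marked x \<Longrightarrow> marked c \<Longrightarrow> codes v \<Longrightarrow>
    runs scan \<sigma> (2 * length u + 2 * length v + 6) (\<sigma>(Rt 1 := [], X := rev (encode (c - ns) False # v) @ \<sigma> X))"
proof (induction u arbitrary: \<sigma>)
  case Nil
  let ?s = "\<sigma>(Rt 1 := v, X := encode (c - ns) False # \<sigma> X)"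
  let ?s' = "\<sigma>(Rt 1 := [], X := rev (encode (c - ns) False # v) @ \<sigma> X)"
  have "runs (Push X (encode (c - ns) False)) (\<sigma>(Rt 1 := v)) 1 ?s"
    by (rule runs_Push) (simp del: One_nat_def)
  moreover have "runs (mv (2 * ns + 1) (Rt 1) X) ?s (length (?s (Rt 1)) * 2 + 1) ?s'"
    using Nil by (intro runs_mv) (auto simp: codes_def fun_eq_iff simp del: One_nat_def)
  ultimately have "runs (Seq (Push X (encode (c - ns) False)) (mv (2 * ns + 1) (Rt 1) X)) (\<sigma>(Rt 1 := v))
      (Suc (1 + (length (?s (Rt 1)) * 2 + 1))) ?s'" by (rule runs_Seq)
  then have B: "runs (if marked c then Seq (Push X (encode (c - ns) False)) (mv (2 * ns + 1) (Rt 1) X) else Skip)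
      (\<sigma>(Rt 1 := v)) (Suc (1 + (length (?s (Rt 1)) * 2 + 1))) ?s'" using Nil by (simp only: if_True)
  have "runs scan ?s' 1 ?s'" unfolding scan_def by (rule runs_Loop_Nil) (simp del: One_nat_def)
  note L = this[unfolded scan_def]
  have "runs scan \<sigma> (Suc (Suc (1 + (length (?s (Rt 1)) * 2 + 1)) + 1)) ?s'"
    unfolding scan_def
    by (rule runs_Loop_Cons[where B = "\<lambda>c. if marked c then Seq (Push X (encode (c - ns) False)) (mv (2 * ns + 1) (Rt 1) X) else Skip",
          OF _ B L]) (use Nil in simp)
  then show ?case by (rule runs_mono) (simp del: One_nat_def)
next
  case (Cons a u)
  have "runs scan (\<sigma>(Rt 1 := u @ c # v)) (2 * length u + 2 * length v + 6)
     ((\<sigma>(Rt 1 := u @ c # v))(Rt 1 := [], X := rev (encode (c - ns) False # v) @ (\<sigma>(Rt 1 := u @ c # v)) X))"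
    by (rule Cons.IH) (use Cons.prems in auto)
  moreover have "(\<sigma>(Rt 1 := u @ c # v))(Rt 1 := [], X := rev (encode (c - ns) False # v) @ (\<sigma>(Rt 1 := u @ c # v)) X)
     = \<sigma>(Rt 1 := [], X := rev (encode (c - ns) False # v) @ \<sigma> X)" by (simp del: One_nat_def)
  ultimately have IH: "runs scan (\<sigma>(Rt 1 := u @ c # v)) (2 * length u + 2 * length v + 6)
     (\<sigma>(Rt 1 := [], X := rev (encode (c - ns) False # v) @ \<sigma> X))" by simp
  have sk: "runs (if marked a then Seq (Push X (encode (a - ns) False)) (mv (2 * ns + 1) (Rt 1) X) else Skip)
      (\<sigma>(Rt 1 := u @ c # v)) 1 (\<sigma>(Rt 1 := u @ c # v))" using Cons.prems(2) runs_Skip by simp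
  have "runs scan \<sigma> (Suc (1 + (2 * length u + 2 * length v + 6)))
     (\<sigma>(Rt 1 := [], X := rev (encode (c - ns) False # v) @ \<sigma> X))"
    unfolding scan_def
    by (rule runs_Loop_Cons[where B = "\<lambda>c. if marked c then Seq (Push X (encode (c - ns) False)) (mv (2 * ns + 1) (Rt 1) X) else Skip",
          OF _ sk IH[unfolded scan_def]]) (use Cons.prems in simp)
  then show ?case by (rule runs_mono) simp
qed

lemma prefix_prog:
  assumes "\<sigma> Y = []" "\<sigma>' = \<sigma>(X := [], Y := takeWhile (\<lambda>c. c = 1 \<or> c = 2) (rev (\<sigma> X)))"
  shows "runs prefix_prog \<sigma> (length (\<sigma> X) * Suc (length (\<sigma> X) * 2 + 1) + 1) \<sigma>'"
proof -
  define F where "F u v = \<sigma>(X := v, Y := takeWhile (\<lambda>c. c = 1 \<or> c = 2) (rev u))" for u v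
  have "runs prefix_prog (F [] (\<sigma> X)) (length (\<sigma> X) * Suc (length (\<sigma> X) * 2 + 1) + 1) (F (\<sigma> X) [])"
    unfolding prefix_prog_def
  proof (rule runs_Loop_list)
    fix u c v assume w: "\<sigma> X = u @ c # v"
    have l: "length ((F u v) Y) \<le> length (\<sigma> X)"
      using length_takeWhile_le[of "\<lambda>c. c = 1 \<or> c = 2" "rev u"] w by (simp add: F_def)
    have e: "(F u (c # v))(X := v) = F u v" by (simp add: F_def fun_eq_iff)
    show "runs (if c = 1 \<or> c = 2 then Push Y c else clear Y) ((F u (c # v))(X := v)) (length (\<sigma> X) * 2 + 1) (F (u @ [c]) v)"
    proof (cases "c = 1 \<or> c = 2")
      case True
      have "runs (Push Y c) (F u v) 1 (F (u @ [c]) v)"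
        by (rule runs_Push) (use True in \<open>auto simp: F_def fun_eq_iff\<close>)
      then show ?thesis unfolding e using True by (simp add: runs_mono)
    next
      case False
      have "runs (clear Y) (F u v) (length ((F u v) Y) * 2 + 1) (F (u @ [c]) v)"
        by (rule runs_clear) (use False in \<open>auto simp: F_def fun_eq_iff\<close>)
      then show ?thesis unfolding e using False l by (auto elim: runs_mono)
    qed
  qed (simp add: F_def)
  moreover have "F [] (\<sigma> X) = \<sigma>" "F (\<sigma> X) [] = \<sigma>'" using assms by (auto simp: F_def fun_eq_iff)
  ultimately show ?thesis by simp
qed

lemma takeWhile_nd:
  "\<forall>i<length y. nd z i = bit_symbol (y ! i) \<Longrightarrow> \<not> (nd z (length y) = 1 \<or> nd z (length y) = 2) \<Longrightarrow>
    takeWhile (\<lambda>c. c = 1 \<or> c = 2) z = bits y"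
proof (induction y arbitrary: z)
  case Nil
  then show ?case by (cases z) auto
next
  case (Cons a y)
  have a: "nd z 0 = bit_symbol a" using Cons.prems(1) by auto
  then obtain z' where z: "z = bit_symbol a # z'" by (cases z) (auto simp: bit_symbol_def split: if_splits)
  have "takeWhile (\<lambda>c. c = 1 \<or> c = 2) z' = bits y"
    by (rule Cons.IH) (use Cons.prems z in auto)
  then show ?case by (simp add: z bit_symbol_def)
qed

text \<open>The list \<open>rev l @ r\<close> is the visited part of the tape from left to right,
  and the mark in it is unique, because it singles out the absolute position 0.\<close>

lemma tape_output_list:
  assumes rep: "tape_rep True T l r" and out: "tape_output T y"
  shows "\<exists>u c v. rev l @ r = u @ c # v \<and> (\<forall>x\<in>set u. \<not> marked x) \<and> marked c \<and>
    takeWhile (\<lambda>c. c = 1 \<or> c = 2) (encode (c - ns) False # v) = bits y"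
proof -
  obtain f h where T: "T = (f, h)" by fastforce
  define w where "w = rev l @ r"
  have R: "f (h + int i) = decode (nd r i)" "marked (nd r i) \<longleftrightarrow> h + int i = 0"
    and L: "f (h - 1 - int i) = decode (nd l i)" "marked (nd l i) \<longleftrightarrow> h - 1 - int i = 0" for i
    using rep unfolding tape_rep_def T by auto
  have W: "f (h - int (length l) + int i) = decode (nd w i)" "marked (nd w i) \<longleftrightarrow> h - int (length l) + int i = 0" for i
  proof -
    have "f (h - int (length l) + int i) = decode (nd w i) \<and> (marked (nd w i) \<longleftrightarrow> h - int (length l) + int i = 0)"
    proof (cases "i < length l")
      case True
      then have e: "nd w i = nd l (length l - 1 - i)" by (auto simp: nd_def w_def nth_append rev_nth)
      have p: "h - 1 - int (length l - 1 - i) = h - int (length l) + int i" using True by simp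
      show ?thesis using L[of "length l - 1 - i"] unfolding p e by simp
    next
      case False
      then have e: "nd w i = nd r (i - length l)" by (auto simp: nd_def w_def nth_append)
      have p: "h + int (i - length l) = h - int (length l) + int i" using False by simp
      show ?thesis using R[of "i - length l"] unfolding p e by simp
    qed
    then show "f (h - int (length l) + int i) = decode (nd w i)" "marked (nd w i) \<longleftrightarrow> h - int (length l) + int i = 0"
      by auto
  qed
  \<comment> \<open>Otherwise the origin would lie below the bottom of the left stack, where nothing
    is marked.\<close>
  have hl: "h \<le> int (length l)"
  proof (rule ccontr)
    assume "\<not> h \<le> int (length l)"
    then have "nd l (nat (h - 1)) = 0" "h - 1 - int (nat (h - 1)) = 0" by (auto simp: nd_def)
    then show False using L(2)[of "nat (h - 1)"] by simp
  qed
  define p where "p = nat (int (length l) - h)"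
  have p: "h - int (length l) + int p = 0" using hl by (simp add: p_def)
  then have "marked (nd w p)" using W(2) by simp
  then have pw: "p < length w" by (auto simp: nd_def split: if_splits)
  have mp: "marked (w ! p)" using \<open>marked (nd w p)\<close> pw by (simp add: nd_def)
  have weq: "w = take p w @ w ! p # drop (Suc p) w" using pw by (rule id_take_nth_drop)
  have u: "\<not> marked x" if x: "x \<in> set (take p w)" for x
  proof -
    obtain i where i: "i < p" "x = w ! i" using x by (auto simp: in_set_conv_nth)
    then have "marked x \<longleftrightarrow> h - int (length l) + int i = 0" using W(2)[of i] pw by (simp add: nd_def)
    then show ?thesis using p i by simp
  qed
  define z where "z = encode (w ! p - ns) False # drop (Suc p) w"
  have z: "decode (nd z i) = f (int i) \<and> \<not> marked (nd z i)" for i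
  proof (cases i)
    case 0
    have "decode (w ! p) = w ! p - ns" "w ! p - ns < ns" using mp by (auto simp: decode_def marked_def)
    moreover have "decode (w ! p) = f 0" using W(1)[of p] pw p by (simp add: nd_def)
    ultimately show ?thesis using 0 encode by (simp add: z_def)
  next
    case (Suc j)
    have "nd z i = nd w (p + i)" using Suc by (auto simp: z_def nd_def)
    moreover have e: "h - int (length l) + int (p + i) = int i" using p by simp
    ultimately show ?thesis using W[of "p + i", unfolded e] Suc by simp
  qed
  have "takeWhile (\<lambda>c. c = 1 \<or> c = 2) z = bits y"
  proof (rule takeWhile_nd)
    show "\<forall>i<length y. nd z i = bit_symbol (y ! i)"
    proof (intro allI impI)
      fix i assume "i < length y"
      then have "decode (nd z i) = bit_symbol (y ! i)" using out z[of i] by (simp add: tape_output_def T)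
      then show "nd z i = bit_symbol (y ! i)" using z[of i]
        by (auto simp: decode_def marked_def bit_symbol_def split: if_splits)
    qed
    have "decode (nd z (length y)) = 0" using out z[of "length y"] by (simp add: tape_output_def T)
    then show "\<not> (nd z (length y) = 1 \<or> nd z (length y) = 2)"
      using ns by (auto simp: decode_def split: if_splits)
  qed
  then show ?thesis using weq u mp unfolding w_def[symmetric] z_def by blast
qed

definition read_out :: "nat \<Rightarrow> prog" where
  "read_out d = Seq (mv (2 * ns + 1) (Lf 1) (Rt 1)) (Seq scan (Seq prefix_prog (Seq (mv 3 Y Z) (Seq (mv 3 Z d)
     (clears b (2 * nt + 4))))))"

lemma wf_read_out:
  assumes "2 * ns < A" "b + 2 * nt + 4 < A" "d < b"
  shows "wf_prog A (read_out d)"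
proof -
  have "encode (c - ns) False < A \<and> 0 < encode (c - ns) False" if "marked c" for c
    using encode(3)[of "c - ns" False] that assms(1) unfolding marked_def by linarith
  moreover have "Lf 1 < A" "Rt 1 < A" using assms ns(2) by (auto simp: Lf_def Rt_def)
  ultimately show ?thesis using assms ns unfolding read_out_def scan_def prefix_prog_def
    by (auto intro!: wf_prog_clears simp del: One_nat_def)
qed

lemma read_out:
  assumes rep: "conf_rep \<sigma> c" and out: "tape_output (snd c ! 1) y" and d: "d < b"
    and len: "\<And>x. b \<le> x \<Longrightarrow> length (\<sigma> x) \<le> L" and hi: "\<And>x. b + 2 * nt < x \<Longrightarrow> \<sigma> x = []"
  shows "runs (read_out d) \<sigma> (16 * (L + 1) * (L + 1) + (2 * nt + 4) * (4 * L + 2) + 40)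
    ((\<lambda>x. if b \<le> x then [] else \<sigma> x)(d := bits y @ \<sigma> d))"
proof -
  let ?l = "\<sigma> (Lf 1)" let ?r = "\<sigma> (Rt 1)"
  have tr: "tape_rep True (snd c ! 1) ?l ?r" 
  proof -
    have "\<forall>j<nt. tape_rep (j = 1) (snd c ! j) (\<sigma> (Lf j)) (\<sigma> (Rt j))"
      using rep unfolding conf_rep_def by blast
    from this[rule_format, of 1] ns(2) show ?thesis by simp
  qed
  obtain u a v where w: "rev ?l @ ?r = u @ a # v" "\<forall>x\<in>set u. \<not> marked x" "marked a"
    "takeWhile (\<lambda>c. c = 1 \<or> c = 2) (encode (a - ns) False # v) = bits y"
    using tape_output_list[OF tr out] by blast
  let ?e = "encode (a - ns) False"
  have cl: "codes ?l" "codes ?r" using tr by (auto simp: tape_rep_def)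
  have "set v \<subseteq> set (rev ?l @ ?r)" unfolding w(1) by auto
  then have cv: "codes v" using cl unfolding codes_def by auto
  have Lb: "b \<le> Lf 1" "b \<le> Rt 1" "d \<noteq> Lf 1" "d \<noteq> Rt 1" using d by (auto simp: Lf_def Rt_def)
  have lw: "length u + length v + 1 \<le> 2 * L"
    using arg_cong[OF w(1), of length] len[OF Lb(1)] len[OF Lb(2)] by simp
  have ly: "length y \<le> length v + 1"
    using arg_cong[OF w(4), of length] length_takeWhile_le[of "\<lambda>c. c = 1 \<or> c = 2" "?e # v"]
    by (simp del: takeWhile.simps)
  have X0: "\<sigma> X = []" "\<sigma> Y = []" "\<sigma> Z = []" using hi by auto
  have dn: "d \<noteq> X" "d \<noteq> Y" "d \<noteq> Z" using d by auto
  have nLX: "Lf 1 \<noteq> X" "Lf 1 \<noteq> Y" "Lf 1 \<noteq> Z" using ns(2) by (auto simp: Lf_def)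
  let ?s1 = "\<sigma>(Lf 1 := [], Rt 1 := u @ a # v)"
  let ?s2 = "\<sigma>(Lf 1 := [], Rt 1 := [], X := rev (?e # v))"
  let ?s3 = "\<sigma>(Lf 1 := [], Rt 1 := [], Y := bits y)"
  let ?s4 = "\<sigma>(Lf 1 := [], Rt 1 := [], Z := rev (bits y))"
  let ?s5 = "\<sigma>(Lf 1 := [], Rt 1 := [], d := bits y @ \<sigma> d)"
  have 1: "runs (mv (2 * ns + 1) (Lf 1) (Rt 1)) \<sigma> (length (\<sigma> (Lf 1)) * 2 + 1) ?s1"
    using cl(1) w(1) by (intro runs_mv) (auto simp: codes_def simp del: One_nat_def)
  have 2: "runs scan ?s1 (2 * length u + 2 * length v + 6) ?s2"
  proof -
    have "runs scan ?s1 (2 * length u + 2 * length v + 6)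
       (?s1(Rt 1 := [], X := rev (?e # v) @ ?s1 X))"
      by (rule scan) (use w cv in \<open>auto simp del: One_nat_def\<close>)
    moreover have "?s1(Rt 1 := [], X := rev (?e # v) @ ?s1 X) = ?s2"
      using X0 nLX by (auto simp: fun_eq_iff simp del: One_nat_def)
    ultimately show ?thesis by simp
  qed
  have 3: "runs prefix_prog ?s2 (length (?s2 X) * Suc (length (?s2 X) * 2 + 1) + 1) ?s3"
    by (rule prefix_prog) (use X0 nLX w(4) in \<open>auto simp: fun_eq_iff simp del: One_nat_def takeWhile.simps\<close>)
  have 4: "runs (mv 3 Y Z) ?s3 (length (?s3 Y) * 2 + 1) ?s4"
    by (rule runs_mv) (use X0 nLX bits_range[of y] in \<open>auto simp: fun_eq_iff simp del: One_nat_def bits_simps(5)\<close>)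
  have 5: "runs (mv 3 Z d) ?s4 (length (?s4 Z) * 2 + 1) ?s5"
    by (rule runs_mv) (use X0 nLX dn Lb bits_range[of "rev y"] in \<open>auto simp: fun_eq_iff simp del: One_nat_def\<close>)
  have 6: "runs (clears b (2 * nt + 4)) ?s5 ((2 * nt + 4) * (2 * L + 2) + 1)
     (\<lambda>k. if b \<le> k \<and> k < b + (2 * nt + 4) then [] else ?s5 k)"
    by (rule runs_clears) (use len d in auto)
  have eq: "(\<lambda>k. if b \<le> k \<and> k < b + (2 * nt + 4) then [] else ?s5 k) =
      (\<lambda>x. if b \<le> x then [] else \<sigma> x)(d := bits y @ \<sigma> d)"
    using d hi Lb by (auto simp: fun_eq_iff simp del: One_nat_def)
  have "runs (read_out d) \<sigma> (Suc (length (\<sigma> (Lf 1)) * 2 + 1 + Suc (2 * length u + 2 * length v + 6 +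
     Suc (length (?s2 X) * Suc (length (?s2 X) * 2 + 1) + 1 + Suc (length (?s3 Y) * 2 + 1 +
     Suc (length (?s4 Z) * 2 + 1 + ((2 * nt + 4) * (2 * L + 2) + 1)))))))
    (\<lambda>k. if b \<le> k \<and> k < b + (2 * nt + 4) then [] else ?s5 k)"
    unfolding read_out_def
    by (intro runs_Seq[OF 1] runs_Seq[OF 2] runs_Seq[OF 3] runs_Seq[OF 4] runs_Seq[OF 5] 6)
  then show ?thesis unfolding eq
  proof (rule runs_mono)
    define V where "V = length v + 1"
    have V: "V \<le> 2 * L" "length u + V \<le> 2 * L" "length y \<le> V" "length (\<sigma> (Lf 1)) \<le> L"
      using lw ly len[OF Lb(1)] by (simp_all add: V_def)
    have "V * Suc (V * 2 + 1) \<le> (2 * L) * Suc (2 * L * 2 + 1)"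
      using V(1) by (intro mult_mono) auto
    then have "V * Suc (V * 2 + 1) \<le> 8 * (L * L) + 4 * L" by (simp add: algebra_simps)
    moreover have "length (?s2 X) = V" "length (?s3 Y) = length y" "length (?s4 Z) = length y"
      by (simp_all add: V_def)
    moreover have "16 * (L + 1) * (L + 1) = 16 * (L * L) + 32 * L + 16" by (simp add: algebra_simps)
    moreover have "(2 * nt + 4) * (2 * L + 2) \<le> (2 * nt + 4) * (4 * L + 2)"
      by (intro mult_left_mono) auto
    ultimately show "Suc (length (\<sigma> (Lf 1)) * 2 + 1 + Suc (2 * length u + 2 * length v + 6 +
     Suc (length (?s2 X) * Suc (length (?s2 X) * 2 + 1) + 1 + Suc (length (?s3 Y) * 2 + 1 +
     Suc (length (?s4 Z) * 2 + 1 + ((2 * nt + 4) * (2 * L + 2) + 1)))))) \<le>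
      16 * (L + 1) * (L + 1) + (2 * nt + 4) * (4 * L + 2) + 40"
      using V by (simp only:) (simp add: V_def)
  qed
qed

text \<open>The symbol \<open>ns\<close> is the code of a blank with the mark: the output tape is
  empty and its head stands on cell 0.\<close>

lemma conf_rep_init:
  assumes "\<forall>x\<ge>b. \<sigma> x = []"
  shows "conf_rep (\<sigma>(Rt 0 := bits w, Rt 1 := [ns], b := (if states M = 0 then [] else [1]))) (init_config M w)"
proof -
  let ?s = "\<sigma>(Rt 0 := bits w, Rt 1 := [ns], b := (if states M = 0 then [] else [1]))"
  have bt: "nd (bits w) i = (if i < length w then bit_symbol (w ! i) else 0)" for i
    by (simp add: nd_def bits_def)
  have dec: "decode (bit_symbol x) = bit_symbol x" for x using ns(1) by (auto simp: decode_def bit_symbol_def)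
  have t0: "tape_rep False (input_tape w) [] (bits w)"
    using bits_range[of w] ns(1) by (fastforce simp: tape_rep_def codes_def input_tape_def bt dec)
  have m: "nd [ns] i = (if i = 0 then ns else 0)" for i by (cases i) auto
  have dm: "decode ns = 0" "marked ns" using ns(1) by (auto simp: decode_def marked_def)
  have t1: "tape_rep True (\<lambda>_. 0, 0) [] [ns]"
    using ns(1) dm by (auto simp: tape_rep_def codes_def m)
  have t2: "tape_rep False (\<lambda>_. 0, 0) [] []" by (simp add: tape_rep_def codes_def)
  have "b \<le> Lf j" "b \<le> Rt j" for j by (auto simp: Lf_def Rt_def)
  then have L: "?s (Lf j) = []" and R: "?s (Rt j) = (if j = 0 then bits w else if j = 1 then [ns] else [])" for j
    using assms by (auto simp del: One_nat_def)
  have "tape_rep (j = 1) ((input_tape w # replicate (nt - 1) (\<lambda>_. 0, 0)) ! j) (?s (Lf j)) (?s (Rt j))" if "j < nt" for j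
    unfolding L R using that t0 t1 t2 by (cases j) auto
  then show ?thesis unfolding conf_rep_def init_config_def using ns(2) by simp
qed

end

text \<open>\<open>F\<close> is any function whose values \<open>M\<close> outputs on the values of
  \<open>g\<close>. This covers both deterministic deciders and the approximation algorithm, whose
  answer is specified by a property only.\<close>

theorem FP_turing_machine:
  assumes M: "is_tm M" and g: "FP m g"
    and out: "\<And>e. length e = m \<Longrightarrow> outputs_within M (poly p (length (g e))) (g e) (F e)"
  shows "FP m F"
proof (rule FP_I)
  fix rs :: "nat list" and d b assume r: "length rs = m" "\<forall>r\<in>set rs. r < b \<and> r \<noteq> d" "d < b"
  interpret tm_sim M b by unfold_locales (rule M)
  let ?bb = "b + 4 + 2 * nt"
  have *: "\<forall>r\<in>set rs. r < ?bb \<and> r \<noteq> Rt 0" "Rt 0 < ?bb" using r by (auto simp: Rt_def)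
  obtain Pg Ag Tg where Pg: "wf_prog Ag Pg" "pbd m Tg"
    "\<And>\<sigma> e. \<forall>k\<ge>?bb. \<sigma> k = [] \<Longrightarrow> map \<sigma> rs = map bits e \<Longrightarrow>
        runs Pg \<sigma> (Tg e) (\<sigma>(Rt 0 := bits (g e) @ \<sigma> (Rt 0)))"
    by (rule FP_E[OF g r(1) *]) blast
  let ?P1 = "Seq Pg (Seq (Push (Rt 1) ns) (Seq (if states M = 0 then Skip else Push b 1) main_loop))"
  let ?P = "Seq ?P1 (read_out d)"
  let ?t = "\<lambda>e. poly p (length (g e))"
  \<comment> \<open>The running time up to the end of the simulation; by \<open>exec_length\<close>
    it also bounds the stacks that have to be read and cleared afterwards.\<close>
  define L where "L e = Suc (Tg e + Suc (1 + Suc (1 + (?t e * (6 * nt + 4) + 1))))" for e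
  let ?T = "\<lambda>e. Suc (L e + (16 * (L e + 1) * (L e + 1) + (2 * nt + 4) * (4 * L e + 2) + 40))"
  have "runs ?P \<sigma> (?T e) (\<sigma>(d := bits (F e) @ \<sigma> d))"
    if \<sigma>: "\<forall>k\<ge>b. \<sigma> k = []" "map \<sigma> rs = map bits e" for \<sigma> e
  proof -
    have em: "length e = m" using \<sigma>(2) r(1) by (metis length_map)
    let ?s1 = "\<sigma>(Rt 0 := bits (g e))"
    let ?s2 = "?s1(Rt 1 := [ns])"
    let ?s3 = "?s2(b := (if states M = 0 then [] else [1]))"
    have Rb: "b \<le> Rt j" for j by (simp add: Rt_def)
    have 1: "runs Pg \<sigma> (Tg e) ?s1" using Pg(3)[OF _ \<sigma>(2)] \<sigma>(1) Rb by simp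
    have 2: "runs (Push (Rt 1) ns) ?s1 1 ?s2"
      by (rule runs_Push) (use \<sigma>(1) Rb in \<open>simp del: One_nat_def\<close>)
    have 3: "runs (if states M = 0 then Skip else Push b 1) ?s2 1 ?s3"
    proof (cases "states M = 0")
      case True
      then have "?s3 = ?s2" using \<sigma>(1) by (auto simp: fun_eq_iff simp del: One_nat_def)
      then show ?thesis using True runs_Skip[of ?s2] by simp
    next
      case False
      have "runs (Push b 1) ?s2 1 ?s3" by (rule runs_Push) (use \<sigma>(1) False in \<open>simp\<close>)
      then show ?thesis using False by (simp only: if_False)
    qed
    define c where "c = (tm_step M ^^ ?t e) (init_config M (g e))"
    have c: "fst c = states M" "tape_output (snd c ! 1) (F e)"
      using out[OF em] by (auto simp: outputs_within_def Let_def c_def)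
    obtain \<sigma>' where \<sigma>': "runs main_loop ?s3 (?t e * (6 * nt + 4) + 1) \<sigma>'" "conf_rep \<sigma>' c" "frame ?s3 \<sigma>'"
      using main_loop[OF conf_rep_init[OF \<sigma>(1)], of "?t e"] c unfolding c_def by blast
    have R1: "runs ?P1 \<sigma> (L e) \<sigma>'"
      unfolding L_def by (intro runs_Seq[OF 1] runs_Seq[OF 2] runs_Seq[OF 3] \<sigma>'(1))
    then obtain t where "t \<le> L e" "exec ?P1 \<sigma> t \<sigma>'" unfolding runs_def by blast
    then have len: "length (\<sigma>' x) \<le> L e" if "b \<le> x" for x
      using exec_length[of ?P1 \<sigma> t \<sigma>' x] \<sigma>(1) that by simp
    have fr: "\<sigma>' x = \<sigma> x" if "x < b \<or> b + 2 * nt < x" for x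
    proof -
      have "x \<noteq> Rt 0" "x \<noteq> Rt 1" "x \<noteq> b" using that ns(2) by (auto simp: Rt_def)
      then show ?thesis using \<sigma>'(3) that by (auto simp: frame_def simp del: One_nat_def)
    qed
    have "runs (read_out d) \<sigma>' (16 * (L e + 1) * (L e + 1) + (2 * nt + 4) * (4 * L e + 2) + 40)
      ((\<lambda>x. if b \<le> x then [] else \<sigma>' x)(d := bits (F e) @ \<sigma>' d))"
      by (rule read_out[OF \<sigma>'(2) c(2) r(3) len]) (use fr \<sigma>(1) in auto)
    moreover have "(\<lambda>x. if b \<le> x then [] else \<sigma>' x)(d := bits (F e) @ \<sigma>' d) = \<sigma>(d := bits (F e) @ \<sigma> d)"
      using fr \<sigma>(1) r(3) by (auto simp: fun_eq_iff)
    ultimately have ro: "runs (read_out d) \<sigma>' (16 * (L e + 1) * (L e + 1) + (2 * nt + 4) * (4 * L e + 2) + 40)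
      (\<sigma>(d := bits (F e) @ \<sigma> d))" by (simp only:)
    show ?thesis by (rule runs_Seq[OF R1 ro])
  qed
  moreover have "wf_prog (Ag + 2 * ns + states M + b + 2 * nt + 6) ?P"
  proof -
    let ?A = "Ag + 2 * ns + states M + b + 2 * nt + 6"
    have "wf_prog ?A main_loop" by (rule wf_main_loop) auto
    moreover have "wf_prog ?A (read_out d)" by (rule wf_read_out) (use r in auto)
    moreover have "wf_prog ?A Pg" using Pg(1) by (rule wf_prog_mono) simp
    moreover have "Rt 1 < ?A" using ns(2) by (simp add: Rt_def)
    ultimately show ?thesis using ns(1) by simp
  qed
  moreover have "pbd m ?T"
  proof -
    have "pbd m ?t" by (intro pbd_FN FN_poly FN_length g)
    then have "pbd m L" unfolding L_def by (intro pbd_intros Pg)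
    then show ?thesis by (intro pbd_intros)
  qed
  ultimately show "\<exists>P A T. computes m rs d b F A P T"
    unfolding computes_def by blast
qed

lemma P_class_iff_FP: "L \<in> P_class \<longleftrightarrow> FP 1 (\<lambda>e. [ev 0 e \<in> L])"
proof
  assume "L \<in> P_class"
  then obtain M p where M: "is_tm M" "\<And>x. outputs_within M (poly p (length x)) x [x \<in> L]"
    unfolding P_class_def by blast
  show "FP 1 (\<lambda>e. [ev 0 e \<in> L])" by (rule FP_turing_machine[OF M(1) FP_ev]) (rule M(2))
qed (rule FP_imp_P_class)


section \<open>Constraint satisfaction as a trip network\<close>

lemma temporal_path_invariant:
  assumes path: "temporal_path F u fs v"
    and start: "\<And>\<theta>. Inv u \<theta>"
    and step: "\<And>f \<theta>. f \<in># F \<Longrightarrow> Inv (t_tail f) \<theta> \<Longrightarrow> \<theta> \<le> t_start f \<Longrightarrow> Inv (t_head f) (t_arrival f)"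
  shows "Inv v (t_arrival (last fs))"
  using path
proof (induction fs arbitrary: v rule: rev_induct)
  case Nil
  then show ?case by (simp add: temporal_path_def)
next
  case (snoc f gs)
  have f: "f \<in># F" "t_head f = v" using snoc.prems by (auto simp: temporal_path_def)
  show ?case
  proof (cases "gs = []")
    case True
    then have "t_tail f = u" using snoc.prems by (simp add: temporal_path_def)
    then show ?thesis using step[OF f(1)] start f(2) True by auto
  next
    case False
    then have "temporal_path F u gs (t_head (last gs))" "t_head (last gs) = t_tail f" "t_arrival (last gs) \<le> t_start f"
      using snoc.prems by (auto simp: temporal_path_def successively_append_iff)
    then show ?thesis using snoc.IH[of "t_tail f"] step[OF f(1)] f(2) by auto
  qed
qed

text \<open>An upper bound on the arrival time instead of the exact time, so that waiting at a node
  needs no treatment.\<close>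

definition reach_at :: "'v temporal_edge multiset \<Rightarrow> 'v \<Rightarrow> 'v \<Rightarrow> real \<Rightarrow> bool" where
  "reach_at F u v \<theta> \<longleftrightarrow> (\<exists>fs. temporal_path F u fs v \<and> t_arrival (last fs) \<le> \<theta>)"

lemma reach_at_single: "(u, v, s, d) \<in># F \<Longrightarrow> reach_at F u v (s + d)"
  unfolding reach_at_def
  by (intro exI[of _ "[(u, v, s, d)]"])
    (simp add: temporal_path_def t_tail_def t_head_def t_arrival_def t_start_def t_travel_def)

lemma reach_at_step:
  assumes "reach_at F u v \<theta>" "(v, w, s, d) \<in># F" "\<theta> \<le> s"
  shows "reach_at F u w (s + d)"
proof -
  obtain fs where "temporal_path F u fs v" "t_arrival (last fs) \<le> \<theta>"
    using assms(1) unfolding reach_at_def by blast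
  then show ?thesis unfolding reach_at_def using assms(2,3)
    by (intro exI[of _ "fs @ [(v, w, s, d)]"])
      (auto simp: temporal_path_def successively_append_iff t_tail_def t_head_def t_arrival_def t_start_def t_travel_def)
qed

definition unit_edge :: "nat \<times> nat \<Rightarrow> rat_edge" where
  "unit_edge = (\<lambda>(u, v). (u, v, 1))"

text \<open>An instance has \<open>nv\<close> variables with values below \<open>D\<close>; the literal \<open>v * D + a\<close> says that
  \<open>v\<close> has the value \<open>a\<close>. The clause \<open>j < m\<close> consists of the slots \<open>3 j, 3 j + 1, 3 j + 2\<close> of \<open>CL\<close>
  and forbids that its three literals hold together. A path from node \<open>0\<close> first chooses a value
  for each variable: choosing the literal \<open>l\<close> means to walk through the nodes
  \<open>nX l 0, \<dots>, nX l (3 m)\<close>, for which the last edge of the trip of each slot holding \<open>l\<close> is needed.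
  After that, the first edge of this trip, which crosses the clause of the slot, is gone.\<close>

locale csp_net =
  fixes D nv m K :: nat and CL :: "nat list"
  assumes D: "0 < D" and len: "length CL = 3 * m" and lits: "\<And>l. l \<in> set CL \<Longrightarrow> l < nv * D"
begin

text \<open>Order of the nodes: 0 to \<open>nv\<close> lie between the variables, the next
  \<open>m + 1\<close> between the clauses; then follow a chain of \<open>3 * m + 1\<close> nodes
  for each literal, the \<open>K\<close> sources from \<open>N0\<close> on, and the \<open>K\<close>
  sinks.\<close>

definition nC :: "nat \<Rightarrow> nat" where "nC j = nv + 1 + j"
definition nX :: "nat \<Rightarrow> nat \<Rightarrow> nat" where "nX l s = nv + m + 2 + l * (3 * m + 1) + s"
definition N0 :: nat where "N0 = nv + m + 2 + nv * D * (3 * m + 1)"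
definition N :: nat where "N = N0 + 2 * K"

text \<open>The middle edge just joins the clause to the chain. It cannot be exploited: a path
  taking it has passed the bridge already and can never use the bridge again.\<close>

definition slot_trip :: "nat \<Rightarrow> (nat \<times> nat) list" where
  "slot_trip s = [(nC (s div 3), nC (s div 3 + 1)), (nC (s div 3 + 1), nX (CL ! s) s),
     (nX (CL ! s) s, nX (CL ! s) (s + 1))]"

text \<open>All these trips have one edge, so their times can be set independently. A dummy edge
  replaces the chain edge of a slot that does not hold the literal, and the loops make it immediate
  that every node lies on a trip.\<close>

definition rest :: "(nat \<times> nat) list list" where
  "rest = concat (map (\<lambda>v. concat (map (\<lambda>a. [[(v, nX (v * D + a) 0)], [(nX (v * D + a) (3 * m), v + 1)]]) [0..<D])) [0..<nv])
   @ concat (map (\<lambda>l. concat (map (\<lambda>s. if CL ! s = l then [] else [[(nX l s, nX l (s + 1))]]) [0..<3 * m])) [0..<nv * D])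
   @ concat (map (\<lambda>i. [[(N0 + i, 0)], [(nC m, N0 + K + i)]]) [0..<K])
   @ concat (map (\<lambda>v. [[(v, v)]]) [0..<N])"

definition Ts :: "(nat \<times> nat) list list" where
  "Ts = [[(nv, nC 0)]] @ concat (map (\<lambda>s. [slot_trip s]) [0..<3 * m]) @ rest"

definition inst :: mrtt_input where
  "inst = (N, map unit_edge (concat Ts), map (map unit_edge) Ts)"

abbreviation "net \<equiv> network_of inst"

lemma concat_map_single: "concat (map (\<lambda>x. [f x]) xs) = map f xs"
  by (induction xs) auto

lemma rest_cases:
  assumes "T \<in> set rest"
  obtains (enter) v a where "v < nv" "a < D" "T = [(v, nX (v * D + a) 0)]"
  | (leave) v a where "v < nv" "a < D" "T = [(nX (v * D + a) (3 * m), v + 1)]"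
  | (dummy) l s where "l < nv * D" "s < 3 * m" "CL ! s \<noteq> l" "T = [(nX l s, nX l (s + 1))]"
  | (source) i where "i < K" "T = [(N0 + i, 0)]"
  | (sink) i where "i < K" "T = [(nC m, N0 + K + i)]"
  | (loop) v where "v < N" "T = [(v, v)]"
  using assms unfolding rest_def by (auto split: if_splits)

lemma rest_intros:
  "v < nv \<Longrightarrow> a < D \<Longrightarrow> [(v, nX (v * D + a) 0)] \<in> set rest"
  "v < nv \<Longrightarrow> a < D \<Longrightarrow> [(nX (v * D + a) (3 * m), v + 1)] \<in> set rest"
  "l < nv * D \<Longrightarrow> s < 3 * m \<Longrightarrow> CL ! s \<noteq> l \<Longrightarrow> [(nX l s, nX l (s + 1))] \<in> set rest"
  "i < K \<Longrightarrow> [(N0 + i, 0)] \<in> set rest"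
  "i < K \<Longrightarrow> [(nC m, N0 + K + i)] \<in> set rest"
  "v < N \<Longrightarrow> [(v, v)] \<in> set rest"
proof -
  show "l < nv * D \<Longrightarrow> s < 3 * m \<Longrightarrow> CL ! s \<noteq> l \<Longrightarrow> [(nX l s, nX l (s + 1))] \<in> set rest"
    unfolding rest_def set_append set_concat set_map set_upt
    by (rule UnI2, rule UnI1, simp, rule bexI[of _ l], rule bexI[of _ s]) auto
  show "v < nv \<Longrightarrow> a < D \<Longrightarrow> [(v, nX (v * D + a) 0)] \<in> set rest"
    unfolding rest_def set_append set_concat set_map set_upt
    by (rule UnI1, simp, rule bexI[of _ v], rule bexI[of _ a]) simp_all
  show "v < nv \<Longrightarrow> a < D \<Longrightarrow> [(nX (v * D + a) (3 * m), v + 1)] \<in> set rest"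
    unfolding rest_def set_append set_concat set_map set_upt
    by (rule UnI1, simp, rule bexI[of _ v], rule bexI[of _ a]) simp_all
qed (unfold rest_def, auto)

lemma Ts_nth: "Ts ! 0 = [(nv, nC 0)]" "s < 3 * m \<Longrightarrow> Ts ! Suc s = slot_trip s"
  by (auto simp: Ts_def concat_map_single nth_append)

lemma length_Ts: "length Ts = 1 + 3 * m + length rest"
  by (simp add: Ts_def concat_map_single)

lemma Ts_cases:
  assumes "i < length Ts"
  obtains (bridge) "i = 0" | (slot) s where "s < 3 * m" "i = Suc s" | (rest) "Ts ! i \<in> set rest"
proof -
  consider "i = 0" | "0 < i" "i \<le> 3 * m" | "3 * m < i" by linarith
  then show thesis
  proof cases
    case 2 then show thesis using slot[of "i - 1"] by simp
  next
    case 3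
    have "Ts ! i = rest ! (i - 1 - 3 * m)" using 3 assms
      by (auto simp: Ts_def concat_map_single nth_append nth_Cons')
    moreover have "i - 1 - 3 * m < length rest" using 3 assms by (simp add: length_Ts)
    ultimately show thesis using rest by simp
  qed (use bridge in auto)
qed

lemma set_Ts: "set Ts = {[(nv, nC 0)]} \<union> slot_trip ` {..<3 * m} \<union> set rest"
  by (auto simp: Ts_def concat_map_single)

lemma temporal_edge_iff:
  "f \<in># temporal_edges net \<tau> \<longleftrightarrow> (\<exists>i<length Ts. \<exists>k<length (Ts ! i).
     f = (fst (Ts ! i ! k), snd (Ts ! i ! k), \<tau> i + real k, 1))"
proof -
  have tr: "trips net = map (map (\<lambda>(u, v). (u, v, 1))) Ts"
    by (auto simp: network_of_def inst_def unit_edge_def real_edge_def o_def split_def)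
  have i: "set (induced_edges s (map (\<lambda>(u, v). (u, v, 1)) T)) =
      {(fst (T ! k), snd (T ! k), s + real k, 1) | k. k < length T}" for s and T :: "(nat \<times> nat) list"
  proof -
    have w: "(\<Sum>j<k. weight (map (\<lambda>(u, v). (u, v, 1)) T ! j)) = real k" if "k < length T" for k
    proof -
      have "(\<Sum>j<k. weight (map (\<lambda>(u, v). (u, v, 1)) T ! j)) = (\<Sum>j<k. 1)"
        using that by (intro sum.cong) (auto simp: weight_def split_def)
      then show ?thesis by simp
    qed
    have "set (induced_edges s (map (\<lambda>(u, v). (u, v, 1)) T)) =
      (\<lambda>k. (fst (T ! k), snd (T ! k), s + real k, 1)) ` {0..<length T}"
      unfolding induced_edges_def set_map set_upt length_map
      by (intro image_cong refl) (use w in \<open>auto simp: tail_def head_def weight_def split_def\<close>)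
    then show ?thesis by auto
  qed
  have "set_mset (temporal_edges net \<tau>) = (\<Union>i<length Ts. set (induced_edges (\<tau> i) (map (\<lambda>(u, v). (u, v, 1)) (Ts ! i))))"
    unfolding temporal_edges_def tr by (auto simp: set_mset_sum)
  then show ?thesis unfolding i by auto
qed

lemma temporal_edge_in:
  assumes "T \<in> set Ts" "k < length T"
  shows "(fst (T ! k), snd (T ! k), \<theta> T + real k, 1) \<in># temporal_edges net (\<lambda>i. \<theta> (Ts ! i))"
proof -
  obtain i where "i < length Ts" "T = Ts ! i" using assms(1) by (metis in_set_conv_nth)
  then show ?thesis unfolding temporal_edge_iff using assms(2) by (intro exI[of _ i]) auto
qed

lemma nX_le: "l < nv * D \<Longrightarrow> s \<le> 3 * m \<Longrightarrow> nv + m + 2 \<le> nX l s \<and> nX l s < N0"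
proof -
  assume l: "l < nv * D" "s \<le> 3 * m"
  have "l * (3 * m + 1) + s < Suc l * (3 * m + 1)" using l(2) by simp
  also have "\<dots> \<le> nv * D * (3 * m + 1)" using l(1) by (intro mult_right_mono) auto
  finally show ?thesis by (simp add: nX_def N0_def)
qed

lemma nX_decode: assumes "s \<le> 3 * m"
  shows "(nX l s - (nv + m + 2)) div (3 * m + 1) = l" "(nX l s - (nv + m + 2)) mod (3 * m + 1) = s"
proof -
  have dm: "s < q \<Longrightarrow> (l * q + s) div q = l \<and> (l * q + s) mod q = s" for q by simp
  have e: "nX l s - (nv + m + 2) = l * (3 * m + 1) + s" by (simp add: nX_def)
  show "(nX l s - (nv + m + 2)) div (3 * m + 1) = l" "(nX l s - (nv + m + 2)) mod (3 * m + 1) = s"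
    unfolding e using dm[of "3 * m + 1"] assms by linarith+
qed

lemma nX_inj: "s \<le> 3 * m \<Longrightarrow> s' \<le> 3 * m \<Longrightarrow> nX l s = nX l' s' \<Longrightarrow> l = l' \<and> s = s'"
  using nX_decode by metis

lemma nC_le: "j \<le> m \<Longrightarrow> nv < nC j \<and> nC j < nv + m + 2"
  by (simp add: nC_def)

lemma N0_gt: "nv + m + 2 \<le> N0" by (simp add: N0_def)

lemma slot_bounds: assumes "s < 3 * m" shows "CL ! s < nv * D" "s div 3 < m" "3 * (s div 3) + s mod 3 = s"
proof -
  show "CL ! s < nv * D" using assms len lits by simp
  show "s div 3 < m" using assms by (simp add: less_mult_imp_div_less mult.commute)
qed simp

lemma lit_less: "v < nv \<Longrightarrow> a < D \<Longrightarrow> v * D + a < nv * D"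
proof -
  assume "v < nv" "a < D"
  then have "v * D + a < Suc v * D" by simp
  also have "\<dots> \<le> nv * D" using \<open>v < nv\<close> by (intro mult_right_mono) auto
  finally show ?thesis .
qed

lemma Ts_bounds: "T \<in> set Ts \<Longrightarrow> e \<in> set T \<Longrightarrow> fst e < N \<and> snd e < N"
proof -
  assume T: "T \<in> set Ts" "e \<in> set T"
  consider "T = [(nv, nC 0)]" | s where "s < 3 * m" "T = slot_trip s" | "T \<in> set rest"
    using T(1) unfolding set_Ts by auto
  then show ?thesis
  proof cases
    case 1 then show ?thesis using T(2) N0_gt by (auto simp: N_def nC_def)
  next
    case 2
    note b = slot_bounds[OF 2(1)]
    have "nX (CL ! s) s < N0" "nX (CL ! s) (s + 1) < N0"
      using nX_le[OF b(1), of s] nX_le[OF b(1), of "s + 1"] 2(1) by auto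
    moreover have "nC (s div 3) < N0" "nC (s div 3 + 1) < N0" using b(2) N0_gt by (auto simp: nC_def)
    ultimately show ?thesis using T(2) 2(2) by (auto simp: slot_trip_def N_def)
  next
    case 3
    then show ?thesis
    proof (cases rule: rest_cases)
      case (enter v a)
      then show ?thesis using T(2) nX_le[OF lit_less, of v a 0] N0_gt by (auto simp: N_def)
    next
      case (leave v a)
      then show ?thesis using T(2) nX_le[OF lit_less, of v a "3 * m"] N0_gt by (auto simp: N_def)
    next
      case (dummy l s)
      then show ?thesis using T(2) nX_le[of l s] nX_le[of l "s + 1"] by (auto simp: N_def)
    next
      case (source i)
      then show ?thesis using T(2) N0_gt by (auto simp: N_def)
    next
      case (sink i)
      then show ?thesis using T(2) N0_gt by (auto simp: N_def nC_def)
    qed (use T(2) in auto)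
  qed
qed

lemma net_simps: "nodes net = {..<N}" "edges net = mset (concat (map (map (real_edge \<circ> unit_edge)) Ts))"
  "trips net = map (map (real_edge \<circ> unit_edge)) Ts"
  by (simp_all add: network_of_def inst_def map_concat o_def flip: mset_map)

lemma unit_edge_simps: "tail (real_edge (unit_edge e)) = fst e" "head (real_edge (unit_edge e)) = snd e"
  "weight (real_edge (unit_edge e)) = 1"
  by (auto simp: real_edge_def unit_edge_def tail_def head_def weight_def split_def)

lemma Ts_walk: "T \<in> set Ts \<Longrightarrow> T \<noteq> [] \<and> successively (\<lambda>e e'. snd e = fst e') T"
  unfolding set_Ts by (auto simp: slot_trip_def elim: rest_cases)

lemma is_trip_network_net: "is_trip_network net"
  unfolding is_trip_network_def
proof (intro conjI ballI)
  show "finite (nodes net)" by (simp add: net_simps)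
next
  fix e assume "e \<in># edges net"
  then obtain T e' where "T \<in> set Ts" "e' \<in> set T" "e = real_edge (unit_edge e')" by (auto simp: net_simps)
  then show "tail e \<in> nodes net" "head e \<in> nodes net" "0 < weight e" "\<exists>T\<in>set (trips net). e \<in> set T"
    using Ts_bounds by (auto simp: net_simps unit_edge_simps)
next
  fix T assume "T \<in> set (trips net)"
  then obtain T' where T': "T' \<in> set Ts" "T = map (real_edge \<circ> unit_edge) T'" by (auto simp: net_simps)
  then show "walk (edges net) T" using Ts_walk[OF T'(1)]
    by (auto simp: walk_def net_simps successively_map unit_edge_simps)
next
  fix v assume "v \<in> nodes net"
  then have "[(v, v)] \<in> set Ts" using rest_intros(6) by (auto simp: net_simps set_Ts)
  then show "\<exists>T\<in>set (trips net). \<exists>e\<in>set T. v = tail e \<or> v = head e"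
    unfolding net_simps set_map
    by (intro bexI[OF _ imageI[of "[(v, v)]"]]) (auto simp: unit_edge_simps)
qed

section \<open>What an arbitrary temporalisation must satisfy\<close>

context
  fixes \<tau> :: "nat \<Rightarrow> real"
begin

text \<open>The last edge of the trip with index \<open>Suc s\<close> arrives 3 units after its
  start. Whoever has walked through the chain of \<open>l\<close> by time \<theta> has used all
  these edges.\<close>

definition killed :: "nat \<Rightarrow> real \<Rightarrow> bool" where
  "killed l \<theta> \<longleftrightarrow> (\<forall>s<3 * m. CL ! s = l \<longrightarrow> \<tau> (Suc s) + 3 \<le> \<theta>)"

definition chosen_upto :: "nat \<Rightarrow> real \<Rightarrow> bool" where
  "chosen_upto v \<theta> \<longleftrightarrow> (\<exists>f. \<forall>v'<v. f v' < D \<and> killed (v' * D + f v') \<theta>)"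

text \<open>The bridge arrives at \<open>\<tau> 0 + 1\<close>; each of the first \<open>j\<close>
  clauses must have a slot whose first edge departs no earlier than that.\<close>

definition late :: "nat \<Rightarrow> bool" where
  "late j \<longleftrightarrow> (\<forall>j'<j. \<exists>p<3. \<tau> 0 + 1 \<le> \<tau> (Suc (3 * j' + p)))"

text \<open>Nothing is claimed about a path that is too late for the bridge. This weakening is what
  admits paths that return from the clauses to the chains.\<close>

definition PV :: "nat \<Rightarrow> real \<Rightarrow> bool" where
  "PV v \<theta> \<longleftrightarrow> \<tau> 0 + 1 \<le> \<theta> \<or> chosen_upto v \<theta>"

definition PX :: "nat \<Rightarrow> nat \<Rightarrow> real \<Rightarrow> bool" where
  "PX l s \<theta> \<longleftrightarrow> \<tau> 0 + 1 \<le> \<theta> \<or>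
     (chosen_upto (l div D) \<theta> \<and> (\<forall>s'<s. CL ! s' = l \<longrightarrow> \<tau> (Suc s') + 3 \<le> \<theta>))"

text \<open>The choice is recorded at the departure of the bridge and no longer at the current time,
  because chains can also be walked after the bridge.\<close>

definition PC :: "nat \<Rightarrow> real \<Rightarrow> bool" where
  "PC j \<theta> \<longleftrightarrow> \<tau> 0 + 1 \<le> \<theta> \<and> chosen_upto nv (\<tau> 0) \<and> late j"

text \<open>Nothing is demanded at sources, where a path may start at any time; at sinks the demand
  is free of time and is the information sought.\<close>

definition Inv :: "nat \<Rightarrow> real \<Rightarrow> bool" where
  "Inv u \<theta> \<longleftrightarrow> (u \<le> nv \<longrightarrow> PV u \<theta>) \<and> (\<forall>j\<le>m. u = nC j \<longrightarrow> PC j \<theta>) \<and>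
     (\<forall>l<nv * D. \<forall>s\<le>3 * m. u = nX l s \<longrightarrow> PX l s \<theta>) \<and>
     (N0 + K \<le> u \<longrightarrow> chosen_upto nv (\<tau> 0) \<and> late m)"

lemma killed_mono: "killed l \<theta> \<Longrightarrow> \<theta> \<le> \<theta>' \<Longrightarrow> killed l \<theta>'"
  unfolding killed_def by force

lemma chosen_mono: "chosen_upto v \<theta> \<Longrightarrow> \<theta> \<le> \<theta>' \<Longrightarrow> chosen_upto v \<theta>'"
  unfolding chosen_upto_def using killed_mono by blast

lemma P_mono:
  assumes "\<theta> \<le> \<theta>'"
  shows "PV v \<theta> \<Longrightarrow> PV v \<theta>'" "PX l s \<theta> \<Longrightarrow> PX l s \<theta>'" "PC j \<theta> \<Longrightarrow> PC j \<theta>'"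
  unfolding PV_def PX_def PC_def using assms chosen_mono[OF _ assms] by (auto intro: order.trans)

lemma Inv_mono: "Inv u \<theta> \<Longrightarrow> \<theta> \<le> \<theta>' \<Longrightarrow> Inv u \<theta>'"
  unfolding Inv_def using P_mono by blast

lemma Inv_V: assumes "u \<le> nv" shows "Inv u \<theta> \<longleftrightarrow> PV u \<theta>"
proof -
  have "u \<noteq> nC j" "l < nv * D \<Longrightarrow> s \<le> 3 * m \<Longrightarrow> u \<noteq> nX l s" "\<not> N0 + K \<le> u" for j l s
    using assms nX_le[of l s] N0_gt by (auto simp: nC_def)
  then show ?thesis using assms unfolding Inv_def by blast
qed

lemma Inv_C: assumes "j \<le> m" shows "Inv (nC j) \<theta> \<longleftrightarrow> PC j \<theta>"
proof -
  have "l < nv * D \<Longrightarrow> s \<le> 3 * m \<Longrightarrow> nC j \<noteq> nX l s" "\<not> N0 + K \<le> nC j" "\<not> nC j \<le> nv"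
      "nC j = nC j' \<longleftrightarrow> j' = j" for j' l s
    using assms nX_le[of l s] N0_gt nC_le[OF assms] by (auto simp: nC_def)
  then show ?thesis using assms unfolding Inv_def by simp
qed

lemma Inv_X: assumes "l < nv * D" "s \<le> 3 * m" shows "Inv (nX l s) \<theta> \<longleftrightarrow> PX l s \<theta>"
proof -
  have "j \<le> m \<Longrightarrow> nX l s \<noteq> nC j" "\<not> N0 + K \<le> nX l s" "\<not> nX l s \<le> nv"
      "s' \<le> 3 * m \<Longrightarrow> nX l s = nX l' s' \<Longrightarrow> l' = l \<and> s' = s" for j l' s'
    using assms nX_le[of l s] nC_le[of j] nX_inj[of s s' l l'] by auto
  then show ?thesis using assms unfolding Inv_def by blast
qed

lemma Inv_outside: assumes "N0 \<le> u" shows "Inv u \<theta> \<longleftrightarrow> (N0 + K \<le> u \<longrightarrow> chosen_upto nv (\<tau> 0) \<and> late m)"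
proof -
  have "j \<le> m \<Longrightarrow> u \<noteq> nC j" "l < nv * D \<Longrightarrow> s \<le> 3 * m \<Longrightarrow> u \<noteq> nX l s" "\<not> u \<le> nv" for j l s
    using assms nX_le[of l s] nC_le[of j] N0_gt by auto
  then show ?thesis unfolding Inv_def by blast
qed

text \<open>The invariant may be weakened to the departure time, since waiting does no harm; then
  each kind of edge is checked by itself.\<close>

lemma Inv_step:
  assumes f: "f \<in># temporal_edges net \<tau>" and inv: "Inv (t_tail f) \<theta>" and le: "\<theta> \<le> t_start f"
  shows "Inv (t_head f) (t_arrival f)"
proof -
  obtain i k where ik: "i < length Ts" "k < length (Ts ! i)"
    "f = (fst (Ts ! i ! k), snd (Ts ! i ! k), \<tau> i + real k, 1)"
    using f unfolding temporal_edge_iff by blast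
  define u w \<theta>' where "u = fst (Ts ! i ! k)" and "w = snd (Ts ! i ! k)" and "\<theta>' = \<tau> i + real k + 1"
  have inv: "Inv u \<theta>" and le: "\<theta> \<le> \<theta>' - 1" and goal: "Inv (t_head f) (t_arrival f) \<longleftrightarrow> Inv w \<theta>'"
    using inv le by (simp_all add: ik(3) u_def w_def \<theta>'_def t_tail_def t_head_def t_start_def t_arrival_def t_travel_def)
  have inv': "Inv u (\<theta>' - 1)" using Inv_mono[OF inv le] .
  have "Inv w \<theta>'"
    using ik(1)
  proof (cases rule: Ts_cases)
    case bridge
    then have e: "u = nv" "w = nC 0" "\<theta>' = \<tau> 0 + 1" using ik(2) Ts_nth(1) by (auto simp: u_def w_def \<theta>'_def)
    \<comment> \<open>Departing at \<open>\<tau> 0\<close> excludes the first alternative of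
      \<open>PV\<close>.\<close>
    then have "chosen_upto nv (\<tau> 0)" using inv' by (auto simp: Inv_V PV_def)
    then show ?thesis unfolding e by (subst Inv_C) (auto simp: PC_def late_def)
  next
    case (slot s)
    note b = slot_bounds[OF slot(1)]
    have T: "Ts ! i = slot_trip s" using slot Ts_nth(2) by simp
    then have "k = 0 \<or> k = 1 \<or> k = 2" using ik(2) by (auto simp: slot_trip_def)
    then consider "u = nC (s div 3)" "w = nC (s div 3 + 1)" "\<theta>' = \<tau> (Suc s) + 1"
      | "u = nC (s div 3 + 1)" "w = nX (CL ! s) s" "\<theta>' = \<tau> (Suc s) + 2"
      | "u = nX (CL ! s) s" "w = nX (CL ! s) (s + 1)" "\<theta>' = \<tau> (Suc s) + 3"
      using T slot by (auto simp: u_def w_def \<theta>'_def slot_trip_def)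
    then show ?thesis
    proof cases
      case 1
      then have P: "PC (s div 3) (\<tau> (Suc s))" using inv' b(2) by (simp add: Inv_C)
      \<comment> \<open>The slot just used is the witness for the clause crossed: its trip starts
        after the arrival at the clause node, which is after the bridge.\<close>
      have "late (s div 3 + 1)"
        unfolding late_def
      proof (intro allI impI)
        fix j' assume "j' < s div 3 + 1"
        then consider "j' < s div 3" | "j' = s div 3" by linarith
        then show "\<exists>p<3. \<tau> 0 + 1 \<le> \<tau> (Suc (3 * j' + p))"
        proof cases
          case 2 then show ?thesis using P b(3) by (intro exI[of _ "s mod 3"]) (auto simp: PC_def)
        qed (use P in \<open>auto simp: PC_def late_def\<close>)
      qed
      then show ?thesis unfolding 1 using P b(2) by (subst Inv_C) (auto simp: PC_def)
    next
      case 2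
      then have "PC (s div 3 + 1) (\<theta>' - 1)" using inv' b(2) by (simp add: Inv_C)
      then show ?thesis unfolding 2(2) using b(1) slot(1) by (subst Inv_X) (auto simp: PC_def PX_def)
    next
      case 3
      then have "PX (CL ! s) s (\<theta>' - 1)" using inv' b(1) slot(1) by (simp add: Inv_X)
      then have "PX (CL ! s) (s + 1) \<theta>'"
        unfolding PX_def using 3(3) chosen_mono[of _ "\<theta>' - 1" \<theta>'] by (fastforce simp: less_Suc_eq)
      then show ?thesis unfolding 3(2) using b(1) slot(1) by (subst Inv_X) auto
    qed
  next
    case rest
    then show ?thesis
    proof (cases rule: rest_cases)
      case (enter v a)
      then have e: "u = v" "w = nX (v * D + a) 0" using ik(2) by (auto simp: u_def w_def)
      then have "PV v (\<theta>' - 1)" using inv' enter by (simp add: Inv_V)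
      moreover have "(v * D + a) div D = v" using enter by simp
      ultimately have "PX (v * D + a) 0 \<theta>'" unfolding PV_def PX_def
        using chosen_mono[of _ "\<theta>' - 1" \<theta>'] by auto
      then show ?thesis unfolding e(2) using lit_less[OF enter(1,2)] by (subst Inv_X) auto
    next
      case (leave v a)
      then have e: "u = nX (v * D + a) (3 * m)" "w = v + 1" using ik(2) by (auto simp: u_def w_def)
      then have X: "PX (v * D + a) (3 * m) (\<theta>' - 1)" using inv' lit_less[OF leave(1,2)] by (simp add: Inv_X)
      have dv: "(v * D + a) div D = v" using leave by simp
      have "PV (v + 1) \<theta>'"
      proof (cases "\<tau> 0 + 1 \<le> \<theta>' - 1")
        case False
        then have "chosen_upto v (\<theta>' - 1)" "killed (v * D + a) (\<theta>' - 1)"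
          using X dv by (auto simp: PX_def killed_def)
        then obtain f where f: "\<forall>v'<v. f v' < D \<and> killed (v' * D + f v') (\<theta>' - 1)"
          unfolding chosen_upto_def by blast
        have "chosen_upto (v + 1) (\<theta>' - 1)"
          unfolding chosen_upto_def using f \<open>killed (v * D + a) (\<theta>' - 1)\<close> leave(2)
          by (intro exI[of _ "f(v := a)"]) (auto simp: less_Suc_eq)
        then show ?thesis unfolding PV_def using chosen_mono[of _ "\<theta>' - 1" \<theta>'] by auto
      qed (simp add: PV_def)
      then show ?thesis unfolding e(2) using leave(1) by (subst Inv_V) auto
    next
      case (dummy l s)
      then have e: "u = nX l s" "w = nX l (s + 1)" using ik(2) by (auto simp: u_def w_def)
      then have "PX l s (\<theta>' - 1)" using inv' dummy by (simp add: Inv_X)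
      then have "PX l (s + 1) \<theta>'"
        unfolding PX_def using dummy(3) chosen_mono[of _ "\<theta>' - 1" \<theta>'] by (fastforce simp: less_Suc_eq)
      then show ?thesis unfolding e(2) using dummy by (subst Inv_X) auto
    next
      case (source i')
      then have e: "w = 0" using ik(2) by (auto simp: w_def)
      show ?thesis unfolding e by (subst Inv_V) (auto simp: PV_def chosen_upto_def)
    next
      case (sink i')
      then have e: "u = nC m" "w = N0 + K + i'" using ik(2) by (auto simp: u_def w_def)
      then have "PC m (\<theta>' - 1)" using inv' by (simp add: Inv_C)
      then show ?thesis unfolding e(2) by (subst Inv_outside) (auto simp: PC_def)
    next
      case (loop v)
      then have "u = w" using ik(2) by (auto simp: u_def w_def)
      then show ?thesis using Inv_mono[OF inv', of \<theta>'] by simp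
    qed
  qed
  then show ?thesis using goal by simp
qed

lemma source_reaches_sink:
  assumes "temporally_reachable (temporal_edges net \<tau>) u v" "N0 \<le> u" "u < N0 + K" "N0 + K \<le> v"
  shows "chosen_upto nv (\<tau> 0) \<and> late m"
proof -
  obtain fs where p: "temporal_path (temporal_edges net \<tau>) u fs v"
    using assms unfolding temporally_reachable_def by auto
  have "Inv u \<theta>" for \<theta>
    using assms(2,3) by (simp add: Inv_outside)
  then have "Inv v (t_arrival (last fs))" by (rule temporal_path_invariant[OF p]) (rule Inv_step)
  then show ?thesis using assms(4) by (simp add: Inv_outside)
qed

text \<open>A second invariant, without times: no edge leads into a source from elsewhere, and none
  leaves a sink for another node.\<close>

lemma static_step:
  assumes f: "f \<in># temporal_edges net \<tau>"
    and inv: "if N0 + K \<le> u then t_tail f = u else t_tail f = u \<or> t_tail f < N0 \<or> N0 + K \<le> t_tail f"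
    and u: "N0 \<le> u"
  shows "if N0 + K \<le> u then t_head f = u else t_head f = u \<or> t_head f < N0 \<or> N0 + K \<le> t_head f"
proof -
  obtain i k where ik: "i < length Ts" "k < length (Ts ! i)"
    "f = (fst (Ts ! i ! k), snd (Ts ! i ! k), \<tau> i + real k, 1)"
    using f unfolding temporal_edge_iff by blast
  define e where "e = Ts ! i ! k"
  have th: "t_tail f = fst e" "t_head f = snd e" by (simp_all add: ik(3) e_def t_tail_def t_head_def)
  have "(fst e < N0 \<and> (snd e < N0 \<or> N0 + K \<le> snd e)) \<or> (fst e < N0 + K \<and> snd e < N0) \<or> fst e = snd e"
    using ik(1)
  proof (cases rule: Ts_cases)
    case bridge
    then show ?thesis using ik(2) Ts_nth(1) N0_gt by (auto simp: e_def nC_def)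
  next
    case (slot s)
    note b = slot_bounds[OF slot(1)]
    have "nX (CL ! s) s < N0" "nX (CL ! s) (s + 1) < N0"
      using nX_le[OF b(1), of s] nX_le[OF b(1), of "s + 1"] slot(1) by auto
    moreover have "nC (s div 3) < N0" "nC (s div 3 + 1) < N0" using b(2) N0_gt by (auto simp: nC_def)
    moreover have "e \<in> set (slot_trip s)" unfolding e_def using ik(2) slot Ts_nth(2) by simp
    ultimately show ?thesis by (auto simp: slot_trip_def)
  next
    case rest
    then show ?thesis
    proof (cases rule: rest_cases)
      case (enter v a)
      then show ?thesis using ik(2) nX_le[OF lit_less, of v a 0] N0_gt by (auto simp: e_def)
    next
      case (leave v a)
      then show ?thesis using ik(2) nX_le[OF lit_less, of v a "3 * m"] N0_gt by (auto simp: e_def)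
    next
      case (dummy l s)
      then show ?thesis using ik(2) nX_le[of l s] nX_le[of l "s + 1"] by (auto simp: e_def)
    next
      case (source i)
      then show ?thesis using ik(2) N0_gt by (auto simp: e_def)
    next
      case (sink i)
      then show ?thesis using ik(2) N0_gt by (auto simp: e_def nC_def)
    qed (use ik(2) in \<open>auto simp: e_def\<close>)
  qed
  then show ?thesis using inv u unfolding th by (auto split: if_splits)
qed

lemma reach_from_outside:
  assumes r: "temporally_reachable (temporal_edges net \<tau>) u v" and u: "N0 \<le> u"
    and no: "\<not> (chosen_upto nv (\<tau> 0) \<and> late m)"
  shows "v = u \<or> v < N0"
proof (cases "u = v")
  case False
  then obtain fs where p: "temporal_path (temporal_edges net \<tau>) u fs v"
    using r unfolding temporally_reachable_def by auto
  let ?I = "\<lambda>w (\<theta>::real). if N0 + K \<le> u then w = u else w = u \<or> w < N0 \<or> N0 + K \<le> w"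
  have "?I v (t_arrival (last fs))"
    by (rule temporal_path_invariant[OF p, where Inv = ?I]) (use static_step u in auto)
  then show ?thesis using source_reaches_sink[OF r u] no by (auto split: if_splits)
qed simp

text \<open>Without a path from a source to a sink, each of the \<open>2 * K\<close> outer nodes
  reaches at most itself and the inner nodes; for the few inner nodes the trivial bound is
  enough.\<close>

lemma reachability_small:
  assumes no: "\<not> (chosen_upto nv (\<tau> 0) \<and> late m)"
  shows "temporal_reachability net \<tau> \<le> N0 * N + 2 * K * (N0 + 1)"
proof -
  let ?R = "\<lambda>u. {v \<in> nodes net. temporally_reachable (temporal_edges net \<tau>) u v}"
  have 1: "card (?R u) \<le> N" for u
    using card_mono[of "{..<N}" "?R u"] by (auto simp: net_simps)
  have 2: "card (?R u) \<le> N0 + 1" if "N0 \<le> u" for u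
  proof -
    have "?R u \<subseteq> insert u {..<N0}" using reach_from_outside[OF _ that no] by auto
    then have "card (?R u) \<le> card (insert u {..<N0})" by (intro card_mono) auto
    also have "\<dots> \<le> N0 + 1" using card_insert_le_m1[of "N0 + 1" "{..<N0}" u] by simp
    finally show ?thesis .
  qed
  have split: "{..<N} = {..<N0} \<union> {N0..<N}" by (auto simp: N_def)
  have "temporal_reachability net \<tau> = (\<Sum>u<N0. card (?R u)) + (\<Sum>u=N0..<N. card (?R u))"
    unfolding temporal_reachability_def net_simps(1) split by (rule sum.union_disjoint) auto
  also have "\<dots> \<le> (\<Sum>u<N0. N) + (\<Sum>u=N0..<N. N0 + 1)"
    by (intro add_mono sum_mono 1 2) auto
  also have "\<dots> = N0 * N + 2 * K * (N0 + 1)" by (simp add: N_def)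
  finally show ?thesis .
qed

lemma temporal_reachability_le: "temporal_reachability net \<tau> \<le> N * N"
proof -
  have "card {v \<in> nodes net. temporally_reachable (temporal_edges net \<tau>) u v} \<le> N" for u
    using card_mono[of "{..<N}" "{v \<in> nodes net. temporally_reachable (temporal_edges net \<tau>) u v}"]
    by (auto simp: net_simps)
  then show ?thesis
    unfolding temporal_reachability_def net_simps(1)
    using sum_bounded_above[of "{..<N}" _ N] by simp
qed

end

section \<open>Solutions of the constraints against temporalisations\<close>

definition chosen :: "(nat \<Rightarrow> nat) \<Rightarrow> nat \<Rightarrow> bool" where
  "chosen f l \<longleftrightarrow> f (l div D) = l mod D"

definition satisfies :: "(nat \<Rightarrow> nat) \<Rightarrow> bool" where
  "satisfies f \<longleftrightarrow> (\<forall>v<nv. f v < D) \<and> (\<forall>j<m. \<exists>p<3. \<not> chosen f (CL ! (3 * j + p)))"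

text \<open>If all literals of a clause were chosen, all three of its trips would start before the
  bridge, against \<open>late\<close>. The two facts on starting times are kept beside
  \<open>satisfies\<close>, because the certificate is decoded from times and not from
  \<open>f\<close>.\<close>

lemma solution_of_network:
  assumes "chosen_upto \<tau> nv (\<tau> 0) \<and> late \<tau> m"
  obtains f where "satisfies f"
    "\<And>s. s < 3 * m \<Longrightarrow> chosen f (CL ! s) \<Longrightarrow> \<tau> (Suc s) < \<tau> 0"
    "\<And>j. j < m \<Longrightarrow> \<exists>p<3. \<tau> 0 \<le> \<tau> (Suc (3 * j + p))"
proof -
  obtain f where f: "\<forall>v<nv. f v < D \<and> killed \<tau> (v * D + f v) (\<tau> 0)"
    using assms unfolding chosen_upto_def by blast
  have k: "\<tau> (Suc s) < \<tau> 0" if s: "s < 3 * m" "chosen f (CL ! s)" for s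
  proof -
    let ?l = "CL ! s"
    have "?l div D < nv" using slot_bounds(1)[OF s(1)] by (simp add: less_mult_imp_div_less)
    then have "killed \<tau> (?l div D * D + f (?l div D)) (\<tau> 0)" using f by blast
    then have "killed \<tau> ?l (\<tau> 0)" using s(2) by (simp add: chosen_def)
    then show ?thesis using s(1) unfolding killed_def by fastforce
  qed
  have l: "\<exists>p<3. \<tau> 0 \<le> \<tau> (Suc (3 * j + p))" if j: "j < m" for j
  proof -
    obtain p where "p < 3" "\<tau> 0 + 1 \<le> \<tau> (Suc (3 * j + p))" using assms j unfolding late_def by blast
    then show ?thesis by (intro exI[of _ p]) auto
  qed
  have "satisfies f" unfolding satisfies_def
  proof (intro conjI allI impI)
    fix j assume j: "j < m"
    obtain p where p: "p < 3" "\<tau> 0 \<le> \<tau> (Suc (3 * j + p))" using l[OF j] by blast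
    have "3 * j + p < 3 * m" using j p(1) by linarith
    then show "\<exists>p<3. \<not> chosen f (CL ! (3 * j + p))" using k[of "3 * j + p"] p by force
  qed (use f in blast)
  then show thesis using that k l by blast
qed

text \<open>The time at which the intended path stands on a node. A variable takes
  \<open>3 * m + 2\<close> units: one edge into the chain, \<open>3 * m\<close> edges along it and
  one out of it.\<close>

definition time_at :: "nat \<Rightarrow> real" where
  "time_at u = (if u \<le> nv then real (u * (3 * m + 2))
     else if u < nv + m + 2 then real (nv * (3 * m + 2) + 1 + (u - (nv + 1)))
     else if u < N0 then real ((u - (nv + m + 2)) div (3 * m + 1) div D * (3 * m + 2) + 1 + (u - (nv + m + 2)) mod (3 * m + 1))
     else -1)"

text \<open>Slot trips are the ones with three edges. If the literal is chosen, the third edge has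
  to depart on time, two units after the start; otherwise the first one has to.\<close>

definition start_time :: "(nat \<Rightarrow> nat) \<Rightarrow> (nat \<times> nat) list \<Rightarrow> real" where
  "start_time f T = (if length T = 3 \<and> chosen f ((fst (last T) - (nv + m + 2)) div (3 * m + 1))
     then time_at (fst (last T)) - 2 else time_at (fst (hd T)))"

lemma time_at:
  "v \<le> nv \<Longrightarrow> time_at v = real (v * (3 * m + 2))"
  "j \<le> m \<Longrightarrow> time_at (nC j) = real (nv * (3 * m + 2) + 1 + j)"
  "l < nv * D \<Longrightarrow> s \<le> 3 * m \<Longrightarrow> time_at (nX l s) = real (l div D * (3 * m + 2) + 1 + s)"
  "N0 \<le> u \<Longrightarrow> time_at u = -1"
proof -
  show "v \<le> nv \<Longrightarrow> time_at v = real (v * (3 * m + 2))" by (simp add: time_at_def)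
  show "j \<le> m \<Longrightarrow> time_at (nC j) = real (nv * (3 * m + 2) + 1 + j)" by (simp add: time_at_def nC_def)
  show "N0 \<le> u \<Longrightarrow> time_at u = -1" using N0_gt by (simp add: time_at_def)
  assume l: "l < nv * D" "s \<le> 3 * m"
  then have b: "\<not> nX l s \<le> nv" "\<not> nX l s < nv + m + 2" "nX l s < N0" using nX_le[of l s] by auto
  show "time_at (nX l s) = real (l div D * (3 * m + 2) + 1 + s)"
    unfolding time_at_def nX_decode[OF l(2)] using b by simp
qed

text \<open>The path never waits: it departs from every node exactly at \<open>time_at\<close>. A
  clause is crossed with a slot that is not chosen, whose trip is scheduled for its first
  edge.\<close>

lemma solution_reaches:
  assumes sat: "satisfies f" and i: "i < K" "i' < K"
  shows "temporally_reachable (temporal_edges net (\<lambda>i. start_time f (Ts ! i))) (N0 + i) (N0 + K + i')"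
proof -
  let ?F = "temporal_edges net (\<lambda>i. start_time f (Ts ! i))"
  let ?u = "N0 + i"
  have single: "(x, y, time_at x, 1) \<in># ?F" if "[(x, y)] \<in> set Ts" for x y
    using temporal_edge_in[OF that, of 0 "start_time f"] by (simp add: start_time_def)
  have rest: "(x, y, time_at x, 1) \<in># ?F" if "[(x, y)] \<in> set rest" for x y
    using that by (intro single) (simp add: set_Ts)
  have slotT: "slot_trip s \<in> set Ts" if "s < 3 * m" for s using that by (auto simp: set_Ts)
  have st: "start_time f (slot_trip s) = (if chosen f (CL ! s) then time_at (nX (CL ! s) s) - 2 else time_at (nC (s div 3)))"
    if "s < 3 * m" for s
    using that nX_decode(1)[of s "CL ! s"] by (simp add: start_time_def slot_trip_def)
  have r0: "reach_at ?F ?u 0 0"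
    using reach_at_single[OF rest[OF rest_intros(4)[OF i(1)]]] time_at(4)[of ?u] by simp
  have rV: "v \<le> nv \<Longrightarrow> reach_at ?F ?u v (time_at v)" for v
  proof (induction v)
    case 0 then show ?case using r0 time_at(1)[of 0] by simp
  next
    case (Suc v)
    have v: "v < nv" "f v < D" using Suc.prems sat by (auto simp: satisfies_def)
    define l where "l = v * D + f v"
    have l: "l < nv * D" "l div D = v" "chosen f l" using lit_less[OF v] v(2) by (auto simp: l_def chosen_def)
    have "s \<le> 3 * m \<Longrightarrow> reach_at ?F ?u (nX l s) (time_at (nX l s))" for s
    proof (induction s)
      case 0
      have "(v, nX l 0, time_at v, 1) \<in># ?F" using rest[OF rest_intros(1)[OF v]] by (simp add: l_def)
      from reach_at_step[OF Suc.IH this] v have "reach_at ?F ?u (nX l 0) (time_at v + 1)" by simp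
      moreover have "time_at v + 1 = time_at (nX l 0)" using v l by (simp add: time_at)
      ultimately show ?case by simp
    next
      case (Suc s)
      have "(nX l s, nX l (s + 1), time_at (nX l s), 1) \<in># ?F"
      proof (cases "CL ! s = l")
        case True
        have "s < 3 * m" using Suc.prems by simp
        from temporal_edge_in[OF slotT[OF this], of 2 "start_time f"] st[OF this] True l(3)
        show ?thesis by (simp add: slot_trip_def)
      next
        case False
        then show ?thesis using Suc.prems l(1) by (intro rest rest_intros) auto
      qed
      from reach_at_step[OF Suc.IH this] Suc.prems
      have "reach_at ?F ?u (nX l (s + 1)) (time_at (nX l s) + 1)" by simp
      moreover have "time_at (nX l s) + 1 = time_at (nX l (s + 1))" using l Suc.prems by (simp add: time_at)
      ultimately show ?case by simp
    qed
    then have "reach_at ?F ?u (nX l (3 * m)) (time_at (nX l (3 * m)))" by simp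
    moreover have "(nX l (3 * m), v + 1, time_at (nX l (3 * m)), 1) \<in># ?F"
      using rest[OF rest_intros(2)[OF v]] by (simp add: l_def)
    ultimately have "reach_at ?F ?u (v + 1) (time_at (nX l (3 * m)) + 1)" by (rule reach_at_step) simp
    moreover have "time_at (nX l (3 * m)) + 1 = time_at (v + 1)" using l v by (simp add: time_at algebra_simps)
    ultimately show ?case by simp
  qed
  have rC: "j \<le> m \<Longrightarrow> reach_at ?F ?u (nC j) (time_at (nC j))" for j
  proof (induction j)
    case 0
    have "(nv, nC 0, time_at nv, 1) \<in># ?F" by (rule single) (simp add: set_Ts)
    from reach_at_step[OF rV this] have "reach_at ?F ?u (nC 0) (time_at nv + 1)" by simp
    then show ?case by (simp add: time_at algebra_simps)
  next
    case (Suc j)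
    then obtain p where p: "p < 3" "\<not> chosen f (CL ! (3 * j + p))" using sat unfolding satisfies_def by (meson Suc_le_lessD)
    let ?s = "3 * j + p"
    have s: "?s < 3 * m" "?s div 3 = j" using Suc.prems p(1) by auto
    have "(nC j, nC (j + 1), time_at (nC j), 1) \<in># ?F"
      using temporal_edge_in[OF slotT[OF s(1)], of 0 "start_time f"] st[OF s(1)] p(2) s(2)
      by (simp add: slot_trip_def)
    from reach_at_step[OF Suc.IH this] Suc.prems
    have "reach_at ?F ?u (nC (j + 1)) (time_at (nC j) + 1)" by simp
    moreover have "time_at (nC j) + 1 = time_at (nC (j + 1))" using Suc.prems by (simp add: time_at)
    ultimately show ?case by simp
  qed
  have "reach_at ?F ?u (N0 + K + i') (time_at (nC m) + 1)"
    using reach_at_step[OF rC rest[OF rest_intros(5)[OF i(2)]]] by simp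
  then show ?thesis unfolding temporally_reachable_def reach_at_def by blast
qed

lemma max_reachability_large:
  assumes "satisfies f" shows "K * K \<le> max_reachability net"
proof -
  let ?\<tau> = "\<lambda>i. start_time f (Ts ! i)"
  let ?R = "\<lambda>u. {v \<in> nodes net. temporally_reachable (temporal_edges net ?\<tau>) u v}"
  have "K \<le> card (?R u)" if u: "u \<in> {N0..<N0 + K}" for u
  proof -
    have "(\<lambda>i. N0 + K + i) ` {..<K} \<subseteq> ?R u"
    proof
      fix v assume "v \<in> (\<lambda>i. N0 + K + i) ` {..<K}"
      then obtain i' where "i' < K" "v = N0 + K + i'" by auto
      then show "v \<in> ?R u" using solution_reaches[OF assms, of "u - N0" i'] u by (auto simp: net_simps N_def)
    qed
    moreover have "finite (?R u)" by (simp add: net_simps)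
    ultimately have "card ((\<lambda>i. N0 + K + i) ` {..<K}) \<le> card (?R u)" by (rule card_mono[rotated])
    then show ?thesis by (simp add: card_image)
  qed
  then have "(\<Sum>u=N0..<N0 + K. K) \<le> (\<Sum>u=N0..<N0 + K. card (?R u))" by (rule sum_mono)
  also have "\<dots> \<le> temporal_reachability net ?\<tau>"
    unfolding temporal_reachability_def by (rule sum_mono2) (auto simp: net_simps N_def)
  also have "\<dots> \<le> max_reachability net"
    unfolding max_reachability_def
  proof (rule Max_ge)
    \<comment> \<open>There are infinitely many temporalisations, but only finitely many values, so
      \<open>Max\<close> is meaningful.\<close>
    have "range (temporal_reachability net) \<subseteq> {..N * N}" using temporal_reachability_le by auto
    then show "finite (range (temporal_reachability net))" by (rule finite_subset) simp
  qed simp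
  finally show ?thesis by simp
qed

end


section \<open>Runs of a stack machine as a constraint satisfaction problem\<close>

definition flat :: "(nat \<times> nat \<times> nat) list \<Rightarrow> nat list" where
  "flat cs = concat (map (\<lambda>(a, b, c). [a, b, c]) cs)"

lemma flat_simps [simp]: "flat [] = []" "flat ((a, b, c) # cs) = a # b # c # flat cs"
  "flat (cs @ ds) = flat cs @ flat ds" "length (flat cs) = 3 * length cs"
  by (induction cs) (auto simp: flat_def)

lemma flat_concat: "flat (concat css) = concat (map flat css)"
  by (induction css) auto

lemma flat_nth:
  "j < length cs \<Longrightarrow> cs ! j = (a, b, c) \<Longrightarrow>
    flat cs ! (3 * j) = a \<and> flat cs ! (3 * j + 1) = b \<and> flat cs ! (3 * j + 2) = c"
proof (induction cs arbitrary: j)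
  case (Cons d cs)
  obtain d1 d2 d3 where d: "d = (d1, d2, d3)" by (cases d) auto
  show ?case
  proof (cases j)
    case 0 then show ?thesis using Cons.prems d by (simp add: numeral_2_eq_2)
  next
    case (Suc i)
    have "flat (d # cs) = [d1, d2, d3] @ flat cs" by (simp add: d)
    moreover have "3 * j = 3 + 3 * i" "3 * j + 1 = 3 + (3 * i + 1)" "3 * j + 2 = 3 + (3 * i + 2)" using Suc by auto
    ultimately have "flat (d # cs) ! (3 * j) = flat cs ! (3 * i)" "flat (d # cs) ! (3 * j + 1) = flat cs ! (3 * i + 1)"
      "flat (d # cs) ! (3 * j + 2) = flat cs ! (3 * i + 2)"
      by (auto simp only: nth_append_right[of "[d1, d2, d3]"] nth_append) auto
    then show ?thesis using Cons Suc by simp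
  qed
qed simp

lemma flat_set: "l \<in> set (flat cs) \<longleftrightarrow> (\<exists>(a, b, c)\<in>set cs. l = a \<or> l = b \<or> l = c)"
  by (induction cs) auto

definition all_of :: "('a \<Rightarrow> bool) \<Rightarrow> 'a list \<Rightarrow> bool" where
  "all_of P cs \<longleftrightarrow> (\<forall>c\<in>set cs. P c)"

lemma all_of_simps:
  "all_of P [] \<longleftrightarrow> True" "all_of P [c] \<longleftrightarrow> P c" "all_of P (cs @ ds) \<longleftrightarrow> all_of P cs \<and> all_of P ds"
  "all_of P (concat (map f xs)) \<longleftrightarrow> (\<forall>x\<in>set xs. all_of P (f x))"
  "all_of P (if Q then cs else ds) \<longleftrightarrow> (if Q then all_of P cs else all_of P ds)"
  by (auto simp: all_of_def)

locale tableau =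
  fixes A Q :: nat and stk op nxt and h :: nat
  assumes sm: "stack_machine A Q stk op nxt h" and A: "3 \<le> A"
begin

text \<open>One range of values for both kinds of variables, which hold symbols below
  \<open>A\<close> or states below \<open>Q\<close>.\<close>

definition D :: nat where "D = A + Q"

text \<open>The variable \<open>vr W t k i\<close> stands for the symbol at depth \<open>i\<close> of stack \<open>k < A\<close> after \<open>t\<close> steps
  (\<open>0\<close> below the bottom), and for the control state if \<open>k = A\<close> and \<open>i = 0\<close>.\<close>

definition vr :: "nat \<Rightarrow> nat \<Rightarrow> nat \<Rightarrow> nat \<Rightarrow> nat" where
  "vr W t k i = (t * (A + 1) + k) * W + i"

definition lit :: "nat \<Rightarrow> nat \<Rightarrow> nat \<Rightarrow> nat \<Rightarrow> nat \<Rightarrow> nat" where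
  "lit W t k i a = vr W t k i * D + a"

text \<open>A unit clause: the same literal fills all three slots.\<close>

definition forbid :: "nat \<Rightarrow> nat \<Rightarrow> nat \<Rightarrow> nat \<Rightarrow> (nat \<Rightarrow> bool) \<Rightarrow> (nat \<times> nat \<times> nat) list" where
  "forbid W t k i P = concat (map (\<lambda>a. if P a then [(lit W t k i a, lit W t k i a, lit W t k i a)] else []) [0..<D])"

definition copy_cell :: "nat \<Rightarrow> nat \<Rightarrow> nat \<Rightarrow> nat \<Rightarrow> nat \<Rightarrow> nat \<Rightarrow> (nat \<times> nat \<times> nat) list" where
  "copy_cell W t q k i i' = concat (map (\<lambda>a. concat (map (\<lambda>b. if a = b then []
     else [(lit W t A 0 q, lit W t k i a, lit W (t + 1) k i' b)]) [0..<D])) [0..<D])"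

definition write_cell :: "nat \<Rightarrow> nat \<Rightarrow> nat \<Rightarrow> nat \<Rightarrow> nat \<Rightarrow> nat \<Rightarrow> (nat \<times> nat \<times> nat) list" where
  "write_cell W t q k i s = concat (map (\<lambda>b. if b = s then []
     else [(lit W t A 0 q, lit W (t + 1) k i b, lit W (t + 1) k i b)]) [0..<D])"

definition next_state :: "nat \<Rightarrow> nat \<Rightarrow> nat \<Rightarrow> (nat \<times> nat \<times> nat) list" where
  "next_state W t q = concat (map (\<lambda>a. concat (map (\<lambda>b. if b = nxt q a then []
     else [(lit W t A 0 q, lit W t (stk q) 0 a, lit W (t + 1) A 0 b)]) [0..<D])) [0..<A])"

text \<open>Only the cells up to depth \<open>V\<close> are recorded. A push lets the deepest cell
  fall off and a pop refills it with 0; both are right because during the run the stacks stay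
  shorter than \<open>V\<close>, by the choice of \<open>width\<close>.\<close>

definition next_stack :: "nat \<Rightarrow> nat \<Rightarrow> nat \<Rightarrow> nat \<Rightarrow> (nat \<times> nat \<times> nat) list" where
  "next_stack V t q k = (case if k = stk q then op q else Nop of
       Nop \<Rightarrow> concat (map (\<lambda>i. copy_cell (Suc V) t q k i i) [0..<Suc V])
     | PushOp s \<Rightarrow> write_cell (Suc V) t q k 0 s @ concat (map (\<lambda>i. copy_cell (Suc V) t q k i (i + 1)) [0..<V])
     | PopOp \<Rightarrow> concat (map (\<lambda>i. copy_cell (Suc V) t q k (i + 1) i) [0..<V]) @ write_cell (Suc V) t q k V 0)"

text \<open>Always satisfied, as a cell has only one value. These clauses make the certificate
  readable from times: they come first in \<open>clauses\<close>, so that cell \<open>i\<close>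
  belongs to the trips from \<open>Suc (3 * i)\<close> on. If the value is 1, the last two trips
  start before the bridge, and so the first one does not; if it is 2, the first one does.\<close>

definition guess :: "nat \<Rightarrow> nat \<Rightarrow> (nat \<times> nat \<times> nat) list" where
  "guess W mz = concat (map (\<lambda>i. [(lit W 0 1 i 2, lit W 0 1 i 1, lit W 0 1 i 1)]) [0..<mz])"

definition width :: "bool list \<Rightarrow> nat \<Rightarrow> nat \<Rightarrow> nat" where
  "width x mz T = length x + mz + T + 1"

text \<open>In \<open>FC_forbid\<close> the predicate is fixed, independent of the input. Therefore
  the digits of \<open>x\<close> are imposed by a separate clause each, which excludes the wrong
  bit. The numbers of zero cells fill the stacks up to \<open>Suc (width x mz T)\<close>
  cells.\<close>

definition initial :: "bool list \<Rightarrow> nat \<Rightarrow> nat \<Rightarrow> (nat \<times> nat \<times> nat) list" where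
  "initial x mz T =
     concat (map (\<lambda>i. forbid (Suc (width x mz T)) 0 0 i (\<lambda>a. a \<noteq> 1 \<and> a \<noteq> 2) @
       [(lit (Suc (width x mz T)) 0 0 i (if hdb (drop i x) then 1 else 2),
         lit (Suc (width x mz T)) 0 0 i (if hdb (drop i x) then 1 else 2),
         lit (Suc (width x mz T)) 0 0 i (if hdb (drop i x) then 1 else 2))]) [0..<length x]) @
     concat (map (\<lambda>i. forbid (Suc (width x mz T)) 0 0 (length x + i) (\<lambda>a. a \<noteq> 0)) [0..<mz + T + 2]) @
     concat (map (\<lambda>i. forbid (Suc (width x mz T)) 0 1 i (\<lambda>a. a \<noteq> 1 \<and> a \<noteq> 2)) [0..<mz]) @
     concat (map (\<lambda>i. forbid (Suc (width x mz T)) 0 1 (mz + i) (\<lambda>a. a \<noteq> 0)) [0..<length x + T + 2]) @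
     concat (map (\<lambda>k. concat (map (\<lambda>i. forbid (Suc (width x mz T)) 0 k i (\<lambda>a. a \<noteq> 0)) [0..<Suc (width x mz T)])) [2..<A]) @
     forbid (Suc (width x mz T)) 0 A 0 (\<lambda>a. a \<noteq> 0)"

definition clauses :: "bool list \<Rightarrow> nat \<Rightarrow> nat \<Rightarrow> (nat \<times> nat \<times> nat) list" where
  "clauses x mz T = guess (Suc (width x mz T)) mz @ initial x mz T @
     concat (map (\<lambda>t. concat (map (\<lambda>q. next_state (Suc (width x mz T)) t q @
       concat (map (\<lambda>k. next_stack (width x mz T) t q k) [0..<A])) [0..<Q])) [0..<T]) @
     forbid (Suc (width x mz T)) T A 0 (\<lambda>a. a \<noteq> h) @ forbid (Suc (width x mz T)) T 2 0 (\<lambda>a. a \<noteq> 2)"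

definition nvars :: "bool list \<Rightarrow> nat \<Rightarrow> nat \<Rightarrow> nat" where
  "nvars x mz T = (T + 1) * (A + 1) * Suc (width x mz T)"

lemma vr_less: assumes "t \<le> T" "k \<le> A" "i < W" shows "vr W t k i < (T + 1) * (A + 1) * W"
proof -
  have "t * (A + 1) + k < Suc t * (A + 1)" using assms(2) by simp
  also have "\<dots> \<le> (T + 1) * (A + 1)" using assms(1) by (intro mult_right_mono) auto
  finally have "Suc (t * (A + 1) + k) \<le> (T + 1) * (A + 1)" by simp
  then have "Suc (t * (A + 1) + k) * W \<le> (T + 1) * (A + 1) * W" by (intro mult_right_mono) auto
  moreover have "vr W t k i < Suc (t * (A + 1) + k) * W" using assms(3) by (simp add: vr_def)
  ultimately show ?thesis by linarith
qed

lemma lit_less: assumes "t \<le> T" "k \<le> A" "i < W" "a < D" shows "lit W t k i a < (T + 1) * (A + 1) * W * D"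
proof -
  have "lit W t k i a < Suc (vr W t k i) * D" using assms(4) by (simp add: lit_def)
  also have "\<dots> \<le> (T + 1) * (A + 1) * W * D" using vr_less[OF assms(1-3)] by (intro mult_right_mono) auto
  finally show ?thesis .
qed

lemma D_pos: "0 < D" "h < D" "2 < D" "q < Q \<Longrightarrow> q < D" "s < A \<Longrightarrow> s < D"
  using A sm by (auto simp: D_def stack_machine_def)

lemma lit_dm [simp]: "a < D \<Longrightarrow> lit W t k i a div D = vr W t k i" "a < D \<Longrightarrow> lit W t k i a mod D = a"
  by (simp_all add: lit_def)

lemma all_of_forbid: "all_of P (forbid W t k i R) \<longleftrightarrow> (\<forall>a<D. R a \<longrightarrow> P (lit W t k i a, lit W t k i a, lit W t k i a))"
  by (auto simp: forbid_def all_of_simps)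

lemma all_of_copy: "all_of P (copy_cell W t q k i i') \<longleftrightarrow>
    (\<forall>a<D. \<forall>b<D. a \<noteq> b \<longrightarrow> P (lit W t A 0 q, lit W t k i a, lit W (t + 1) k i' b))"
  by (auto simp: copy_cell_def all_of_simps)

lemma all_of_write: "all_of P (write_cell W t q k i s) \<longleftrightarrow>
    (\<forall>b<D. b \<noteq> s \<longrightarrow> P (lit W t A 0 q, lit W (t + 1) k i b, lit W (t + 1) k i b))"
  by (auto simp: write_cell_def all_of_simps)

lemma all_of_next_state: "all_of P (next_state W t q) \<longleftrightarrow>
    (\<forall>a<A. \<forall>b<D. b \<noteq> nxt q a \<longrightarrow> P (lit W t A 0 q, lit W t (stk q) 0 a, lit W (t + 1) A 0 b))"
  by (auto simp: next_state_def all_of_simps)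

lemma all_of_next_stack: "all_of P (next_stack V t q k) \<longleftrightarrow> (case if k = stk q then op q else Nop of
       Nop \<Rightarrow> (\<forall>i<Suc V. all_of P (copy_cell (Suc V) t q k i i))
     | PushOp s \<Rightarrow> all_of P (write_cell (Suc V) t q k 0 s) \<and> (\<forall>i<V. all_of P (copy_cell (Suc V) t q k i (i + 1)))
     | PopOp \<Rightarrow> (\<forall>i<V. all_of P (copy_cell (Suc V) t q k (i + 1) i)) \<and> all_of P (write_cell (Suc V) t q k V 0))"
  by (auto simp: next_stack_def all_of_simps split: stack_op.splits simp del: upt_Suc)

lemma all_of_next_stackI:
  assumes "\<And>i i'. i < Suc V \<Longrightarrow> i' < Suc V \<Longrightarrow> all_of P (copy_cell (Suc V) t q k i i')"
    "\<And>i s. i < Suc V \<Longrightarrow> all_of P (write_cell (Suc V) t q k i s)"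
  shows "all_of P (next_stack V t q k)"
proof (cases "if k = stk q then op q else Nop")
  case Nop then show ?thesis unfolding all_of_next_stack Nop using assms by simp
next
  case (PushOp s) then show ?thesis unfolding all_of_next_stack PushOp using assms by simp
next
  case PopOp then show ?thesis unfolding all_of_next_stack PopOp using assms by simp
qed

text \<open>Valid for any \<open>P\<close>, so that the range of the literals, soundness and
  completeness can all be derived from the same decomposition.\<close>

lemma all_of_clauses:
  fixes x mz T defines "W \<equiv> Suc (width x mz T)"
  shows "all_of P (clauses x mz T) \<longleftrightarrow>
    (\<forall>i<mz. P (lit W 0 1 i 2, lit W 0 1 i 1, lit W 0 1 i 1)) \<and>
    (\<forall>i<length x. all_of P (forbid W 0 0 i (\<lambda>a. a \<noteq> 1 \<and> a \<noteq> 2)) \<and>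
       P (lit W 0 0 i (if hdb (drop i x) then 1 else 2), lit W 0 0 i (if hdb (drop i x) then 1 else 2),
          lit W 0 0 i (if hdb (drop i x) then 1 else 2))) \<and>
    (\<forall>i<mz + T + 2. all_of P (forbid W 0 0 (length x + i) (\<lambda>a. a \<noteq> 0))) \<and>
    (\<forall>i<mz. all_of P (forbid W 0 1 i (\<lambda>a. a \<noteq> 1 \<and> a \<noteq> 2))) \<and>
    (\<forall>i<length x + T + 2. all_of P (forbid W 0 1 (mz + i) (\<lambda>a. a \<noteq> 0))) \<and>
    (\<forall>k\<in>{2..<A}. \<forall>i<W. all_of P (forbid W 0 k i (\<lambda>a. a \<noteq> 0))) \<and>
    all_of P (forbid W 0 A 0 (\<lambda>a. a \<noteq> 0)) \<and>
    (\<forall>t<T. \<forall>q<Q. all_of P (next_state W t q) \<and> (\<forall>k<A. all_of P (next_stack (width x mz T) t q k))) \<and>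
    all_of P (forbid W T A 0 (\<lambda>a. a \<noteq> h)) \<and> all_of P (forbid W T 2 0 (\<lambda>a. a \<noteq> 2))"
  unfolding clauses_def guess_def initial_def all_of_simps W_def set_upt atLeast0LessThan lessThan_iff Ball_def
  by (auto simp only: atLeastLessThan_iff)

lemma clauses_lit_bound:
  "all_of (\<lambda>(a, b, c). a < nvars x mz T * D \<and> b < nvars x mz T * D \<and> c < nvars x mz T * D) (clauses x mz T)"
proof -
  define V where "V = width x mz T"
  have V: "V = length x + mz + T + 1" by (simp add: V_def width_def)
  let ?B = "nvars x mz T * D"
  let ?P = "\<lambda>(a, b, c). a < ?B \<and> b < ?B \<and> c < ?B"
  have L: "lit (Suc V) t k i a < ?B" if "t \<le> T" "k \<le> A" "i < Suc V" "a < D" for t k i a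
    using lit_less[OF that] by (simp add: nvars_def V_def)
  have forb: "all_of ?P (forbid (Suc V) t k i R)" if "t \<le> T" "k \<le> A" "i < Suc V" for t k i R
    unfolding all_of_forbid using L[OF that] by auto
  have cp: "all_of ?P (copy_cell (Suc V) t q k i i')" if "t < T" "q < Q" "k < A" "i < Suc V" "i' < Suc V" for t q k i i'
    unfolding all_of_copy using L[of t A 0 q] L[of t k i] L[of "t + 1" k i'] that D_pos(4)[of q] by auto
  have wr: "all_of ?P (write_cell (Suc V) t q k i s)" if "t < T" "q < Q" "k < A" "i < Suc V" for t q k i s
    unfolding all_of_write using L[of t A 0 q] L[of "t + 1" k i] that D_pos(4)[of q] by auto
  have st: "all_of ?P (next_state (Suc V) t q)" if "t < T" "q < Q" for t q
  proof -
    have "stk q < A" using sm that(2) by (auto simp: stack_machine_def)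
    then show ?thesis
      unfolding all_of_next_state using L[of t A 0 q] L[of t "stk q" 0] L[of "t + 1" A 0] that D_pos(4)[of q] D_pos(5)
      by auto
  qed
  have sk: "all_of ?P (next_stack V t q k)" if "t < T" "q < Q" "k < A" for t q k
    by (rule all_of_next_stackI) (intro cp wr that; simp)+
  show ?thesis
    unfolding all_of_clauses V_def[symmetric]
  proof (intro conjI allI impI ballI)
    fix i assume "i < mz"
    then show "?P (lit (Suc V) 0 1 i 2, lit (Suc V) 0 1 i 1, lit (Suc V) 0 1 i 1)"
      using L[of 0 1 i] A V D_pos(3) by auto
  next
    fix i assume "i < length x"
    then show "?P (lit (Suc V) 0 0 i (if hdb (drop i x) then 1 else 2),
        lit (Suc V) 0 0 i (if hdb (drop i x) then 1 else 2), lit (Suc V) 0 0 i (if hdb (drop i x) then 1 else 2))"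
      using L[of 0 0 i] V D_pos(3) by auto
  qed ((rule forb | rule st | rule sk); use A V in auto)+
qed

lemma guess_nth:
  assumes "i < mz"
  shows "flat (clauses x mz T) ! (3 * i) = lit (Suc (width x mz T)) 0 1 i 2"
    "flat (clauses x mz T) ! (3 * i + 1) = lit (Suc (width x mz T)) 0 1 i 1"
    "flat (clauses x mz T) ! (3 * i + 2) = lit (Suc (width x mz T)) 0 1 i 1"
    "i < length (clauses x mz T)"
proof -
  have "guess (Suc (width x mz T)) mz = map (\<lambda>i. (lit (Suc (width x mz T)) 0 1 i 2,
      lit (Suc (width x mz T)) 0 1 i 1, lit (Suc (width x mz T)) 0 1 i 1)) [0..<mz]"
    unfolding guess_def by (induction mz) auto
  then have "clauses x mz T ! i = (lit (Suc (width x mz T)) 0 1 i 2,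
      lit (Suc (width x mz T)) 0 1 i 1, lit (Suc (width x mz T)) 0 1 i 1)"
    and l: "i < length (clauses x mz T)"
    using assms by (simp_all add: clauses_def nth_append)
  from flat_nth[OF l this(1)] l
  show "flat (clauses x mz T) ! (3 * i) = lit (Suc (width x mz T)) 0 1 i 2"
    "flat (clauses x mz T) ! (3 * i + 1) = lit (Suc (width x mz T)) 0 1 i 1"
    "flat (clauses x mz T) ! (3 * i + 2) = lit (Suc (width x mz T)) 0 1 i 1"
    "i < length (clauses x mz T)" by auto
qed

section \<open>Solutions of the clauses are accepting runs\<close>

definition start :: "bool list \<Rightarrow> bool list \<Rightarrow> store" where
  "start x z = (\<lambda>_. [])(0 := bits x, 1 := bits z)"

definition conf :: "bool list \<Rightarrow> bool list \<Rightarrow> nat \<Rightarrow> nat \<times> store" where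
  "conf x z t = (sm_step stk op nxt ^^ t) (0, start x z)"

lemma conf_ok:
  "fst (conf x z t) < Q \<and> ok_store A (snd (conf x z t)) \<and> (\<forall>k. length (snd (conf x z t) k) \<le> length x + length z + t)"
proof (induction t)
  case 0
  have "0 < Q" using sm by (auto simp: stack_machine_def)
  moreover have "ok_store A (start x z)" using bits_range A by (fastforce simp: ok_store_def start_def)
  moreover have "length (start x z k) \<le> length x + length z + 0" for k by (simp add: start_def)
  ultimately show ?case by (simp add: conf_def)
next
  case (Suc t)
  obtain q \<sigma> where c: "conf x z t = (q, \<sigma>)" by fastforce
  obtain q' \<sigma>' where c': "conf x z (Suc t) = (q', \<sigma>')" by fastforce
  have s: "sm_step stk op nxt (q, \<sigma>) = (q', \<sigma>')" using c c' by (simp add: conf_def)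
  have "q' < Q \<and> ok_store A \<sigma>'" using sm_step_ok[OF sm _ _ _ s] Suc c A by auto
  moreover have "length (\<sigma>' k) \<le> length x + length z + Suc t" for k
  proof -
    have "length (apply_op (op q) w) \<le> Suc (length w)" for w by (cases "op q") auto
    then have "length (\<sigma>' k) \<le> Suc (length (\<sigma> k))" using s by (auto simp: sm_step_def)
    then show ?thesis using Suc c by (metis add_Suc_right le_trans not_less_eq_eq snd_conv)
  qed
  ultimately show ?case using c' by simp
qed

abbreviation sat_by :: "(nat \<Rightarrow> nat) \<Rightarrow> nat \<times> nat \<times> nat \<Rightarrow> bool" where
  "sat_by f \<equiv> (\<lambda>(a, b, c). \<not> (f (a div D) = a mod D \<and> f (b div D) = b mod D \<and> f (c div D) = c mod D))"

definition accepts :: "bool list \<Rightarrow> bool list \<Rightarrow> nat \<Rightarrow> bool" where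
  "accepts x z T \<longleftrightarrow> fst (conf x z T) = h \<and> top_symbol (snd (conf x z T) 2) = 2"

text \<open>By induction on the time, the values agree with the run: once the current state is
  known, the clauses conditioned on it leave a single value for each variable of the next time. Only
  the cells of stack 1 are free at time 0, and they constitute the certificate.\<close>

lemma clauses_sound:
  assumes f: "\<And>v. v < nvars x mz T \<Longrightarrow> f v < D" and sat: "all_of (sat_by f) (clauses x mz T)"
  shows "accepts x (map (\<lambda>i. f (vr (Suc (width x mz T)) 0 1 i) = 2) [0..<mz]) T"
    "\<And>i. i < mz \<Longrightarrow> f (vr (Suc (width x mz T)) 0 1 i) = 1 \<or> f (vr (Suc (width x mz T)) 0 1 i) = 2"
proof -
  define V where "V = width x mz T"
  define g where "g t k i = f (vr (Suc V) t k i)" for t k i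
  define z where "z = map (\<lambda>i. g 0 1 i = 2) [0..<mz]"
  have gD: "g t k i < D" if "t \<le> T" "k \<le> A" "i < Suc V" for t k i
    unfolding g_def using vr_less[OF that] by (intro f) (simp add: nvars_def V_def)
  have forb: "all_of (sat_by f) (forbid (Suc V) t k i R) \<Longrightarrow> t \<le> T \<Longrightarrow> k \<le> A \<Longrightarrow> i < Suc V \<Longrightarrow> \<not> R (g t k i)" for t k i R
    using gD[of t k i] by (auto simp: all_of_forbid g_def)
  note S = sat[unfolded all_of_clauses, folded V_def]
  have V: "V = length x + mz + T + 1" by (simp add: V_def width_def)
  have z1: "g 0 1 i = 1 \<or> g 0 1 i = 2" if "i < mz" for i
    using forb[of 0 1 i "\<lambda>a. a \<noteq> 1 \<and> a \<noteq> 2"] S that A V by auto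
  have run: "t \<le> T \<Longrightarrow> g t A 0 = fst (conf x z t) \<and> (\<forall>k<A. \<forall>i<Suc V. g t k i = nd (snd (conf x z t) k) i)" for t
  proof (induction t)
    case 0
    have "g 0 A 0 = 0" using forb[of 0 A 0 "\<lambda>a. a \<noteq> 0"] S V by auto
    moreover have "g 0 k i = nd (start x z k) i" if k: "k < A" "i < Suc V" for k i
    proof -
      consider "k = 0" "i < length x" | "k = 0" "length x \<le> i" | "k = 1" "i < mz" | "k = 1" "mz \<le> i" | "2 \<le> k" by linarith
      then show ?thesis
      proof cases
        case 1
        have "\<not> (g 0 0 i \<noteq> 1 \<and> g 0 0 i \<noteq> 2)"
          using forb[of 0 0 i "\<lambda>a. a \<noteq> 1 \<and> a \<noteq> 2"] S 1 V by auto
        moreover have "sat_by f (lit (Suc V) 0 0 i (if hdb (drop i x) then 1 else 2), lit (Suc V) 0 0 i (if hdb (drop i x) then 1 else 2),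
          lit (Suc V) 0 0 i (if hdb (drop i x) then 1 else 2))"
          using S 1 by blast
        then have "g 0 0 i \<noteq> (if hdb (drop i x) then 1 else 2)" using D_pos(3) by (auto simp: g_def split: if_splits)
        moreover have "hdb (drop i x) = x ! i" using 1 by (simp add: Cons_nth_drop_Suc[symmetric])
        ultimately have "g 0 0 i = bit_symbol (x ! i)" by (auto simp: bit_symbol_def split: if_splits)
        then show ?thesis using 1 by (simp add: start_def nd_def bits_def)
      next
        case 2
        have "all_of (sat_by f) (forbid (Suc V) 0 0 (length x + (i - length x)) (\<lambda>a. a \<noteq> 0))"
          using S k(2) 2 V by (intro S[THEN conjunct2, THEN conjunct2, THEN conjunct1, rule_format]) auto
        then have "g 0 0 i = 0" using forb[of 0 0 i "\<lambda>a. a \<noteq> 0"] k(2) 2 by auto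
        then show ?thesis using 2 by (simp add: start_def nd_def)
      next
        case 3
        have "nd (bits z) i = bit_symbol (g 0 1 i = 2)" using 3 by (simp add: nd_def bits_def z_def)
        then show ?thesis using z1[OF 3(2)] 3 by (auto simp: start_def bit_symbol_def)
      next
        case 4
        have "all_of (sat_by f) (forbid (Suc V) 0 1 (mz + (i - mz)) (\<lambda>a. a \<noteq> 0))"
          using k(2) 4 V by (intro S[THEN conjunct2, THEN conjunct2, THEN conjunct2, THEN conjunct2, THEN conjunct1, rule_format]) auto
        then have "g 0 1 i = 0" using forb[of 0 1 i "\<lambda>a. a \<noteq> 0"] k(2) 4 A by auto
        then show ?thesis using 4 by (simp add: start_def nd_def z_def)
      next
        case 5
        have "all_of (sat_by f) (forbid (Suc V) 0 k i (\<lambda>a. a \<noteq> 0))" using S 5 k by auto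
        then have "g 0 k i = 0" using forb[of 0 k i "\<lambda>a. a \<noteq> 0"] k by auto
        then show ?thesis using 5 by (simp add: start_def nd_def)
      qed
    qed
    ultimately show ?case by (simp add: conf_def)
  next
    case (Suc t)
    obtain q \<sigma> where c: "conf x z t = (q, \<sigma>)" by fastforce
    have q: "q < Q" "stk q < A" "q < D" and ok: "ok_store A \<sigma>" and ln: "\<And>k. length (\<sigma> k) \<le> length x + mz + t"
      using conf_ok[of x z t] c sm D_pos(4) by (auto simp: stack_machine_def z_def)
    have gq: "g t A 0 = q" and gk: "\<And>k i. k < A \<Longrightarrow> i < Suc V \<Longrightarrow> g t k i = nd (\<sigma> k) i" using Suc c by auto
    have t: "t < T" using Suc.prems by simp
    have ns: "all_of (sat_by f) (next_state (Suc V) t q)" and nk: "\<And>k. k < A \<Longrightarrow> all_of (sat_by f) (next_stack V t q k)"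
      using S t q(1) by auto
    have c': "conf x z (Suc t) = (nxt q (top_symbol (\<sigma> (stk q))), \<sigma>(stk q := apply_op (op q) (\<sigma> (stk q))))"
      using c by (simp add: conf_def sm_step_def)
    let ?a = "top_symbol (\<sigma> (stk q))"
    have a: "?a < A" "?a = g t (stk q) 0" using ok_store_top[OF ok, of "stk q"] A gk[of "stk q" 0] q by (auto simp: nd_top_symbol)
    have "g (Suc t) A 0 = nxt q ?a"
    proof (rule ccontr)
      assume "g (Suc t) A 0 \<noteq> nxt q ?a"
      moreover have "g (Suc t) A 0 < D" using gD[of "Suc t" A 0] t by auto
      ultimately have "sat_by f (lit (Suc V) t A 0 q, lit (Suc V) t (stk q) 0 ?a, lit (Suc V) (t + 1) A 0 (g (Suc t) A 0))"
        using ns a(1) unfolding all_of_next_state by blast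
      then show False using gq a q(3) D_pos(5)[OF a(1)] \<open>g (Suc t) A 0 < D\<close> by (auto simp: g_def)
    qed
    moreover have "g (Suc t) k i = nd ((\<sigma>(stk q := apply_op (op q) (\<sigma> (stk q)))) k) i" if k: "k < A" "i < Suc V" for k i
    proof -
      have cp: "g (Suc t) k i' = g t k i0" if "all_of (sat_by f) (copy_cell (Suc V) t q k i0 i')" "i' < Suc V" "i0 < Suc V" for i0 i'
      proof (rule ccontr)
        assume ne: "g (Suc t) k i' \<noteq> g t k i0"
        have b: "g (Suc t) k i' < D" "g t k i0 < D" using gD[of "Suc t" k i'] gD[of t k i0] t k that by auto
        have "sat_by f (lit (Suc V) t A 0 q, lit (Suc V) t k i0 (g t k i0), lit (Suc V) (t + 1) k i' (g (Suc t) k i'))"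
          using that(1)[unfolded all_of_copy, THEN spec, THEN mp, OF b(2), THEN spec, THEN mp, OF b(1), THEN mp, OF ne[symmetric]] .
        then show False using gq q(3) b by (auto simp: g_def)
      qed
      have wr: "g (Suc t) k i' = s" if "all_of (sat_by f) (write_cell (Suc V) t q k i' s)" "i' < Suc V" for i' s
      proof (rule ccontr)
        assume ne: "g (Suc t) k i' \<noteq> s"
        have b: "g (Suc t) k i' < D" using gD[of "Suc t" k i'] t k that by auto
        have "sat_by f (lit (Suc V) t A 0 q, lit (Suc V) (t + 1) k i' (g (Suc t) k i'), lit (Suc V) (t + 1) k i' (g (Suc t) k i'))"
          using that(1)[unfolded all_of_write, THEN spec, THEN mp, OF b, THEN mp, OF ne] .
        then show False using gq q(3) b by (auto simp: g_def)
      qed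
      note N = nk[OF k(1), unfolded all_of_next_stack]
      show ?thesis
      proof (cases "if k = stk q then op q else Nop")
        case Nop
        then have "g (Suc t) k i = g t k i" using N k(2) by (intro cp) auto
        moreover have "(\<sigma>(stk q := apply_op (op q) (\<sigma> (stk q)))) k = \<sigma> k" using Nop by (auto split: if_splits)
        ultimately show ?thesis using gk[OF k] by simp
      next
        case (PushOp s)
        then have ks: "k = stk q" "op q = PushOp s" by (auto split: if_splits)
        show ?thesis
        proof (cases i)
          case 0
          then show ?thesis using wr[of 0 s] N ks by simp
        next
          case (Suc j)
          then have "g (Suc t) k (j + 1) = g t k j" using N ks k(2) by (intro cp) auto
          then show ?thesis using Suc ks gk[OF k(1), of j] k(2) by simp
        qed
      next
        case PopOp
        then have ks: "k = stk q" "op q = PopOp" by (auto split: if_splits)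
        show ?thesis
        proof (cases "i < V")
          case True
          then have "g (Suc t) k i = g t k (i + 1)" using N ks by (intro cp) auto
          then show ?thesis using True ks gk[OF k(1), of "i + 1"] by (simp add: nd_tl)
        next
          case False
          then have "i = V" using k(2) by simp
          then have "g (Suc t) k i = 0" using wr[of V 0] N ks by simp
          \<comment> \<open>At time \<open>t < T\<close> the stack has fewer than \<open>V\<close>
            symbols, so the bottom cell is indeed blank.\<close>
          moreover have "nd (tl (\<sigma> k)) i = 0" using ln[of k] \<open>i = V\<close> t V by (simp add: nd_def)
          ultimately show ?thesis using ks by simp
        qed
      qed
    qed
    ultimately show ?case unfolding c' by simp
  qed
  have "g T A 0 = h" using forb[of T A 0 "\<lambda>a. a \<noteq> h"] S by auto
  moreover have "g T 2 0 = 2" using forb[of T 2 0 "\<lambda>a. a \<noteq> 2"] S A by auto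
  ultimately have "accepts x z T" using run[of T] A unfolding accepts_def nd_top_symbol by auto
  then show "accepts x (map (\<lambda>i. f (vr (Suc (width x mz T)) 0 1 i) = 2) [0..<mz]) T"
    by (simp add: z_def g_def V_def)
  show "\<And>i. i < mz \<Longrightarrow> f (vr (Suc (width x mz T)) 0 1 i) = 1 \<or> f (vr (Suc (width x mz T)) 0 1 i) = 2"
    using z1 by (simp add: g_def V_def)
qed

definition truth :: "bool list \<Rightarrow> bool list \<Rightarrow> nat \<Rightarrow> nat \<Rightarrow> nat \<Rightarrow> nat" where
  "truth x z t k i = (if k = A then fst (conf x z t) else nd (snd (conf x z t) k) i)"

definition assignment :: "bool list \<Rightarrow> bool list \<Rightarrow> nat \<Rightarrow> nat \<Rightarrow> nat" where
  "assignment x z W v = truth x z (v div W div (A + 1)) (v div W mod (A + 1)) (v mod W)"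

lemma truth_less: "truth x z t k i < D"
proof -
  have "nd w i < A" if "\<forall>c\<in>set w. c < A" for w using that A by (auto simp: nd_def)
  then show ?thesis using conf_ok[of x z t] by (auto simp: truth_def D_def ok_store_def intro: trans_less_add1 trans_less_add2)
qed

lemma assignment: assumes "k \<le> A" "i < W" shows "assignment x z W (vr W t k i) = truth x z t k i"
proof -
  have dm: "s < q \<Longrightarrow> (l * q + s) div q = l \<and> (l * q + s) mod q = s" for l q s :: nat by simp
  have 1: "vr W t k i div W = t * (A + 1) + k" "vr W t k i mod W = i"
    using dm[OF assms(2), of "t * (A + 1) + k"] by (simp_all add: vr_def)
  have 2: "(t * (A + 1) + k) div (A + 1) = t" "(t * (A + 1) + k) mod (A + 1) = k"
    using dm[of k "A + 1" t] assms(1) by linarith+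
  show ?thesis unfolding assignment_def 1 2 ..
qed

text \<open>The values of the run itself satisfy everything. What needs care are the clauses for a
  step, which are conditioned on a state \<open>q\<close>.\<close>

lemma clauses_complete:
  assumes z: "length z = mz" and acc: "accepts x z T"
  shows "all_of (sat_by (assignment x z (Suc (width x mz T)))) (clauses x mz T)"
proof -
  define V where "V = width x mz T"
  have V: "V = length x + mz + T + 1" by (simp add: V_def width_def)
  let ?f = "assignment x z (Suc V)"
  have ch: "?f (lit (Suc V) t k i a div D) = lit (Suc V) t k i a mod D \<longleftrightarrow> truth x z t k i = a"
    if "k \<le> A" "i < Suc V" "a < D" for t k i a
    using assignment[OF that(1,2)] that(3) by simp
  have forb: "all_of (sat_by ?f) (forbid (Suc V) t k i R)" if "k \<le> A" "i < Suc V" "\<not> R (truth x z t k i)" for t k i R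
    unfolding all_of_forbid using ch[OF that(1,2)] that(3) by (auto simp del: lit_dm)
  have t0: "truth x z 0 k i = nd (start x z k) i" if "k < A" for k i using that by (simp add: truth_def conf_def)
  have b: "bit_symbol c = 1 \<or> bit_symbol c = 2" for c by (auto simp: bit_symbol_def)
  have g1: "truth x z 0 1 i = bit_symbol (z ! i)" if "i < mz" for i
    using t0[of 1 i] A that z by (simp add: start_def nd_def bits_def)
  have g0: "truth x z 0 0 i = bit_symbol (x ! i)" if "i < length x" for i
    using t0[of 0 i] A that by (simp add: start_def nd_def bits_def)
  have step: "all_of (sat_by ?f) (next_state (Suc V) t q) \<and> (\<forall>k<A. all_of (sat_by ?f) (next_stack V t q k))"
    if t: "t < T" and q: "q < Q" for t q
  proof -
    obtain q0 \<sigma> where c: "conf x z t = (q0, \<sigma>)" by fastforce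
    have q0: "q0 < Q" "stk q0 < A" "q0 < D" and ok: "ok_store A \<sigma>" and ln: "\<And>k. length (\<sigma> k) \<le> length x + mz + t"
      using conf_ok[of x z t] c sm D_pos(4) z by (auto simp: stack_machine_def)
    have qD: "q < D" "stk q < A" using q D_pos(4) sm by (auto simp: stack_machine_def)
    have c': "conf x z (Suc t) = (nxt q0 (top_symbol (\<sigma> (stk q0))), \<sigma>(stk q0 := apply_op (op q0) (\<sigma> (stk q0))))"
      using c by (simp add: conf_def sm_step_def)
    have tA: "truth x z t A i = q0" "truth x z (Suc t) A i = nxt q0 (top_symbol (\<sigma> (stk q0)))" for i
      by (simp_all add: truth_def c c')
    have tk: "truth x z t k i = nd (\<sigma> k) i"
      "truth x z (Suc t) k i = nd ((\<sigma>(stk q0 := apply_op (op q0) (\<sigma> (stk q0)))) k) i" if "k < A" for k i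
      using that by (simp_all add: truth_def c c')
    have s: "?f (lit (Suc V) t A 0 q div D) = lit (Suc V) t A 0 q mod D \<longleftrightarrow> q0 = q"
      using ch[of A 0 q t] qD tA by simp
    show ?thesis
    proof (cases "q0 = q")
      case False
      \<comment> \<open>A clause conditioned on a state other than the current one holds because of
        its first literal.\<close>
      then have n: "sat_by ?f (lit (Suc V) t A 0 q, b', c'')" for b' c'' using s by simp
      have "all_of (sat_by ?f) (next_stack V t q k)" for k
        by (rule all_of_next_stackI; unfold all_of_copy all_of_write; intro allI impI; rule n)
      moreover have "all_of (sat_by ?f) (next_state (Suc V) t q)"
        unfolding all_of_next_state by (intro allI impI; rule n)
      ultimately show ?thesis by blast
    next
      case True
      have "all_of (sat_by ?f) (next_state (Suc V) t q)"
        unfolding all_of_next_state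
      proof (intro allI impI)
        fix a b' assume ab: "a < A" "b' < D" "b' \<noteq> nxt q a"
        have "truth x z t (stk q) 0 = a \<Longrightarrow> truth x z (Suc t) A 0 \<noteq> b'"
          using tk[of "stk q" 0] tA(2) qD ab True by (auto simp: nd_top_symbol)
        then show "sat_by ?f (lit (Suc V) t A 0 q, lit (Suc V) t (stk q) 0 a, lit (Suc V) (t + 1) A 0 b')"
          using ch[of "stk q" 0 a t] ch[of A 0 b' "Suc t"] ab qD D_pos(5)[OF ab(1)] by (auto simp del: lit_dm)
      qed
      moreover have "all_of (sat_by ?f) (next_stack V t q k)" if k: "k < A" for k
      proof -
        have cp: "all_of (sat_by ?f) (copy_cell (Suc V) t q k i i')"
          if "truth x z (Suc t) k i' = truth x z t k i" "i < Suc V" "i' < Suc V" for i i'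
          unfolding all_of_copy
        proof (intro allI impI)
          fix a b' assume "a < D" "b' < D" "a \<noteq> b'"
          then show "sat_by ?f (lit (Suc V) t A 0 q, lit (Suc V) t k i a, lit (Suc V) (t + 1) k i' b')"
            using ch[of k i a t] ch[of k i' b' "Suc t"] k that by (auto simp del: lit_dm)
        qed
        have wr: "all_of (sat_by ?f) (write_cell (Suc V) t q k i s)" if "truth x z (Suc t) k i = s" "i < Suc V" for i s
          unfolding all_of_write
        proof (intro allI impI)
          fix b' assume "b' < D" "b' \<noteq> s"
          then show "sat_by ?f (lit (Suc V) t A 0 q, lit (Suc V) (t + 1) k i b', lit (Suc V) (t + 1) k i b')"
            using ch[of k i b' "Suc t"] k that by (auto simp del: lit_dm)
        qed
        show ?thesis
        proof (cases "if k = stk q then op q else Nop")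
          case Nop
          then have "truth x z (Suc t) k i = truth x z t k i" for i
            using tk[OF k] True by (auto split: if_splits)
          then show ?thesis unfolding all_of_next_stack Nop using cp by simp
        next
          case (PushOp s)
          then have ks: "k = stk q" "op q = PushOp s" by (auto split: if_splits)
          then have e: "truth x z (Suc t) k 0 = s" "truth x z (Suc t) k (i + 1) = truth x z t k i" for i
            using tk[OF k] True by simp_all
          show ?thesis unfolding all_of_next_stack PushOp stack_op.case
            by (intro conjI allI impI wr cp e) simp_all
        next
          case PopOp
          then have ks: "k = stk q" "op q = PopOp" by (auto split: if_splits)
          then have "truth x z (Suc t) k i = truth x z t k (i + 1)" for i
            using tk[OF k] True by (simp add: nd_tl)
          moreover have "truth x z (Suc t) k V = 0"
            using tk(2)[OF k, of V] True ks ln[of k] t V by (simp add: nd_def)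
          ultimately show ?thesis unfolding all_of_next_stack PopOp stack_op.case
            by (intro conjI allI impI wr cp) simp_all
        qed
      qed
      ultimately show ?thesis by blast
    qed
  qed
  show ?thesis
    unfolding all_of_clauses V_def[symmetric]
  proof (intro conjI allI impI ballI)
    fix i assume i: "i < mz"
    show "sat_by ?f (lit (Suc V) 0 1 i 2, lit (Suc V) 0 1 i 1, lit (Suc V) 0 1 i 1)"
      using ch[of 1 i 2 0] ch[of 1 i 1 0] i A V D_pos(3) by (auto simp del: lit_dm)
    show "all_of (sat_by ?f) (forbid (Suc V) 0 1 i (\<lambda>a. a \<noteq> 1 \<and> a \<noteq> 2))"
      by (rule forb) (use i A V g1[OF i] b in auto)
  next
    fix i assume i: "i < length x"
    show "all_of (sat_by ?f) (forbid (Suc V) 0 0 i (\<lambda>a. a \<noteq> 1 \<and> a \<noteq> 2))"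
      by (rule forb) (use i A V g0[OF i] b in auto)
    have "hdb (drop i x) = x ! i" using i by (simp add: Cons_nth_drop_Suc[symmetric])
    then have "truth x z 0 0 i \<noteq> (if hdb (drop i x) then 1 else 2)" using g0[OF i] by (auto simp: bit_symbol_def)
    moreover have "(if hdb (drop i x) then 1 else 2) < D" using D_pos(3) by auto
    ultimately show "sat_by ?f (lit (Suc V) 0 0 i (if hdb (drop i x) then 1 else 2),
        lit (Suc V) 0 0 i (if hdb (drop i x) then 1 else 2), lit (Suc V) 0 0 i (if hdb (drop i x) then 1 else 2))"
      using ch[of 0 i "if hdb (drop i x) then 1 else 2" 0] i A V by (auto simp del: lit_dm)
  next
    fix i assume i: "i < mz + T + 2"
    show "all_of (sat_by ?f) (forbid (Suc V) 0 0 (length x + i) (\<lambda>a. a \<noteq> 0))"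
      by (rule forb) (use i V t0[of 0] A in \<open>auto simp: start_def nd_def\<close>)
  next
    fix i assume i: "i < length x + T + 2"
    show "all_of (sat_by ?f) (forbid (Suc V) 0 1 (mz + i) (\<lambda>a. a \<noteq> 0))"
      by (rule forb) (use i V t0[of 1] A z in \<open>auto simp: start_def nd_def\<close>)
  next
    fix k i assume k: "k \<in> {2..<A}" "i < Suc V"
    show "all_of (sat_by ?f) (forbid (Suc V) 0 k i (\<lambda>a. a \<noteq> 0))"
      by (rule forb) (use k t0[of k] in \<open>auto simp: start_def nd_def\<close>)
  next
    show "all_of (sat_by ?f) (forbid (Suc V) 0 A 0 (\<lambda>a. a \<noteq> 0))"
      by (rule forb) (auto simp: truth_def conf_def)
    show "all_of (sat_by ?f) (forbid (Suc V) T A 0 (\<lambda>a. a \<noteq> h))"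
      by (rule forb) (use acc in \<open>auto simp: truth_def accepts_def\<close>)
    show "all_of (sat_by ?f) (forbid (Suc V) T 2 0 (\<lambda>a. a \<noteq> 2))"
      by (rule forb) (use acc A in \<open>auto simp: truth_def accepts_def nd_top_symbol\<close>)
  qed (use step in blast)+
qed

end


section \<open>Computing the reduction\<close>

lemma enc_nats_concat: "enc_nats (concat xss) = concat (map enc_nats xss)"
  by (induction xss) auto

lemma FP_comp_clauses:
  "FP 3 (\<lambda>e. F (ev 0 e) (length (ev 1 e)) (length (ev 2 e))) \<Longrightarrow> FP m f \<Longrightarrow> FN m g \<Longrightarrow> FN m h \<Longrightarrow>
    FP m (\<lambda>e. F (f e) (g e) (h e))"
  using FP_comp3[of "\<lambda>u v w. F u (length v) (length w)" m f "\<lambda>e. un (g e)" "\<lambda>e. un (h e)"]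
  by (simp add: FN_def)

lemma FP_comp_network:
  assumes "FP 4 (\<lambda>e. F (ev 0 e) (length (ev 1 e)) (length (ev 2 e)) (length (ev 3 e)))"
    "FP m f" "FN m g" "FN m h" "FN m k"
  shows "FP m (\<lambda>e. F (f e) (g e) (h e) (k e))"
  using FP_comp[of "[f, \<lambda>e. un (g e), \<lambda>e. un (h e), \<lambda>e. un (k e)]"
      "\<lambda>e. F (ev 0 e) (length (ev 1 e)) (length (ev 2 e)) (length (ev 3 e))" m] assms
  by (auto simp: FN_def eval_nat_numeral)

text \<open>The quotient is the number of \<open>j\<close> with \<open>3 * Suc j \<le> n\<close>,
  which a loop can count; truncated subtraction expresses the inequality.\<close>

lemma FN_div3: assumes "FN m f" shows "FN m (\<lambda>e. f e div 3)"
proof -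
  have "concat (map (\<lambda>j. if 3 * Suc j - n = 0 then [True] else []) [0..<k]) = un (min k (n div 3))" for n k
  proof (induction k)
    case (Suc k)
    have "3 * Suc k - n = 0 \<longleftrightarrow> Suc k \<le> n div 3" by auto
    then show ?case using Suc by (auto simp: min_def un_def replicate_append_same not_less_eq_eq)
  qed simp
  then have eq: "concat (map (\<lambda>j. if 3 * Suc j - n = 0 then [True] else []) [0..<n]) = un (n div 3)" for n
    by (simp only: min_absorb2[OF div_le_dividend])
  have "FP 1 (\<lambda>e. concat (map (\<lambda>j. if 3 * Suc j - length (ev 0 e) = 0 then [True] else []) [0..<length (ev 0 e)]))"
    by (intro FP_for FP_if FB_eq FN_minus FN_mult FN_const FN_Suc FN_var FP_const; simp only: ev_tl; rule FN_var)
  from FP_comp1[of "\<lambda>w. concat (map (\<lambda>j. if 3 * Suc j - length w = 0 then [True] else []) [0..<length w])",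
      OF this assms[unfolded FN_def]]
  show ?thesis by (simp only: un_simps eq FN_def)
qed

text \<open>Each block ends with its only False. The number of clauses is recovered in this way from
  their encoding.\<close>

definition count_blocks :: "bool list \<Rightarrow> nat" where
  "count_blocks w = length (filter Not w)"

lemma count_blocks_enc_nats [simp]: "count_blocks (enc_nats ns) = length ns"
  by (induction ns) (auto simp: count_blocks_def un_def)

lemma FN_count_blocks: assumes "FP m f" shows "FN m (\<lambda>e. count_blocks (f e))"
proof -
  have "FP m (\<lambda>e. filter Not (f e))"
  proof (rule FP_rec[where R = "\<lambda>e. filter Not" and n = f and z = "\<lambda>_. []" and
        g = "\<lambda>c e. if c then ev 0 e else False # ev 0 e" and C = 1])
    fix e :: "bool list list" and s :: "bool list"
    show "length (filter Not s) \<le> (sz e + length s) ^ 1" by (simp add: trans_le_add2)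
    show "FP (Suc (Suc m)) (\<lambda>e. if c then ev 0 e else False # ev 0 e)" for c
      by (intro FP_If_const FP_Cons FP_ev)
  qed (auto intro: assms FP_const)
  then show ?thesis unfolding count_blocks_def by (rule FN_length)
qed

subsection \<open>The clauses\<close>

definition FC :: "nat \<Rightarrow> (bool list list \<Rightarrow> (nat \<times> nat \<times> nat) list) \<Rightarrow> bool" where
  "FC m cs \<longleftrightarrow> FP m (\<lambda>e. enc_nats (flat (cs e)))"

lemma FC_Nil: "FC m (\<lambda>e. [])"
  unfolding FC_def by (simp add: FP_const)

lemma FC_append: "FC m f \<Longrightarrow> FC m g \<Longrightarrow> FC m (\<lambda>e. f e @ g e)"
  unfolding FC_def by (simp add: FP_append)

lemma FC_single:
  assumes "FN m a" "FN m b" "FN m c" shows "FC m (\<lambda>e. [(a e, b e, c e)])"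
proof -
  have "FP m (\<lambda>e. un (a e) @ [False] @ un (b e) @ [False] @ un (c e) @ [False])"
    by (intro FP_append FP_const assms[unfolded FN_def])
  then show ?thesis unfolding FC_def by simp
qed

lemma FC_for:
  assumes "FC (Suc m) (\<lambda>e. body (length (ev 0 e)) (tl e))" "FN m n"
  shows "FC m (\<lambda>e. concat (map (\<lambda>i. body i e) [0..<n e]))"
  using FP_for[of m "\<lambda>i e. enc_nats (flat (body i e))" n] assms
  unfolding FC_def by (simp add: flat_concat enc_nats_concat o_def)

text \<open>For ranges such as the states or the values, which are constants of the machine: the
  concatenation is unrolled. Ranges that depend on the input need \<open>FC_for\<close>.\<close>

lemma FC_list: "(\<And>a. a \<in> set xs \<Longrightarrow> FC m (f a)) \<Longrightarrow> FC m (\<lambda>e. concat (map (\<lambda>a. f a e) xs))"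
  by (induction xs) (auto intro: FC_append FC_Nil)

lemma FC_If: "(c \<Longrightarrow> FC m f) \<Longrightarrow> (\<not> c \<Longrightarrow> FC m g) \<Longrightarrow> FC m (\<lambda>e. if c then f e else g e)"
  by (cases c) simp_all

context tableau
begin

lemma FN_lit: "FN m W \<Longrightarrow> FN m t \<Longrightarrow> FN m i \<Longrightarrow> FN m a \<Longrightarrow> FN m (\<lambda>e. lit (W e) (t e) k (i e) (a e))"
  unfolding lit_def vr_def by (intro FN_add FN_mult FN_const)

lemma FC_forbid: "FN m W \<Longrightarrow> FN m t \<Longrightarrow> FN m i \<Longrightarrow> FC m (\<lambda>e. forbid (W e) (t e) k (i e) P)"
  unfolding forbid_def by (intro FC_list FC_If FC_single FC_Nil FN_lit FN_const)

lemma FC_copy_cell: "FN m W \<Longrightarrow> FN m t \<Longrightarrow> FN m i \<Longrightarrow> FN m i' \<Longrightarrow> FC m (\<lambda>e. copy_cell (W e) (t e) q k (i e) (i' e))"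
  unfolding copy_cell_def by (intro FC_list FC_If FC_single FC_Nil FN_lit FN_const FN_add)

lemma FC_write_cell: "FN m W \<Longrightarrow> FN m t \<Longrightarrow> FN m i \<Longrightarrow> FC m (\<lambda>e. write_cell (W e) (t e) q k (i e) s)"
  unfolding write_cell_def by (intro FC_list FC_If FC_single FC_Nil FN_lit FN_const FN_add)

lemma FC_next_state: "FN m W \<Longrightarrow> FN m t \<Longrightarrow> FC m (\<lambda>e. next_state (W e) (t e) q)"
  unfolding next_state_def by (intro FC_list FC_If FC_single FC_Nil FN_lit FN_const FN_add)

lemma FN_tl: "FN m f \<Longrightarrow> FN (Suc m) (\<lambda>e. f (tl e))"
  unfolding FN_def by (rule FP_tl_env)

lemma FC_next_stack:
  assumes "FN m V" "FN m t" shows "FC m (\<lambda>e. next_stack (V e) (t e) q k)"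
proof (cases "if k = stk q then op q else Nop")
  case Nop
  show ?thesis unfolding next_stack_def Nop stack_op.case
    by (intro FC_for FC_copy_cell FN_Suc FN_tl FN_var assms)
next
  case (PushOp s)
  show ?thesis unfolding next_stack_def PushOp stack_op.case
    by (intro FC_append FC_for FC_copy_cell FC_write_cell FN_Suc FN_tl FN_var FN_add FN_const assms)
next
  case PopOp
  show ?thesis unfolding next_stack_def PopOp stack_op.case
    by (intro FC_append FC_for FC_copy_cell FC_write_cell FN_Suc FN_tl FN_var FN_add FN_const assms)
qed

lemma FC_clauses: "FC 3 (\<lambda>e. clauses (ev 0 e) (length (ev 1 e)) (length (ev 2 e)))"
proof -
  let ?V = "\<lambda>e. width (ev 0 e) (length (ev 1 e)) (length (ev 2 e))"
  have V: "FN 3 ?V" unfolding width_def by (intro FN_add FN_var FN_const)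
  have W: "FN 3 (\<lambda>e. Suc (?V e))" by (intro FN_Suc V)
  have Vt: "FN 4 (\<lambda>e. ?V (tl e))" using FN_tl[OF V] by simp
  have Wt: "FN 4 (\<lambda>e. Suc (?V (tl e)))" by (intro FN_Suc Vt)
  have four: "Suc 3 = 4" by simp
  have bit: "FN 4 (\<lambda>e. if hdb (drop (length (ev 0 e)) (ev 0 (tl e))) then 1 else 2)"
    unfolding ev_tl by (intro FN_if FB_hdb FP_drop FN_var FP_ev FN_const)
  have x: "FN 4 (\<lambda>e. length (ev 0 (tl e)))" "FN 4 (\<lambda>e. length (ev 1 (tl e)))"
    unfolding ev_tl by (intro FN_var)+
  show ?thesis
    unfolding clauses_def guess_def initial_def
    apply (intro FC_append)
             apply (rule FC_for, unfold four, intro FC_single FN_lit Wt FN_const FN_var, rule FN_var)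
            apply (rule FC_for, unfold four, intro FC_append FC_single FC_forbid FN_lit Wt FN_const FN_var bit, rule FN_var)
           apply (rule FC_for, unfold four, intro FC_forbid Wt FN_const FN_add x FN_var, intro FN_add FN_var FN_const)
          apply (rule FC_for, unfold four, intro FC_forbid Wt FN_const FN_var, rule FN_var)
         apply (rule FC_for, unfold four, intro FC_forbid Wt FN_const FN_add x FN_var, intro FN_add FN_var FN_const)
        apply (rule FC_list, rule FC_for, unfold four, intro FC_forbid Wt FN_const FN_var, rule W)
       apply (intro FC_forbid W FN_const)
      apply (rule FC_for, unfold four, rule FC_list, rule FC_append, intro FC_next_state Wt FN_var)
       apply (rule FC_list, intro FC_next_stack Vt FN_var, rule FN_var)
     apply (intro FC_forbid W FN_const FN_var)+
    done
qed

lemma FN_nvars: "FP m x \<Longrightarrow> FN m mz \<Longrightarrow> FN m T \<Longrightarrow> FN m (\<lambda>e. nvars (x e) (mz e) (T e))"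
  unfolding nvars_def width_def by (intro FN_add FN_mult FN_const FN_Suc FN_length)

end

subsection \<open>The network\<close>

definition enc_trip :: "(nat \<times> nat) list \<Rightarrow> bool list" where
  "enc_trip T = True # enc_list enc_edge (map unit_edge T)"

definition enc_trip_edges :: "(nat \<times> nat) list \<Rightarrow> bool list" where
  "enc_trip_edges T = concat (map (\<lambda>a. True # enc_edge (unit_edge a)) T)"

text \<open>The encoded input lists the edges of all trips before the trips themselves, so both
  strings have to be produced by the same constructions.\<close>

definition FT :: "nat \<Rightarrow> (bool list list \<Rightarrow> (nat \<times> nat) list list) \<Rightarrow> bool" where
  "FT m F \<longleftrightarrow> FP m (\<lambda>e. concat (map enc_trip (F e))) \<and> FP m (\<lambda>e. concat (map enc_trip_edges (F e)))"

lemma FP_unit_edge: assumes "FN m a" "FN m b" shows "FP m (\<lambda>e. enc_edge (unit_edge (a e, b e)))"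
proof -
  have "FP m (\<lambda>e. enc_nat (a e) @ enc_nat (b e) @ enc_rat 1)"
    by (intro FP_append FP_enc_nat FP_const assms)
  then show ?thesis by (simp add: enc_edge_def unit_edge_def)
qed

lemma FT_Nil: "FT m (\<lambda>e. [])"
  unfolding FT_def by (simp add: FP_const)

lemma FT_append: "FT m f \<Longrightarrow> FT m g \<Longrightarrow> FT m (\<lambda>e. f e @ g e)"
  unfolding FT_def by (simp add: FP_append)

lemma FT_edge: assumes "FN m a" "FN m b" shows "FT m (\<lambda>e. [[(a e, b e)]])"
proof -
  have "FP m (\<lambda>e. True # True # enc_edge (unit_edge (a e, b e)) @ [False])"
    "FP m (\<lambda>e. True # enc_edge (unit_edge (a e, b e)))"
    by (intro FP_Cons FP_append FP_const FP_unit_edge assms)+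
  then show ?thesis unfolding FT_def by (simp add: enc_trip_def enc_trip_edges_def enc_list_def)
qed

lemma FT_edges3:
  assumes "FN m a" "FN m b" "FN m c" "FN m d" "FN m g" "FN m h"
  shows "FT m (\<lambda>e. [[(a e, b e), (c e, d e), (g e, h e)]])"
proof -
  have "FP m (\<lambda>e. True # True # enc_edge (unit_edge (a e, b e)) @ True # enc_edge (unit_edge (c e, d e)) @
      True # enc_edge (unit_edge (g e, h e)) @ [False])"
    "FP m (\<lambda>e. True # enc_edge (unit_edge (a e, b e)) @ True # enc_edge (unit_edge (c e, d e)) @
      True # enc_edge (unit_edge (g e, h e)))"
    by (intro FP_Cons FP_append FP_const FP_unit_edge assms)+
  then show ?thesis unfolding FT_def by (simp add: enc_trip_def enc_trip_edges_def enc_list_def)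
qed

lemma concat_map_concat_map: "concat (map f (concat (map g xs))) = concat (map (\<lambda>x. concat (map f (g x))) xs)"
  by (induction xs) auto

lemma FT_for:
  assumes "FT (Suc m) (\<lambda>e. body (length (ev 0 e)) (tl e))" "FN m n"
  shows "FT m (\<lambda>e. concat (map (\<lambda>i. body i e) [0..<n e]))"
  using FP_for[of m "\<lambda>i e. concat (map enc_trip (body i e))" n]
    FP_for[of m "\<lambda>i e. concat (map enc_trip_edges (body i e))" n] assms
  unfolding FT_def by (simp add: concat_map_concat_map)

lemma FT_if: "FP m (\<lambda>e. [Q e]) \<Longrightarrow> FT m f \<Longrightarrow> FT m g \<Longrightarrow> FT m (\<lambda>e. if Q e then f e else g e)"
  unfolding FT_def if_distrib[of "map enc_trip"] if_distrib[of "map enc_trip_edges"] if_distrib[of concat]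
  by (intro conjI FP_if) auto

text \<open>The node numbering of \<open>csp_net\<close> with its parameters as arguments, because
  in the reduction \<open>nv\<close> and \<open>m\<close> vary with the input.\<close>

definition gX :: "nat \<Rightarrow> nat \<Rightarrow> nat \<Rightarrow> nat \<Rightarrow> nat" where
  "gX nv m l s = nv + m + 2 + l * (3 * m + 1) + s"

definition g0 :: "nat \<Rightarrow> nat \<Rightarrow> nat \<Rightarrow> nat" where
  "g0 D nv m = nv + m + 2 + nv * D * (3 * m + 1)"

text \<open>A copy of \<open>Ts\<close>, trip by trip in the same order, in which literals are
  looked up in the string \<open>w\<close> and which is built only from constructs that
  \<open>FT\<close> covers.\<close>

definition gen_trips :: "nat \<Rightarrow> bool list \<Rightarrow> nat \<Rightarrow> nat \<Rightarrow> nat \<Rightarrow> (nat \<times> nat) list list" where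
  "gen_trips D w nv m K = [[(nv, nv + 1 + 0)]]
   @ concat (map (\<lambda>s. [[(nv + 1 + s div 3, nv + 1 + (s div 3 + 1)), (nv + 1 + (s div 3 + 1), gX nv m (nth_block w s) s),
       (gX nv m (nth_block w s) s, gX nv m (nth_block w s) (s + 1))]]) [0..<3 * m])
   @ concat (map (\<lambda>v. concat (map (\<lambda>a. [[(v, gX nv m (v * D + a) 0)]] @ [[(gX nv m (v * D + a) (3 * m), v + 1)]]) [0..<D])) [0..<nv])
   @ concat (map (\<lambda>l. concat (map (\<lambda>s. if nth_block w s = l then [] else [[(gX nv m l s, gX nv m l (s + 1))]]) [0..<3 * m])) [0..<nv * D])
   @ concat (map (\<lambda>i. [[(g0 D nv m + i, 0)]] @ [[(nv + 1 + m, g0 D nv m + K + i)]]) [0..<K])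
   @ concat (map (\<lambda>v. [[(v, v)]]) [0..<g0 D nv m + 2 * K])"

lemma FN_gX: "FN n a \<Longrightarrow> FN n b \<Longrightarrow> FN n l \<Longrightarrow> FN n s \<Longrightarrow> FN n (\<lambda>e. gX (a e) (b e) (l e) (s e))"
  unfolding gX_def by (intro FN_add FN_mult FN_const)

lemma FN_g0: "FN n a \<Longrightarrow> FN n b \<Longrightarrow> FN n (\<lambda>e. g0 D (a e) (b e))"
  unfolding g0_def by (intro FN_add FN_mult FN_const)

lemma FT_gen_trips: "FT 4 (\<lambda>e. gen_trips D (ev 0 e) (length (ev 1 e)) (length (ev 2 e)) (length (ev 3 e)))"
  unfolding gen_trips_def
  by (intro FT_append FT_edge FT_edges3 FT_for FT_if FT_Nil FB_eq FN_gX FN_g0 FN_nth_block FN_div3 FN_add FN_mult FN_const FN_var FP_ev;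
      (unfold ev_tl)?;
      (intro FN_add FN_mult FN_const FN_var FP_ev)?)

definition gen_input :: "nat \<Rightarrow> bool list \<Rightarrow> nat \<Rightarrow> nat \<Rightarrow> nat \<Rightarrow> bool list" where
  "gen_input D w nv m K = enc_nat (g0 D nv m + 2 * K) @ concat (map enc_trip_edges (gen_trips D w nv m K)) @ [False] @
     concat (map enc_trip (gen_trips D w nv m K)) @ [False]"

lemma FP_gen_input: "FP 4 (\<lambda>e. gen_input D (ev 0 e) (length (ev 1 e)) (length (ev 2 e)) (length (ev 3 e)))"
  unfolding gen_input_def
  by (intro FP_append FP_enc_nat FP_const FN_add FN_g0 FN_mult FN_const FN_var
      FT_gen_trips[unfolded FT_def, THEN conjunct1] FT_gen_trips[unfolded FT_def, THEN conjunct2])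

context csp_net
begin

lemma gen_trips_eq: "gen_trips D (enc_nats CL) nv m K = Ts"
proof -
  have nb: "nth_block (enc_nats CL) s = CL ! s" if "s < 3 * m" for s
    using nth_enc_nats[of s CL] that len by (simp add: nth_block_def)
  have 1: "map (\<lambda>s. [[(nv + 1 + s div 3, nv + 1 + (s div 3 + 1)), (nv + 1 + (s div 3 + 1), gX nv m (nth_block (enc_nats CL) s) s),
       (gX nv m (nth_block (enc_nats CL) s) s, gX nv m (nth_block (enc_nats CL) s) (s + 1))]]) [0..<3 * m] =
      map (\<lambda>s. [slot_trip s]) [0..<3 * m]"
    by (intro map_cong refl) (simp add: nb slot_trip_def nC_def nX_def gX_def)
  have 2: "map (\<lambda>s. if nth_block (enc_nats CL) s = l then [] else [[(gX nv m l s, gX nv m l (s + 1))]]) [0..<3 * m] =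
     map (\<lambda>s. if CL ! s = l then [] else [[(nX l s, nX l (s + 1))]]) [0..<3 * m]" for l
    by (intro map_cong refl) (simp add: nb nX_def gX_def)
  have 3: "gX nv m = nX" "g0 D nv m = N0" "nv + 1 + m = nC m" "N0 + 2 * K = N" "nv + 1 + 0 = nC 0"
    by (auto simp: fun_eq_iff gX_def nX_def g0_def N0_def nC_def N_def)
  show ?thesis unfolding gen_trips_def 1 2 unfolding 3 Ts_def rest_def by simp
qed

lemma gen_input_eq: "gen_input D (enc_nats CL) nv m K = enc_input inst"
proof -
  have e: "concat (map (\<lambda>x. True # enc_edge x) (map unit_edge (concat U))) = concat (map enc_trip_edges U)" for U
    by (induction U) (auto simp: enc_trip_edges_def o_def)
  have t: "concat (map (\<lambda>x. True # enc_list enc_edge x) (map (map unit_edge) U)) = concat (map enc_trip U)" for U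
    by (induction U) (auto simp: enc_trip_def)
  have "g0 D nv m + 2 * K = N" by (simp add: g0_def N0_def N_def)
  then show ?thesis
    unfolding gen_input_def gen_trips_eq enc_input_def inst_def prod.case enc_list_def[of enc_edge "map unit_edge (concat Ts)"]
      enc_list_def[of "enc_list enc_edge"] e t by simp
qed

lemma satisfies_iff:
  assumes "CL = flat cs"
  shows "satisfies f \<longleftrightarrow> (\<forall>v<nv. f v < D) \<and>
    all_of (\<lambda>(a, b, c). \<not> (f (a div D) = a mod D \<and> f (b div D) = b mod D \<and> f (c div D) = c mod D)) cs"
proof -
  have lc: "length cs = m" using len assms by simp
  have *: "(\<exists>p<3. \<not> chosen f (CL ! (3 * j + p))) \<longleftrightarrow>
     (\<lambda>(a, b, c). \<not> (f (a div D) = a mod D \<and> f (b div D) = b mod D \<and> f (c div D) = c mod D)) (cs ! j)" if j: "j < m" for j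
  proof -
    obtain a b c where abc: "cs ! j = (a, b, c)" by (cases "cs ! j") auto
    have n: "CL ! (3 * j + 0) = a" "CL ! (3 * j + 1) = b" "CL ! (3 * j + 2) = c"
      using flat_nth[of j cs a b c] j abc lc assms by auto
    have "(\<exists>p<3. R p) \<longleftrightarrow> R 0 \<or> R 1 \<or> R (2::nat)" for R
      by (auto simp: numeral_3_eq_3 less_Suc_eq numeral_2_eq_2)
    then have "(\<exists>p<3. \<not> chosen f (CL ! (3 * j + p))) \<longleftrightarrow> \<not> chosen f a \<or> \<not> chosen f b \<or> \<not> chosen f c"
      using n by (simp only:)
    then show ?thesis by (simp add: abc chosen_def)
  qed
  show ?thesis unfolding satisfies_def all_of_def all_set_conv_all_nth lc
    by (intro conj_cong refl all_cong1 imp_cong *)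
qed

end

subsection \<open>Certificates of fixed length\<close>

text \<open>Undoes padding with one True followed by any number of False: everything from the last
  True on is removed. Thus certificates of bounded length become strings of one fixed
  length.\<close>

fun unpad :: "bool list \<Rightarrow> bool list" where
  "unpad [] = []"
| "unpad (c # s) = (if True \<in> set s then c # unpad s else [])"

lemma unpad_pad: "unpad (y @ True # replicate n False) = y"
  by (induction y) auto

lemma length_unpad: "length (unpad z) \<le> length z - 1"
proof (induction z)
  case (Cons c z) then show ?case by (cases z) auto
qed simp

fun has_True :: "bool list \<Rightarrow> bool list" where
  "has_True [] = []"
| "has_True (c # s) = (if c then [True] else has_True s)"

lemma hdb_has_True: "hdb (has_True s) \<longleftrightarrow> True \<in> set s"
  by (induction s) auto

lemma FP_has_True: assumes "FP m f" shows "FP m (\<lambda>e. has_True (f e))"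
proof (rule FP_rec[where R = "\<lambda>e. has_True" and n = f and z = "\<lambda>_. []" and g = "\<lambda>c e. if c then [True] else ev 0 e" and C = 1])
  fix e :: "bool list list" and s :: "bool list"
  have "length (has_True s) \<le> 1" by (induction s) auto
  then show "length (has_True s) \<le> (sz e + length s) ^ 1" by (simp add: sz_def)
  show "FP (Suc (Suc m)) (\<lambda>e. if c then [True] else ev 0 e)" for c by (intro FP_If_const FP_const FP_ev)
qed (auto intro: assms FP_const)

lemma FP_unpad: assumes "FP m f" shows "FP m (\<lambda>e. unpad (f e))"
proof (rule FP_rec[where R = "\<lambda>e. unpad" and n = f and z = "\<lambda>_. []" and C = 1 and
      g = "\<lambda>c e. if hdb (has_True (ev 1 e)) then c # ev 0 e else []"])
  fix e :: "bool list list" and s :: "bool list"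
  show "length (unpad s) \<le> (sz e + length s) ^ 1" using length_unpad[of s] by (simp add: sz_def)
  show "FP (Suc (Suc m)) (\<lambda>e. if hdb (has_True (ev 1 e)) then c # ev 0 e else [])" for c
    by (intro FP_if_hdb FP_has_True FP_Cons FP_ev FP_const)
qed (auto intro: assms FP_const simp: hdb_has_True)

lemma FP_enc_pair: "FP m f \<Longrightarrow> FP m g \<Longrightarrow> FP m (\<lambda>e. enc_pair (f e) (g e))"
  unfolding enc_pair_def by (intro FP_append FP_enc_string)

section \<open>The theorem\<close>

lemma P_subset_NP: "P_class \<subseteq> NP_class"
proof
  fix L assume "L \<in> P_class"
  then have "FP 1 (\<lambda>e. [ev 0 e \<in> L])" by (simp add: P_class_iff_FP)
  from FP_comp1[of "\<lambda>x. [x \<in> L]", OF this FP_unstr[OF FP_ev]]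
  have "{w. unstr w \<in> L} \<in> P_class" by (simp add: P_class_iff_FP)
  moreover have "\<forall>x. x \<in> L \<longleftrightarrow> (\<exists>y. length y \<le> poly (0 :: nat poly) (length x) \<and> enc_pair x y \<in> {w. unstr w \<in> L})"
    by (simp add: enc_pair_def)
  ultimately show "L \<in> NP_class" unfolding NP_class_def by blast
qed

text \<open>Without a solution the value is at most \<open>7 * K * N0\<close>, while the
  approximation guarantees \<open>K * K / r N\<close>. As \<open>N \<le> 3 * K\<close>, this would
  make \<open>K powr \<epsilon>\<close> at most linear in \<open>N0\<close>; but the exponent
  \<open>E\<close> makes it at least quadratic in \<open>N0 + c0\<close>.\<close>

lemma ratio_too_large:
  fixes \<epsilon> C :: real and r :: "nat \<Rightarrow> real"
  assumes eps: "0 < \<epsilon>" "\<epsilon> < 1" and r: "0 < r N" "r N \<le> C * real N powr (1 - \<epsilon>)"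
    and C: "0 < C" "21 * C < real c0" and E: "2 \<le> real E * \<epsilon>"
    and K: "K = (N0 + c0) ^ E" and N: "N = N0 + 2 * K" "0 < N0"
    and big: "real (N0 * N + 2 * K * (N0 + 1)) \<ge> 1 / r N * real (K * K)"
  shows False
proof -
  have "E \<noteq> 0" using E by (cases E) auto
  then have "N0 + c0 \<le> K" unfolding K using N(2) self_le_power[of "N0 + c0" E] by simp
  then have NK: "N0 \<le> K" "0 < K" using N(2) by auto
  have N3: "N \<le> 3 * K" using NK N(1) by simp
  have "N0 * N \<le> N0 * (3 * K)" using N3 by (rule mult_left_mono) simp
  then have "N0 * N \<le> 3 * (K * N0)" by (simp only: ac_simps)
  moreover have "K \<le> K * N0" using N(2) by simp
  moreover have "2 * K * (N0 + 1) = 2 * (K * N0) + 2 * K" by (simp add: algebra_simps)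
  ultimately have "N0 * N + 2 * K * (N0 + 1) \<le> 7 * (K * N0)" by linarith
  then have "real (N0 * N + 2 * K * (N0 + 1)) \<le> 7 * (real K * real N0)"
    by (metis of_nat_le_iff of_nat_mult of_nat_numeral)
  with big have "1 / r N * (real K * real K) \<le> 7 * (real K * real N0)" by simp
  then have "real K * real K \<le> 7 * (real K * real N0) * r N" using r(1) by (simp add: field_simps)
  then have "real K * real K \<le> real K * (7 * real N0 * r N)" by (simp add: algebra_simps)
  then have "real K \<le> 7 * real N0 * r N" using NK(2) by simp
  also have "\<dots> \<le> 7 * real N0 * (C * real N powr (1 - \<epsilon>))" using r(2) by (intro mult_left_mono) auto
  also have "\<dots> \<le> 7 * real N0 * (C * (3 * real K powr (1 - \<epsilon>)))"
  proof -
    have "real N powr (1 - \<epsilon>) \<le> (3 * real K) powr (1 - \<epsilon>)" using N3 eps by (intro powr_mono2) auto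
    also have "\<dots> = 3 powr (1 - \<epsilon>) * real K powr (1 - \<epsilon>)" by (simp add: powr_mult)
    also have "3 powr (1 - \<epsilon>) \<le> (3::real) powr 1" using eps by (intro powr_mono) auto
    finally have "real N powr (1 - \<epsilon>) \<le> 3 * real K powr (1 - \<epsilon>)"
      by (simp add: mult_right_mono order.trans)
    then show ?thesis using C(1) by (intro mult_left_mono) auto
  qed
  \<comment> \<open>The factor 21 is 7 from the count of pairs times 3 from
    \<open>N \<le> 3 * K\<close>.\<close>
  finally have 1: "real K \<le> (21 * C * real N0) * real K powr (1 - \<epsilon>)" by (simp add: algebra_simps)
  have "real K = real K powr \<epsilon> * real K powr (1 - \<epsilon>)" using NK(2) by (simp flip: powr_add)
  with 1 have "real K powr \<epsilon> * real K powr (1 - \<epsilon>) \<le> (21 * C * real N0) * real K powr (1 - \<epsilon>)" by simp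
  then have 2: "real K powr \<epsilon> \<le> 21 * C * real N0" using NK(2) by simp
  have "real (N0 + c0) ^ 2 = real (N0 + c0) powr 2" using N(2) by (simp add: powr_numeral)
  also have "\<dots> \<le> real (N0 + c0) powr (real E * \<epsilon>)" using E N(2) by (intro powr_mono) auto
  also have "\<dots> = real K powr \<epsilon>" unfolding K using N(2)
    by (simp add: powr_powr[symmetric] powr_realpow)
  finally have "real (N0 + c0) * real (N0 + c0) \<le> 21 * C * real N0" using 2 by (simp add: power2_eq_square)
  moreover have "21 * C * real N0 < real (N0 + c0) * real (N0 + c0)"
    using C N(2) by (intro mult_strict_mono) auto
  ultimately show False by simp
qed

theorem theorem2:
  fixes \<epsilon> :: real and r :: "nat \<Rightarrow> real"
  assumes "P_class \<noteq> NP_class"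
    and "0 < \<epsilon>" and "\<epsilon> < 1"
    and "\<And>n. 0 < r n"
    and "mono r"
    and "r \<in> O(\<lambda>n. real n powr (1 - \<epsilon>))"
  shows "\<not> (\<exists>M. poly_time_approximation r M)"
proof
  assume "\<exists>M. poly_time_approximation r M"
  then obtain M p where M: "is_tm M"
    and approx: "\<And>I. is_trip_network (network_of I) \<Longrightarrow> \<exists>ts :: rat list.
           length ts = length (trips (network_of I)) \<and>
           outputs_within M (poly p (length (enc_input I))) (enc_input I) (enc_list enc_rat ts) \<and>
           real (temporal_reachability (network_of I) (\<lambda>i. of_rat (ts ! i)))
             \<ge> 1 / r (card (nodes (network_of I))) * real (max_reachability (network_of I))"
    unfolding poly_time_approximation_def by blast
  obtain C where C: "0 < C" "eventually (\<lambda>n. norm (r n) \<le> C * norm (real n powr (1 - \<epsilon>))) at_top"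
    using assms(6) by (elim landau_o.bigE)
  then obtain n0 where n0: "\<And>n. n0 \<le> n \<Longrightarrow> r n \<le> C * real n powr (1 - \<epsilon>)"
    unfolding eventually_at_top_linorder using assms(4) by (auto simp: less_imp_le)
  obtain c1 :: nat where c1: "21 * C < real c1" using reals_Archimedean2 by blast
  \<comment> \<open>The part \<open>c1\<close> outweighs the constants of the gap; the part
    \<open>n0\<close> ensures that every network is so large that the asymptotic bound on
    \<open>r\<close> applies.\<close>
  define c0 where "c0 = c1 + n0"
  have c0: "21 * C < real c0" "n0 \<le> c0" using c1 by (auto simp: c0_def)
  obtain E :: nat where "2 / \<epsilon> < real E" using reals_Archimedean2 by blast
  then have E: "2 \<le> real E * \<epsilon>" using assms(2) by (simp add: field_simps)
  have "L \<in> P_class" if L: "L \<in> NP_class" for L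
  proof -
    obtain V q where V: "V \<in> P_class" and Lq: "\<And>x. x \<in> L \<longleftrightarrow> (\<exists>y. length y \<le> poly q (length x) \<and> enc_pair x y \<in> V)"
      using L unfolding NP_class_def by blast
    have FV: "FP 1 (\<lambda>e. [ev 0 e \<in> V])" using V by (simp add: P_class_iff_FP)
    have FN2: "FP 2 (\<lambda>e. [enc_pair (ev 0 e) (unpad (ev 1 e)) \<in> V])"
      by (rule FP_comp1[of "\<lambda>x. [x \<in> V]", OF FV]) (intro FP_enc_pair FP_unpad FP_ev)
    obtain P A1 T1 where P: "wf_prog A1 P" "pbd 2 T1"
      "\<And>\<sigma> e. \<forall>k\<ge>3. \<sigma> k = [] \<Longrightarrow> map \<sigma> [0, 1] = map bits e \<Longrightarrow>
        runs P \<sigma> (T1 e) (\<sigma>(2 := bits [enc_pair (ev 0 e) (unpad (ev 1 e)) \<in> V] @ \<sigma> 2))"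
      by (rule FP_E[OF FN2, of "[0, 1]" 3 2]) auto
    define A where "A = max A1 3"
    have A: "wf_prog A P" "3 \<le> A" "0 < A" using P(1) by (auto simp: A_def intro: wf_prog_mono)
    obtain Q stk op nxt h where sm: "stack_machine A Q stk op nxt h" and
      run: "\<And>\<sigma> t \<sigma>'. ok_store A \<sigma> \<Longrightarrow> exec P \<sigma> t \<sigma>' \<Longrightarrow> (sm_step stk op nxt ^^ t) (0, \<sigma>) = (h, \<sigma>')"
      using stack_machine_exists[OF A(1,3)] by (elim exE conjE) blast
    interpret tb: tableau A Q stk op nxt h by unfold_locales (rule sm, rule A(2))
    obtain c where c: "\<And>e. length e = 2 \<Longrightarrow> T1 e \<le> sz e ^ c" using P(2) unfolding pbd_def by blast
    \<comment> \<open>One symbol more than the longest certificate, for the True of the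
      padding.\<close>
    define mz where "mz x = poly q (length x) + 1" for x :: "bool list"
    define T where "T x = (length x + mz x + 2) ^ c" for x
    have acc: "tb.accepts x z (T x) \<longleftrightarrow> enc_pair x (unpad z) \<in> V" if z: "length z = mz x" for x z
    proof -
      let ?b = "enc_pair x (unpad z) \<in> V"
      have ok: "ok_store A (tb.start x z)" using tb.conf_ok[of x z 0] by (simp add: tb.conf_def)
      have "runs P (tb.start x z) (T1 [x, z]) ((tb.start x z)(2 := bits [enc_pair (ev 0 [x, z]) (unpad (ev 1 [x, z])) \<in> V] @ tb.start x z 2))"
        by (rule P(3)) (auto simp: tb.start_def)
      then obtain t where t: "t \<le> T1 [x, z]" "exec P (tb.start x z) t ((tb.start x z)(2 := bits [?b]))"
        by (auto simp: runs_def tb.start_def)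
      have "T1 [x, z] \<le> T x" using c[of "[x, z]"] z by (simp add: T_def sz_def add.assoc)
      then obtain k where k: "T x = k + t" using t(1) by (metis le_add_diff_inverse2 le_trans)
      have "tb.conf x z (T x) = (h, (tb.start x z)(2 := bits [?b]))"
        unfolding tb.conf_def k funpow_add o_apply run[OF ok t(2)] by (rule sm_halted[OF sm])
      then show ?thesis by (simp add: tb.accepts_def bit_symbol_def)
    qed
    define cs where "cs x = tb.clauses x (mz x) (T x)" for x
    define nv where "nv x = tb.nvars x (mz x) (T x)" for x
    define K where "K x = (g0 tb.D (nv x) (length (cs x)) + c0) ^ E" for x
    have net: "csp_net tb.D (nv x) (length (cs x)) (flat (cs x))" for x
    proof
      show "0 < tb.D" by (rule tb.D_pos)
      show "length (flat (cs x)) = 3 * length (cs x)" by simp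
      fix l assume "l \<in> set (flat (cs x))"
      then show "l < nv x * tb.D"
        using tb.clauses_lit_bound[of x "mz x" "T x"] by (fastforce simp: flat_set all_of_def cs_def nv_def)
    qed
    define I where "I x = csp_net.inst tb.D (nv x) (length (cs x)) (K x) (flat (cs x))" for x
    have input: "gen_input tb.D (enc_nats (flat (cs x))) (nv x) (length (cs x)) (K x) = enc_input (I x)" for x
      unfolding I_def by (rule csp_net.gen_input_eq[OF net])
    define good where "good x ts \<longleftrightarrow> length ts = length (trips (network_of (I x))) \<and>
           outputs_within M (poly p (length (enc_input (I x)))) (enc_input (I x)) (enc_list enc_rat ts) \<and>
           real (temporal_reachability (network_of (I x)) (\<lambda>i. of_rat (ts ! i)))
             \<ge> 1 / r (card (nodes (network_of (I x)))) * real (max_reachability (network_of (I x)))"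
      for x and ts :: "rat list"
    have "\<exists>ts. good x ts" for x
      unfolding good_def I_def by (intro approx csp_net.is_trip_network_net[OF net])
    \<comment> \<open>Any choice will do: by \<open>good\<close>, the encoding of
      \<open>ts x\<close> is an output of \<open>M\<close>, which makes it computable in
      \<open>Fts\<close>.\<close>
    then obtain ts where ts: "\<And>x. good x (ts x)" by metis
    \<comment> \<open>Trip 0 is the bridge, and trip \<open>Suc (3 * i)\<close> belongs to the
      literal that gives cell \<open>i\<close> the value 2, that is, True.\<close>
    define cert where "cert x = map (\<lambda>i. ts x ! Suc (3 * i) < ts x ! 0) [0..<mz x]" for x
    have len_ts: "length (ts x) = length (csp_net.Ts tb.D (nv x) (length (cs x)) (K x) (flat (cs x)))" for x
    proof -
      interpret csp_net tb.D "nv x" "length (cs x)" "K x" "flat (cs x)" by (rule net)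
      show ?thesis using ts[of x] unfolding good_def I_def net_simps by simp
    qed
    have len3: "3 * mz x < length (ts x)" for x
    proof -
      interpret csp_net tb.D "nv x" "length (cs x)" "K x" "flat (cs x)" by (rule net)
      have "mz x \<le> length (cs x)" using tb.guess_nth(4)[of "mz x - 1" "mz x" x "T x"] by (simp add: cs_def mz_def)
      then show ?thesis unfolding len_ts length_Ts by simp
    qed
    have complete: "enc_pair x (unpad (cert x)) \<in> V" if x: "x \<in> L" for x
    proof -
      interpret csp_net tb.D "nv x" "length (cs x)" "K x" "flat (cs x)" by (rule net)
      obtain y where y: "length y \<le> poly q (length x)" "enc_pair x y \<in> V" using x Lq by blast
      define z where "z = y @ True # replicate (mz x - length y - 1) False"
      have z: "length z = mz x" "unpad z = y" using y(1) unpad_pad by (auto simp: z_def mz_def)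
      have "tb.accepts x z (T x)" using acc[OF z(1)] z(2) y(2) by simp
      from tb.clauses_complete[OF z(1) this]
      have "satisfies (tb.assignment x z (Suc (tb.width x (mz x) (T x))))"
        unfolding satisfies_iff[OF refl] using tb.truth_less by (auto simp: tb.assignment_def cs_def)
      then have large: "K x * K x \<le> max_reachability net" by (rule max_reachability_large)
      define \<tau> :: "nat \<Rightarrow> real" where "\<tau> i = of_rat (ts x ! i)" for i
      have "1 / r N * real (max_reachability net) \<le> real (temporal_reachability net \<tau>)"
        using ts[of x] unfolding good_def I_def net_simps \<tau>_def by simp
      moreover have "1 / r N * real (K x * K x) \<le> 1 / r N * real (max_reachability net)"
        using large assms(4)[of N] by (intro mult_left_mono) (auto simp del: of_nat_mult)
      ultimately have reach: "1 / r N * real (K x * K x) \<le> real (temporal_reachability net \<tau>)" by linarith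
      have g0: "g0 tb.D (nv x) (length (cs x)) = N0" by (simp add: g0_def N0_def)
      have KE: "K x = (N0 + c0) ^ E" by (simp add: K_def g0)
      have N0: "0 < N0" by (simp add: N0_def)
      have "chosen_upto \<tau> (nv x) (\<tau> 0) \<and> late \<tau> (length (cs x))"
      \<comment> \<open>Since \<open>x \<in> L\<close>, the optimum is at least
        \<open>K x * K x\<close>; a temporalisation without a solution would miss it by more than
        the factor \<open>r N\<close>.\<close>
      proof (rule ccontr)
        assume "\<not> ?thesis"
        then have "temporal_reachability net \<tau> \<le> N0 * N + 2 * K x * (N0 + 1)" by (rule reachability_small)
        with reach have big: "1 / r N * real (K x * K x) \<le> real (N0 * N + 2 * K x * (N0 + 1))"
          by (meson of_nat_le_iff order.trans)
        have "E \<noteq> 0" using E by (cases E) auto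
        then have "N0 + c0 \<le> K x" unfolding KE using N0 self_le_power[of "N0 + c0" E] by simp
        then have "n0 \<le> N" using c0(2) by (simp add: N_def)
        from ratio_too_large[where r = r and N = N, OF assms(2,3) assms(4) n0[OF this] C(1) c0(1) E KE N_def N0 big] show False .
      qed
      then obtain f where f: "satisfies f"
        "\<And>s. s < 3 * length (cs x) \<Longrightarrow> chosen f (flat (cs x) ! s) \<Longrightarrow> \<tau> (Suc s) < \<tau> 0"
        "\<And>j. j < length (cs x) \<Longrightarrow> \<exists>p<3. \<tau> 0 \<le> \<tau> (Suc (3 * j + p))"
        by (rule solution_of_network) (rule that)
      have fD: "\<And>v. v < tb.nvars x (mz x) (T x) \<Longrightarrow> f v < tb.D" and fs: "all_of (tb.sat_by f) (tb.clauses x (mz x) (T x))"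
        using f(1)[unfolded satisfies_iff[OF refl]] by (auto simp: nv_def cs_def)
      let ?g = "\<lambda>i. f (tb.vr (Suc (tb.width x (mz x) (T x))) 0 1 i)"
      have sound: "tb.accepts x (map (\<lambda>i. ?g i = 2) [0..<mz x]) (T x)" "\<And>i. i < mz x \<Longrightarrow> ?g i = 1 \<or> ?g i = 2"
        using tb.clauses_sound[of x "mz x" "T x" f] fD fs by blast+
      \<comment> \<open>For the value 2, the trip of the first slot must start before the bridge.
        For the value 1 the trips of the other two slots do, so the first slot is the one that
        starts late enough.\<close>
      have "(ts x ! Suc (3 * i) < ts x ! 0) \<longleftrightarrow> ?g i = 2" if i: "i < mz x" for i
      proof -
        note gn = tb.guess_nth[OF i, of x "T x", folded cs_def]
        have il: "3 * i < 3 * length (cs x)" "3 * i + 1 < 3 * length (cs x)" "3 * i + 2 < 3 * length (cs x)" using gn(4) by auto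
        have lt: "(ts x ! Suc (3 * i) < ts x ! 0) \<longleftrightarrow> \<tau> (Suc (3 * i)) < \<tau> 0" by (simp add: \<tau>_def of_rat_less)
        have D2: "1 < tb.D" "2 < tb.D" using tb.D_pos(3) by auto
        show ?thesis
        proof (cases "?g i = 2")
          case True
          then have "chosen f (flat (cs x) ! (3 * i))" unfolding chosen_def gn using D2 by simp
          then show ?thesis using f(2)[OF il(1)] lt True by simp
        next
          case False
          then have g1: "?g i = 1" using sound(2)[OF i] by simp
          then have "chosen f (flat (cs x) ! (3 * i + 1))" "chosen f (flat (cs x) ! (3 * i + 2))"
            unfolding chosen_def gn using D2 by simp_all
          then have l12: "\<tau> (Suc (3 * i + 1)) < \<tau> 0" "\<tau> (Suc (3 * i + 2)) < \<tau> 0" using f(2) il by blast+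
          obtain p where p: "p < 3" "\<tau> 0 \<le> \<tau> (Suc (3 * i + p))" using f(3)[OF gn(4)] by blast
          then have "p \<noteq> 1" "p \<noteq> 2" using l12 by auto
          then have "p = 0" using p(1) by linarith
          then show ?thesis using p(2) lt False by simp
        qed
      qed
      then have "cert x = map (\<lambda>i. ?g i = 2) [0..<mz x]" by (simp add: cert_def)
      then have "tb.accepts x (cert x) (T x)" using sound(1) by simp
      then show ?thesis using acc[of "cert x" x] by (simp add: cert_def)
    qed
    \<comment> \<open>The network is irrelevant here: the verifier has accepted a string that is
      short enough to be a certificate.\<close>
    have sound: "x \<in> L" if "enc_pair x (unpad (cert x)) \<in> V" for x
    proof -
      have "length (unpad (cert x)) \<le> poly q (length x)"
        using length_unpad[of "cert x"] by (simp add: cert_def mz_def)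
      then show ?thesis using that Lq by blast
    qed
    have Fmz: "FN 1 (\<lambda>e. mz (ev 0 e))" unfolding mz_def by (intro FN_add FN_poly FN_length FP_ev FN_const)
    have FT: "FN 1 (\<lambda>e. T (ev 0 e))" unfolding T_def by (intro FN_power FN_add FN_length FP_ev FN_const Fmz)
    have Fcs: "FP 1 (\<lambda>e. enc_nats (flat (cs (ev 0 e))))"
      unfolding cs_def
      by (rule FP_comp_clauses[OF tb.FC_clauses[unfolded FC_def]]) (intro FP_ev Fmz FT)+
    have Fnv: "FN 1 (\<lambda>e. nv (ev 0 e))" unfolding nv_def by (intro tb.FN_nvars FP_ev Fmz FT)
    \<comment> \<open>Three literals, hence three blocks, for each clause.\<close>
    have Fm: "FN 1 (\<lambda>e. length (cs (ev 0 e)))"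
      using FN_div3[OF FN_count_blocks[OF Fcs]] by simp
    have FK: "FN 1 (\<lambda>e. K (ev 0 e))" unfolding K_def by (intro FN_power FN_add FN_g0 FN_const Fnv Fm)
    have Fin: "FP 1 (\<lambda>e. enc_input (I (ev 0 e)))"
      unfolding input[symmetric] by (rule FP_comp_network[OF FP_gen_input Fcs Fnv Fm FK])
    have Fts: "FP 1 (\<lambda>e. enc_list enc_rat (ts (ev 0 e)))"
      by (rule FP_turing_machine[OF M Fin]) (use ts in \<open>auto simp: good_def\<close>)
    have less: "less_rat (nth_rat (enc_list enc_rat (ts x)) (Suc (3 * i))) (nth_rat (enc_list enc_rat (ts x)) 0) \<longleftrightarrow>
        ts x ! Suc (3 * i) < ts x ! 0" if "i < mz x" for x i
    proof -
      have "Suc (3 * i) < length (ts x)" "0 < length (ts x)" using len3[of x] that by auto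
      then show ?thesis using nth_rat_enc[of "Suc (3 * i)" "ts x"] nth_rat_enc[of 0 "ts x"] less_rat_enc by fastforce
    qed
    have "FP 1 (\<lambda>e. concat (map (\<lambda>i. [less_rat (nth_rat (enc_list enc_rat (ts (ev 0 e))) (Suc (3 * i)))
        (nth_rat (enc_list enc_rat (ts (ev 0 e))) 0)]) [0..<mz (ev 0 e)]))"
      by (intro FP_for FB_less_rat FP_nth_rat FP_tl_env[OF Fts] FN_Suc FN_mult FN_const FN_var Fmz)
    moreover have "concat (map (\<lambda>i. [less_rat (nth_rat (enc_list enc_rat (ts x)) (Suc (3 * i)))
        (nth_rat (enc_list enc_rat (ts x)) 0)]) [0..<mz x]) = cert x" for x
      unfolding cert_def concat_map_singleton using less by (intro map_cong) auto
    ultimately have Fcert: "FP 1 (\<lambda>e. cert (ev 0 e))" by simp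
    have "FP 1 (\<lambda>e. [enc_pair (ev 0 e) (unpad (cert (ev 0 e))) \<in> V])"
      by (rule FP_comp1[of "\<lambda>x. [x \<in> V]", OF FV]) (intro FP_enc_pair FP_unpad FP_ev Fcert)
    moreover have "enc_pair x (unpad (cert x)) \<in> V \<longleftrightarrow> x \<in> L" for x using complete sound by blast
    ultimately show "L \<in> P_class" by (simp add: P_class_iff_FP)
  qed
  then have "NP_class \<subseteq> P_class" by blast
  then show False using P_subset_NP assms(1) by blast
qed

end
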